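(* Let $m\ge 1$, let $V\subset\mathbb{R}^m$ be a centrally symmetric (with respect to the origin) closed convex body satisfying the $\Pi$-condition, let $p\in(0,\infty)$, and let $\alpha_j\ge 0$, $\beta_j\ge -1/2$, $1\le j\le m$. Then $$\lim_{a\to\infty}a^{-\left(m+\sum_{j=1}^m\alpha_j\right)/p}\,\mathcal{N}_0\left(\mathcal{P}_{aV},L_{p,\prod_{j=1}^m|t_j|^{\alpha_j}(1-t_j^2)^{\beta_j}}(Q^m)\right)=\mathcal{N}_0\left(B_V\cap L_{p,\prod_{j=1}^m|t_j|^{\alpha_j}}(\mathbb{R}^m),\,L_{p,\prod_{j=1}^m|t_j|^{\alpha_j}}(\mathbb{R}^m)\right).$$ In addition, there exists a function $f_0\in\left(B_V\cap L_{p,\prod_{j=1}^m|t_j|^{\alpha_j}}(\mathbb{R}^m)\right)\setminus\{0\}$ such that $$\lim_{a\to\infty}a^{-\left(m+\sum_{j=1}^m\alpha_j\right)/p}\,\mathcal{N}_0\left(\mathcal{P}_{aV},L_{p,\prod_{j=1}^m|t_j|^{\alpha_j}(1-t_j^2)^{\beta_j}}(Q^m)\right)=|f_0(0)|\,/\,\|f_0\|_{L_{p,\prod_{j=1}^m|t_j|^{\alpha_j}}(\mathbb{R}^m)}.$$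
   Context: $Q^m=[-1,1]^m\subset\mathbb{R}^m$. A convex body is a compact convex set with nonempty interior. $V$ satisfies the $\Pi$-condition if for every $t\in V\setminus\{0\}$ the set $\{s\in\mathbb{R}^m:|s_j|\le|t_j|,\,1\le j\le m\}$ is contained in $V$. For a measurable $\Omega\subseteq\mathbb{R}^m$ and a locally integrable weight $W:\Omega\to[0,\infty]$, $L_{r,W}(\Omega)$, $0<r<\infty$, is the space of measurable $F:\Omega\to\mathbb{C}$ with $\|F\|_{L_{r,W}(\Omega)}:=\left(\int_\Omega|F(t)|^rW(t)\,dt\right)^{1/r}<\infty$; the weight in the subscript is written as a function of the variable $t\in\Omega$. For a subspace $B$ of $L_{p,W}(\Omega)$ ($\Omega$ closed, $0\in\Omega$), $$\mathcal{N}_{0}(B,L_{p,W}(\Omega)):=\sup_{h\in B\setminus\{0\}}\frac{|h(0)|}{\|h\|_{L_{p,W}(\Omega)}}.$$ For a real $a\ge0$, $\mathcal{P}_{aV}$ is the set of all polynomials $P(x)=\sum_{k\in aV\cap\mathbb{Z}^m_+}c_kx^k$ in $m$ variables with complex coefficients, where $\mathbb{Z}^m_+$ is the set of integer points with nonnegative coordinates and $x^k=x_1^{k_1}\cdots x_m^{k_m}$. For $z\in\mathbb{C}^m$ let $\|z\|_V^*:=\sup_{t\in V}\left|\sum_{j=1}^mt_jz_j\right|$. $B_V$ is the set of all entire functions $f:\mathbb{C}^m\to\mathbb{C}$ of exponential type $V$, i.e. such that for every $\varepsilon>0$ there is a constant $C_0(\varepsilon,f)>0$ with $|f(z)|\le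 C_0(\varepsilon,f)\exp\left((1+\varepsilon)\|z\|_V^*\right)$ for all $z\in\mathbb{C}^m$. A function $f\in B_V$ is identified with its restriction to $\mathbb{R}^m$ when writing $B_V\cap L_{p,W}(\mathbb{R}^m)$. *)

theory Defs
  imports "HOL-Analysis.Analysis"
begin

text \<open>
  The dimension \<open>m \<ge> 1\<close> is the cardinality of the finite index type \<open>'n\<close>: \<open>real ^ 'n\<close> is the real
  and \<open>complex ^ 'n\<close> the complex \<open>m\<close>-dimensional space.
\<close>

definition cube :: "(real ^ 'n) set" where
  "cube = {t. \<forall>j. \<bar>t $ j\<bar> \<le> 1}"

definition convex_body :: "(real ^ 'n) set \<Rightarrow> bool" where
  "convex_body V \<longleftrightarrow> compact V \<and> convex V \<and> interior V \<noteq> {}"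

definition centrally_symmetric :: "(real ^ 'n) set \<Rightarrow> bool" where
  "centrally_symmetric V \<longleftrightarrow> (\<forall>t\<in>V. - t \<in> V)"

definition Pi_condition :: "(real ^ 'n) set \<Rightarrow> bool" where
  "Pi_condition V \<longleftrightarrow> (\<forall>t \<in> V - {0}. {s. \<forall>j. \<bar>s $ j\<bar> \<le> \<bar>t $ j\<bar>} \<subseteq> V)"


subsection \<open>Weighted spaces\<close>

text \<open>
  The norm takes the value \<open>\<infinity>\<close> where the integral diverges (\<open>enn2real \<infinity>\<close> would be \<open>0\<close>).
\<close>

definition Lnorm ::
  "real \<Rightarrow> (real ^ 'n \<Rightarrow> ennreal) \<Rightarrow> (real ^ 'n) set \<Rightarrow> (real ^ 'n \<Rightarrow> complex) \<Rightarrow> ennreal" where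
  "Lnorm r W \<Omega> F =
    (let I = (\<integral>\<^sup>+ t. ennreal (cmod (F t) powr r) * W t \<partial>(lebesgue_on \<Omega>))
     in if I = \<infinity> then \<infinity> else ennreal (enn2real I powr (1 / r)))"

definition Lspace ::
  "real \<Rightarrow> (real ^ 'n \<Rightarrow> ennreal) \<Rightarrow> (real ^ 'n) set \<Rightarrow> (real ^ 'n \<Rightarrow> complex) set" where
  "Lspace r W \<Omega> = {F. F \<in> borel_measurable (lebesgue_on \<Omega>) \<and> Lnorm r W \<Omega> F < \<infinity>}"

text \<open>
  \<open>\<N>\<^sub>0(B, L\<^bsub>p,W\<^esub>(\<Omega>))\<close>, with values in \<open>[0,\<infinity>]\<close>. A function on \<open>\<Omega>\<close> is represented by a total function
  whose values off \<open>\<Omega>\<close> are irrelevant, so \<open>h \<noteq> 0\<close> means that \<open>h\<close> does not vanish identically on \<open>\<Omega>\<close>.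
\<close>

definition N0 ::
  "(real ^ 'n \<Rightarrow> complex) set \<Rightarrow> real \<Rightarrow> (real ^ 'n \<Rightarrow> ennreal) \<Rightarrow> (real ^ 'n) set \<Rightarrow> ennreal" where
  "N0 B p W \<Omega> = (SUP h \<in> {h \<in> B. \<exists>t\<in>\<Omega>. h t \<noteq> 0}. ennreal (cmod (h 0)) / Lnorm p W \<Omega> h)"


subsection \<open>The power weights\<close>

text \<open>
  The power \<open>x\<^sup>b\<close> of \<open>x \<ge> 0\<close> with values in \<open>[0,\<infinity>]\<close>: here \<open>0\<^sup>0 = 1\<close> and \<open>0\<^sup>b = \<infinity>\<close> for \<open>b < 0\<close>,
  whereas \<open>0 powr b = 0\<close> for every \<open>b\<close>.
\<close>

definition epow :: "real \<Rightarrow> real \<Rightarrow> ennreal" where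
  "epow x b = (if x = 0 then (if b < 0 then \<infinity> else if b = 0 then 1 else 0) else ennreal (x powr b))"

definition power_weight :: "('n::finite \<Rightarrow> real) \<Rightarrow> real ^ 'n \<Rightarrow> ennreal" where
  "power_weight \<alpha> t = (\<Prod>j\<in>UNIV. epow \<bar>t $ j\<bar> (\<alpha> j))"

definition jacobi_weight :: "('n::finite \<Rightarrow> real) \<Rightarrow> ('n \<Rightarrow> real) \<Rightarrow> real ^ 'n \<Rightarrow> ennreal" where
  "jacobi_weight \<alpha> \<beta> t = (\<Prod>j\<in>UNIV. epow \<bar>t $ j\<bar> (\<alpha> j) * epow (1 - (t $ j)\<^sup>2) (\<beta> j))"


subsection \<open>Polynomials and entire functions of exponential type\<close>

text \<open>
  \<open>\<P>\<^bsub>aV\<^esub>\<close>, as functions on the real space. The index set of the sum is finite for bounded \<open>V\<close>.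
\<close>

definition lattice_points :: "(real ^ 'n) set \<Rightarrow> (nat ^ 'n) set" where
  "lattice_points S = {k. (\<chi> j. real (k $ j)) \<in> S}"

definition polys :: "real \<Rightarrow> (real ^ 'n) set \<Rightarrow> (real ^ 'n \<Rightarrow> complex) set" where
  "polys a V =
    {P. \<exists>c :: nat ^ 'n \<Rightarrow> complex. P = (\<lambda>x.
      \<Sum>k \<in> lattice_points ((\<lambda>v. a *\<^sub>R v) ` V). c k * (\<Prod>j\<in>UNIV. complex_of_real (x $ j) ^ (k $ j)))}"

text \<open>
  An entire function on the complex space: at each point the (real) Frechet derivative exists and is
  complex linear.
\<close>

definition entire :: "(complex ^ 'n \<Rightarrow> complex) \<Rightarrow> bool" where
  "entire f \<longleftrightarrow> (\<forall>z. \<exists>D. (f has_derivative D) (at z) \<and> (\<forall>c v. D (c *s v) = c * D v))"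

definition dual_norm :: "(real ^ 'n) set \<Rightarrow> complex ^ 'n \<Rightarrow> real" where
  "dual_norm V z = (SUP t\<in>V. cmod (\<Sum>j\<in>UNIV. complex_of_real (t $ j) * z $ j))"

definition exp_type :: "(real ^ 'n) set \<Rightarrow> (complex ^ 'n \<Rightarrow> complex) set" where
  "exp_type V = {f. entire f \<and>
    (\<forall>\<epsilon>>0. \<exists>C>0. \<forall>z. cmod (f z) \<le> C * exp ((1 + \<epsilon>) * dual_norm V z))}"

definition real_restriction :: "(complex ^ 'n \<Rightarrow> complex) \<Rightarrow> real ^ 'n \<Rightarrow> complex" where
  "real_restriction f x = f (\<chi> j. complex_of_real (x $ j))"

text \<open>\<open>B\<^sub>V \<inter> L\<^bsub>p,W\<^esub>\<close> over the whole real space, each function in it being identified with its restriction.\<close>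

definition BL :: "(real ^ 'n) set \<Rightarrow> real \<Rightarrow> (real ^ 'n \<Rightarrow> ennreal) \<Rightarrow> (real ^ 'n \<Rightarrow> complex) set" where
  "BL V p W = real_restriction ` exp_type V \<inter> Lspace p W UNIV"

end

theory Submission
  imports Defs "HOL-Complex_Analysis.Complex_Analysis" "HOL-Real_Asymp.Real_Asymp" "HOL-Library.Diagonal_Subsequence"
begin

text \<open>
  Write \<open>E\<close> for the supremum over the entire functions, \<open>q = m + \<Sum>\<^sub>j \<alpha>\<^sub>j\<close>, and \<open>M a\<close> for \<open>a\<^bsup>-q/p\<^esup>\<close> times the supremum over the
  polynomials.  The power weight is homogeneous, so the dilation \<open>t = x / a\<close> turns the cube into a cube of side
  \<open>2 a\<close>, the weight \<open>\<Prod>\<^sub>j (1 - t\<^sub>j\<^sup>2)\<^bsup>\<beta>\<^sub>j\<^esup>\<close> into one that tends to \<open>1\<close>, and polynomials with exponents in \<open>a V\<close> into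
  functions that resemble entire functions of exponential type \<open>V\<close>.  Two facts make this precise.

  The upper limit of \<open>M\<close> is at most \<open>E\<close>.  The substitution \<open>t\<^sub>j = sin \<theta>\<^sub>j\<close> turns a polynomial \<open>P\<close> with exponents in \<open>a V\<close>
  into an exponential sum in \<open>\<theta>\<close>, whose frequencies lie in \<open>a V\<close> by the \<Pi>-condition.  Such a sum varies
  on the scale \<open>1 / a\<close> by a Bernstein-type inequality, which follows from the theorem of Phragmen and Lindelof, so its
  maximum is controlled by the weighted norm of \<open>P\<close> (\<open>nikolskii\<close>).  Rescaled, these sums are uniformly bounded on the
  real space and locally equicontinuous on the complex space; a subsequence converges to an entire function of
  type \<open>V\<close> (\<open>expsum_compactness\<close>), and Fatou's lemma passes to the limit in the integral
  (\<open>limit_of_rescaled_polynomials\<close>).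

  The lower limit of \<open>M\<close> is at least \<open>E\<close>.  A function \<open>f\<close> in the weighted space is bounded on the real space
  (\<open>bounded_of_finite_norm\<close>).  Then \<open>f(\<sigma> a sin \<theta>)\<close>, \<open>\<sigma> < 1\<close>, is a periodic entire function of \<open>\<theta>\<close> whose Fourier
  coefficients outside \<open>\<tau> a V\<close>, \<open>\<sigma> < \<tau> < 1\<close>, are exponentially small; dropping these leaves a
  polynomial in \<open>sin \<theta>\<close> with an exponentially small error (\<open>polynomial_approximation\<close>).  A fixed power of
  \<open>\<Prod>\<^sub>j (1 - t\<^sub>j\<^sup>2)\<close> removes the effect of the \<open>\<beta>\<^sub>j\<close> near the faces of the cube (\<open>lower_estimate\<close>).

  The compactness argument also gives the extremal function: applied to nearly extremal polynomials it yields a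
  function whose quotient is \<open>E\<close>.  That \<open>E\<close> is positive is seen from powers of \<open>sin z / z\<close>.
\<close>

no_notation fps_nth (infixl \<open>$\<close> 75)

section \<open>Entire functions of one variable\<close>

lemma le_of_powers_le:
  fixes a M c :: real
  assumes "0 < M" "\<And>n. a ^ n \<le> M ^ n * c"
  shows "a \<le> M"
proof (rule ccontr)
  assume "\<not> a \<le> M"
  then have "1 < a / M" using assms(1) by simp
  then obtain n where n: "c < (a / M) ^ n" using real_arch_pow by blast
  have "(a / M) ^ n \<le> c" using assms(2)[of n] assms(1) by (simp add: power_divide field_simps)
  with n show False by simp
qed

text \<open>On the sector between the real axis and the line \<open>Im z = \<kappa> s Re z\<close> the function \<open>Re (b z\<^sup>2)\<close>, \<open>b = 1 - i s \<kappa>\<close>, is at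
  least \<open>\<bar>z\<bar>\<^sup>2\<close>.  So \<open>exp (- \<delta> b z\<^sup>2)\<close> absorbs the exponential growth, the maximum principle applies on a large
  truncated sector, and \<open>\<delta>\<close> tends to \<open>0\<close>.  The sign \<open>s\<close> selects the sector next to the positive or to the negative
  half-axis.\<close>
lemma bounded_on_sector:
  fixes G :: "complex \<Rightarrow> complex" and s :: real
  assumes hol: "G holomorphic_on UNIV"
    and growth: "\<And>z. cmod (G z) \<le> C * exp (a * cmod z)"
    and s: "s = 1 \<or> s = -1" and "0 < \<kappa>" "0 < K"
    and bdry: "\<And>z. 0 \<le> s * Re z \<Longrightarrow> Im z = 0 \<or> Im z = \<kappa> * (s * Re z) \<Longrightarrow> cmod (G z) \<le> K"
    and w: "0 \<le> Im w" "Im w \<le> \<kappa> * (s * Re w)"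
  shows "cmod (G w) \<le> K"
proof (cases "Im w = 0 \<or> Im w = \<kappa> * (s * Re w)")
  case True
  have "0 \<le> s * Re w" using w \<open>0 < \<kappa>\<close> by (metis mult_nonneg_nonneg order_trans zero_le_mult_iff less_le_not_le)
  then show ?thesis using True bdry by blast
next
  case False
  have *: "cmod (G w) \<le> K * exp (\<delta> * (2 + \<kappa>) * (cmod w)\<^sup>2)" if "0 < \<delta>" for \<delta>
  proof -
    define b where "b = Complex 1 (- s * \<kappa>)"
    define H where "H z = G z * exp (- of_real \<delta> * b * z\<^sup>2)" for z
    have Rb: "Re (b * z\<^sup>2) = (Re z)\<^sup>2 - (Im z)\<^sup>2 + 2 * (\<kappa> * (s * Re z)) * Im z" for z
      by (simp add: b_def power2_eq_square algebra_simps)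
    have Hn: "cmod (H z) = cmod (G z) * exp (- \<delta> * Re (b * z\<^sup>2))" for z
      by (simp add: H_def norm_mult algebra_simps)
    have low: "(cmod z)\<^sup>2 \<le> Re (b * z\<^sup>2)" if "0 \<le> Im z" "Im z \<le> \<kappa> * (s * Re z)" for z
    proof -
      have "Im z * Im z \<le> (\<kappa> * (s * Re z)) * Im z" using that by (intro mult_right_mono)
      then show ?thesis unfolding Rb cmod_power2 by (simp add: power2_eq_square)
    qed
    have ev: "((\<lambda>R. C * exp (a * R - \<delta> * R\<^sup>2)) \<longlongrightarrow> 0) at_top" using \<open>0 < \<delta>\<close> by real_asymp
    have "\<forall>\<^sub>F R in at_top. C * exp (a * R - \<delta> * R\<^sup>2) < K" using order_tendstoD(2)[OF ev \<open>0 < K\<close>] .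
    then obtain R where R: "C * exp (a * R - \<delta> * R\<^sup>2) < K" "cmod w < R"
      using eventually_conj[OF _ eventually_gt_at_top[of "cmod w"]] eventually_happens'[of at_top] by (metis (mono_tags, lifting) trivial_limit_at_top_linorder)
    define S where "S = {z. 0 < Im z \<and> Im z < \<kappa> * (s * Re z) \<and> cmod z < R}"
    define S' where "S' = {z. 0 \<le> Im z \<and> Im z \<le> \<kappa> * (s * Re z) \<and> cmod z \<le> R}"
    have oS: "open S" unfolding S_def
      by (intro open_Collect_conj open_Collect_less continuous_intros)
    have cS': "closed S'" unfolding S'_def
      by (intro closed_Collect_conj closed_Collect_le continuous_intros)
    have SS': "closure S \<subseteq> S'" by (rule closure_minimal[OF _ cS']) (auto simp: S_def S'_def)
    have holH: "H holomorphic_on A" for A unfolding H_def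
      by (intro holomorphic_intros holomorphic_on_subset[OF hol]) auto
    have Gl: "cmod (H z) \<le> cmod (G z) * exp (- \<delta> * (cmod z)\<^sup>2)" if "z \<in> S'" for z
      unfolding Hn using low[of z] that \<open>0 < \<delta>\<close> by (intro mult_left_mono) (auto simp: S'_def)
    have "cmod (H w) \<le> K"
    proof (rule maximum_modulus_frontier[of H S])
      show "H holomorphic_on interior S" by (rule holH)
      show "continuous_on (closure S) H" using holH holomorphic_on_imp_continuous_on by blast
      show "bounded S" unfolding S_def by (rule bounded_subset[OF bounded_ball[of 0 R]]) auto
      show "w \<in> S" using w False R unfolding S_def by auto
      fix z assume "z \<in> frontier S"
      then have z: "z \<in> S'" "z \<notin> S" using SS' oS by (auto simp: frontier_def interior_open)
      have e1: "exp (- \<delta> * (cmod z)\<^sup>2) \<le> 1" using \<open>0 < \<delta>\<close> by simp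
      consider "Im z = 0 \<or> Im z = \<kappa> * (s * Re z)" | "cmod z = R" using z unfolding S_def S'_def by force
      then show "cmod (H z) \<le> K"
      proof cases
        case 1
        have "0 \<le> \<kappa> * (s * Re z)" using z(1) by (auto simp: S'_def)
        then have "0 \<le> s * Re z" using \<open>0 < \<kappa>\<close> by (simp add: zero_le_mult_iff)
        from bdry[OF this 1] have "cmod (G z) \<le> K" .
        then have "cmod (G z) * exp (- \<delta> * (cmod z)\<^sup>2) \<le> K * 1" using e1 \<open>0 < K\<close> by (intro mult_mono) auto
        then show ?thesis using Gl[OF z(1)] by simp
      next
        case 2
        have "cmod (H z) \<le> C * exp (a * cmod z) * exp (- \<delta> * (cmod z)\<^sup>2)"
          using Gl[OF z(1)] growth[of z] by (meson exp_ge_zero mult_right_mono order_trans)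
        also have "\<dots> = C * exp (a * R - \<delta> * R\<^sup>2)" using 2 by (simp add: exp_diff exp_minus divide_inverse)
        finally show ?thesis using R by simp
      qed
    qed
    then have "cmod (G w) \<le> K * exp (\<delta> * Re (b * w\<^sup>2))"
      unfolding Hn by (simp add: exp_minus field_simps del: times_complex.sel)
    also have "Re (b * w\<^sup>2) \<le> (2 + \<kappa>) * (cmod w)\<^sup>2"
    proof -
      have "Re (b * w\<^sup>2) \<le> cmod b * (cmod w)\<^sup>2" by (metis complex_Re_le_cmod norm_mult norm_power)
      moreover have "cmod b \<le> 2 + \<kappa>" unfolding b_def using cmod_le[of "Complex 1 (- s * \<kappa>)"] s \<open>0 < \<kappa>\<close> by auto
      ultimately show ?thesis by (meson mult_right_mono order_trans zero_le_power2)
    qed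
    finally show ?thesis using \<open>0 < \<delta>\<close> \<open>0 < K\<close> by (simp add: mult_ac)
  qed
  have "((\<lambda>\<delta>. K * exp (\<delta> * (2 + \<kappa>) * (cmod w)\<^sup>2)) \<longlongrightarrow> K * exp (0 * (2 + \<kappa>) * (cmod w)\<^sup>2)) (at_right 0)"
    by (intro tendsto_intros)
  then have "cmod (G w) \<le> K * exp (0 * (2 + \<kappa>) * (cmod w)\<^sup>2)"
    by (rule tendsto_lowerbound) (use * in \<open>auto simp: eventually_at_filter\<close>)
  then show ?thesis by simp
qed

text \<open>A function that is merely bounded in the half-plane already obeys its boundary bound there: \<open>G\<^sup>n / (z + i)\<close>
  vanishes at infinity, so the maximum principle bounds it by \<open>M\<^sup>n\<close>, and the \<open>n\<close>-th roots of the remaining factor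
  \<open>\<bar>w + i\<bar>\<close> disappear.\<close>
lemma bounded_halfplane_max:
  assumes hol: "G holomorphic_on UNIV"
    and K: "\<And>z. 0 \<le> Im z \<Longrightarrow> cmod (G z) \<le> K"
    and M: "\<And>z. Im z = 0 \<Longrightarrow> cmod (G z) \<le> M" and "0 < M"
    and w: "0 \<le> Im w"
  shows "cmod (G w) \<le> M"
proof (cases "Im w = 0")
  case False
  with w have w: "0 < Im w" by simp
  have "cmod (G w) ^ n \<le> M ^ n * cmod (w + \<i>)" for n
  proof -
    define H where "H z = G z ^ n / (z + \<i>)" for z
    define R where "R = cmod w + 1 + K ^ n / M ^ n + 1"
    have "0 \<le> K" using K[of 0] norm_ge_zero order_trans by (metis order_refl zero_complex.sel(2))
    then have q: "0 \<le> K ^ n / M ^ n" using \<open>0 < M\<close> by simp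
    have R: "cmod w < R" "K ^ n / M ^ n \<le> R - 1" "1 < R"
      unfolding R_def using q norm_ge_zero[of w] by linarith+
    note R1 = R(3)
    define S where "S = {z. 0 < Im z \<and> cmod z < R}"
    have oS: "open S" unfolding S_def by (intro open_Collect_conj open_Collect_less continuous_intros)
    have SS': "closure S \<subseteq> {z. 0 \<le> Im z \<and> cmod z \<le> R}"
      by (rule closure_minimal) (auto simp: S_def intro!: closed_Collect_conj closed_Collect_le continuous_intros)
    have ge1: "1 \<le> cmod (z + \<i>)" if "0 \<le> Im z" for z
      using abs_Im_le_cmod[of "z + \<i>"] that by simp
    have holH: "H holomorphic_on A" if "A \<subseteq> {z. 0 \<le> Im z}" for A unfolding H_def
      using ge1 that by (intro holomorphic_intros holomorphic_on_subset[OF hol]) (auto, fastforce)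
    have "cmod (H w) \<le> M ^ n"
    proof (rule maximum_modulus_frontier[of H S])
      show "H holomorphic_on interior S" by (rule holH) (use interior_subset[of S] in \<open>auto simp: S_def\<close>)
      show "continuous_on (closure S) H" using SS' by (intro holomorphic_on_imp_continuous_on holH) auto
      show "bounded S" unfolding S_def by (rule bounded_subset[OF bounded_ball[of 0 R]]) auto
      show "w \<in> S" using w R unfolding S_def by auto
      fix z assume "z \<in> frontier S"
      then have z: "0 \<le> Im z" "cmod z \<le> R" "z \<notin> S" using SS' oS by (auto simp: frontier_def interior_open)
      then consider "Im z = 0" | "cmod z = R" unfolding S_def by force
      then show "cmod (H z) \<le> M ^ n"
      proof cases
        case 1
        have "cmod (H z) \<le> cmod (G z) ^ n / 1" unfolding H_def norm_divide norm_power
          using ge1[OF z(1)] by (intro divide_left_mono) auto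
        also have "\<dots> \<le> M ^ n" using M[OF 1] by (simp add: power_mono)
        finally show ?thesis .
      next
        case 2
        have "R - 1 \<le> cmod (z + \<i>)" using norm_triangle_ineq2[of z "- \<i>"] 2 by simp
        then have "cmod (H z) \<le> cmod (G z) ^ n / (R - 1)" unfolding H_def norm_divide norm_power
          using R1 by (intro divide_left_mono) (auto intro!: mult_pos_pos)
        also have "\<dots> \<le> K ^ n / (R - 1)" using K[OF z(1)] R1 by (intro divide_right_mono power_mono) auto
        also have "\<dots> \<le> M ^ n" using R(2) R1 \<open>0 < M\<close> by (simp add: field_simps)
        finally show ?thesis .
      qed
    qed
    moreover have "0 < cmod (w + \<i>)" using ge1[of w] w by linarith
    ultimately show ?thesis unfolding H_def norm_divide norm_power
      by (simp only: pos_divide_le_eq)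
  qed
  then show ?thesis using le_of_powers_le[OF \<open>0 < M\<close>] by blast
qed (use M in auto)

text \<open>In the steep directions, where \<open>D Im z\<close> exceeds \<open>A \<bar>z\<bar>\<close>, the factor \<open>exp (i D z)\<close> compensates the growth of \<open>g\<close>.
  The directions left over form two sectors along the real axis; on these the bound comes from
  \<open>bounded_on_sector\<close>, and \<open>bounded_halfplane_max\<close> replaces the resulting constant by \<open>M\<close>.\<close>
lemma phragmen_lindelof_upper:
  assumes hol: "g holomorphic_on UNIV"
    and growth: "\<And>z. cmod (g z) \<le> C * exp (A * cmod z)"
    and M: "\<And>t. cmod (g (of_real t)) \<le> M" and "0 < M" and "0 \<le> A" "A < D"
    and w: "0 \<le> Im w"
  shows "cmod (g w) \<le> M * exp (D * Im w)"
proof -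
  define G where "G z = g z * exp (\<i> * of_real D * z)" for z
  have nG: "cmod (G z) = cmod (g z) * exp (- D * Im z)" for z by (simp add: G_def norm_mult)
  have C0: "0 \<le> C" using order_trans[OF norm_ge_zero growth[of 0]] by simp
  have holG: "G holomorphic_on UNIV" unfolding G_def by (intro holomorphic_intros hol)
  define \<kappa> where "\<kappa> = A / sqrt (D\<^sup>2 - A\<^sup>2) + 1"
  have DA: "0 < D\<^sup>2 - A\<^sup>2" using \<open>0 \<le> A\<close> \<open>A < D\<close> by (simp add: power_strict_mono)
  have k: "0 < \<kappa>" "A\<^sup>2 \<le> \<kappa>\<^sup>2 * (D\<^sup>2 - A\<^sup>2)"
  proof -
    show "0 < \<kappa>" unfolding \<kappa>_def using \<open>0 \<le> A\<close> DA by (simp add: add_nonneg_pos)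
    have "A \<le> \<kappa> * sqrt (D\<^sup>2 - A\<^sup>2)" unfolding \<kappa>_def using DA by (simp add: field_simps)
    then have "A\<^sup>2 \<le> (\<kappa> * sqrt (D\<^sup>2 - A\<^sup>2))\<^sup>2" using \<open>0 \<le> A\<close> by (intro power_mono)
    then show "A\<^sup>2 \<le> \<kappa>\<^sup>2 * (D\<^sup>2 - A\<^sup>2)" using DA by (simp add: power_mult_distrib)
  qed
  have steep: "cmod (G z) \<le> C" if "0 \<le> Im z" "\<kappa> * \<bar>Re z\<bar> \<le> Im z" for z
  proof -
    have "(\<kappa> * \<bar>Re z\<bar>)\<^sup>2 \<le> (Im z)\<^sup>2" using that k by (intro power_mono) auto
    then have x: "\<kappa>\<^sup>2 * (Re z)\<^sup>2 \<le> (Im z)\<^sup>2" by (simp add: power_mult_distrib)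
    have "\<kappa>\<^sup>2 * (A\<^sup>2 * (Re z)\<^sup>2) = A\<^sup>2 * (\<kappa>\<^sup>2 * (Re z)\<^sup>2)" by simp
    also have "\<dots> \<le> A\<^sup>2 * (Im z)\<^sup>2" using x by (intro mult_left_mono) auto
    also have "\<dots> \<le> \<kappa>\<^sup>2 * (D\<^sup>2 - A\<^sup>2) * (Im z)\<^sup>2" using k by (intro mult_right_mono) auto
    finally have "\<kappa>\<^sup>2 * (A\<^sup>2 * (Re z)\<^sup>2) \<le> \<kappa>\<^sup>2 * ((D\<^sup>2 - A\<^sup>2) * (Im z)\<^sup>2)" by (simp add: mult_ac)
    then have "A\<^sup>2 * (Re z)\<^sup>2 \<le> (D\<^sup>2 - A\<^sup>2) * (Im z)\<^sup>2" using k(1) by simp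
    then have "(A * cmod z)\<^sup>2 \<le> (D * Im z)\<^sup>2" by (simp add: power_mult_distrib cmod_power2 algebra_simps)
    then have le: "A * cmod z \<le> D * Im z" using that \<open>0 \<le> A\<close> \<open>A < D\<close> by (intro power2_le_imp_le[of "A * cmod z"]) auto
    have "cmod (G z) \<le> C * exp (A * cmod z) * exp (- D * Im z)" unfolding nG using growth by (intro mult_right_mono) auto
    also have "\<dots> = C * exp (A * cmod z - D * Im z)" by (simp add: exp_diff exp_minus divide_inverse)
    also have "\<dots> \<le> C * 1" using le C0 by (intro mult_left_mono) auto
    finally show ?thesis by simp
  qed
  have real: "cmod (G z) \<le> M" if "Im z = 0" for z
  proof -
    have "of_real (Re z) = z" using that by (simp add: complex_eq_iff)
    then show ?thesis using M[of "Re z"] that by (simp add: nG)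
  qed
  define K where "K = max M C"
  have gG: "cmod (G z) \<le> C * exp ((A + D) * cmod z)" for z
  proof -
    have "cmod (G z) \<le> C * exp (A * cmod z) * exp (- D * Im z)" unfolding nG using growth by (intro mult_right_mono) auto
    also have "\<dots> \<le> C * exp (A * cmod z) * exp (D * cmod z)"
    proof -
      have "D * (- Im z) \<le> D * cmod z" using abs_Im_le_cmod[of z] \<open>0 \<le> A\<close> \<open>A < D\<close> by (intro mult_left_mono) linarith+
      then show ?thesis using C0 by (intro mult_left_mono) auto
    qed
    finally show ?thesis by (simp add: exp_add ring_distribs mult_ac)
  qed
  have bdd: "cmod (G z) \<le> K" if z: "0 \<le> Im z" for z
  proof (cases "\<kappa> * \<bar>Re z\<bar> \<le> Im z")
    case True
    then show ?thesis using steep[OF z] by (simp add: K_def)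
  next
    case False
    define s where "s = (if 0 \<le> Re z then 1 else -1 :: real)"
    have s: "s * Re z = \<bar>Re z\<bar>" "s = 1 \<or> s = -1" by (auto simp: s_def)
    show ?thesis
    proof (rule bounded_on_sector[OF holG gG s(2) k(1)])
      show "0 < K" using \<open>0 < M\<close> by (simp add: K_def)
      show "0 \<le> Im z" "Im z \<le> \<kappa> * (s * Re z)" using z False s by auto
      fix z assume "0 \<le> s * Re z" "Im z = 0 \<or> Im z = \<kappa> * (s * Re z)"
      moreover from this s(2) have "s * Re z = \<bar>Re z\<bar>" by auto
      ultimately show "cmod (G z) \<le> K" using steep[of z] real[of z] k(1) by (auto simp: K_def)
    qed
  qed
  have "cmod (G w) \<le> M" by (rule bounded_halfplane_max[OF holG bdd real \<open>0 < M\<close> w])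
  then show ?thesis by (simp add: nG exp_minus field_simps)
qed

lemma holomorphic_on_uminus_argument: "g holomorphic_on UNIV \<Longrightarrow> (\<lambda>z. g (- z)) holomorphic_on UNIV"
  using holomorphic_on_compose[of uminus UNIV g] holomorphic_on_subset[of g UNIV "range uminus"] holomorphic_on_minus[OF holomorphic_on_ident]
  by (simp add: o_def)

theorem phragmen_lindelof_exponential_type:
  assumes hol: "g holomorphic_on UNIV"
    and growth: "\<And>z. cmod (g z) \<le> C * exp (A * cmod z)"
    and M: "\<And>t. cmod (g (of_real t)) \<le> M" and "0 \<le> A" "A < D"
  shows "cmod (g w) \<le> M * exp (D * \<bar>Im w\<bar>)"
proof -
  have *: "cmod (g w) \<le> (M + e) * exp (D * \<bar>Im w\<bar>)" if "0 < e" for e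
  proof (cases "0 \<le> Im w")
    case True
    have M': "cmod (g (of_real t)) \<le> M + e" for t using M[of t] \<open>0 < e\<close> by linarith
    have "0 < M + e" using M[of 0] \<open>0 < e\<close> by (smt (verit) norm_ge_zero)
    from phragmen_lindelof_upper[OF hol growth M' this assms(4,5) True] show ?thesis using True by simp
  next
    case False
    have M': "cmod (g (- of_real t)) \<le> M + e" for t using M[of "- t"] \<open>0 < e\<close> by simp
    have "0 < M + e" using M[of 0] \<open>0 < e\<close> by (smt (verit) norm_ge_zero)
    moreover have "(\<lambda>z. g (- z)) holomorphic_on UNIV"
      by (rule holomorphic_on_uminus_argument[OF hol])
    moreover have "cmod (g (- z)) \<le> C * exp (A * cmod z)" for z using growth[of "- z"] by simp
    ultimately show ?thesis using phragmen_lindelof_upper[of "\<lambda>z. g (- z)" C A "M + e" D "- w"] M' assms(4,5) False by simp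
  qed
  show ?thesis
  proof (rule field_le_epsilon)
    fix e :: real assume "0 < e"
    then show "cmod (g w) \<le> M * exp (D * \<bar>Im w\<bar>) + e"
      using *[of "e / exp (D * \<bar>Im w\<bar>)"] by (simp add: algebra_simps)
  qed
qed

text \<open>A local version, in which the function is controlled on a segment of the real axis only.  The multiplier
  \<open>exp (- (4 A / r) z\<^sup>2 + 7 i A z)\<close> has modulus at most one on the segment.  It outweighs the growth \<open>exp (5 A r / 2)\<close>
  on the rest of the boundary of the rectangle \<open>[- r, r] \<times> [0, r / 2]\<close>: on the vertical sides through the Gaussian
  factor, which is at most \<open>exp (- 3 A r)\<close>, and on the upper side through \<open>exp (- 7 A r / 2)\<close>, of which the Gaussian factor gives back at
  most \<open>exp (A r)\<close>.  Undoing it in the unit disc costs \<open>exp ((4 + 7) A)\<close>.\<close>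
lemma segment_bound_near_centre_upper:
  assumes hol: "g holomorphic_on UNIV"
    and growth: "\<And>z. cmod (g z) \<le> C * exp (A * (r + cmod z))"
    and m: "\<And>t. \<bar>t\<bar> \<le> r \<Longrightarrow> cmod (g (of_real t)) \<le> m"
    and "0 \<le> A" "2 \<le> r" and w: "cmod w \<le> 1" "0 \<le> Im w"
  shows "cmod (g w) \<le> max m C * exp (11 * A)"
proof -
  define G where "G z = g z * exp (- of_real (4 * A / r) * z\<^sup>2 + \<i> * of_real (7 * A) * z)" for z
  have nG: "cmod (G z) = cmod (g z) * exp (- (4 * A / r) * ((Re z)\<^sup>2 - (Im z)\<^sup>2) - 7 * A * Im z)" for z
    by (simp add: G_def norm_mult power2_eq_square)
  have holG: "G holomorphic_on X" for X unfolding G_def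
    by (rule holomorphic_on_subset[of _ UNIV]) (intro holomorphic_intros hol, auto)
  have C0: "0 \<le> C" using order_trans[OF norm_ge_zero growth[of 0]] by (simp add: zero_le_mult_iff)
  define S where "S = cbox (Complex (- r) 0) (Complex r (r / 2))"
  have Si: "z \<in> S \<longleftrightarrow> \<bar>Re z\<bar> \<le> r \<and> 0 \<le> Im z \<and> Im z \<le> r / 2" for z
    by (auto simp: S_def in_cbox_complex_iff)
  have gS: "cmod (g z) \<le> C * exp (A * (5/2 * r))" if "z \<in> S" for z
  proof -
    have "cmod z \<le> r + r / 2" using cmod_le[of z] that unfolding Si by linarith
    then have "A * (r + cmod z) \<le> A * (5/2 * r)" using \<open>0 \<le> A\<close> by (intro mult_left_mono) auto
    then show ?thesis using growth[of z] C0 by (smt (verit) exp_le_cancel_iff mult_left_mono)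
  qed
  have "cmod (G w) \<le> max m C"
  proof (rule maximum_modulus_frontier[of G S])
    show "G holomorphic_on interior S" by (rule holG)
    show "continuous_on (closure S) G" using holG holomorphic_on_imp_continuous_on by blast
    show "bounded S" by (simp add: S_def bounded_cbox)
    show "w \<in> S" unfolding Si using w abs_Re_le_cmod[of w] abs_Im_le_cmod[of w] \<open>2 \<le> r\<close> by linarith
    fix z assume "z \<in> frontier S"
    then have z: "z \<in> S" "z \<notin> box (Complex (- r) 0) (Complex r (r / 2))"
      unfolding S_def frontier_def by (auto simp: interior_cbox closed_cbox)
    have big: "cmod (G z) \<le> C" if "5/2 * (A * r) - (4 * A / r) * ((Re z)\<^sup>2 - (Im z)\<^sup>2) - 7 * A * Im z \<le> 0"
    proof -
      have "cmod (G z) \<le> C * exp (A * (5/2 * r)) * exp (- (4 * A / r) * ((Re z)\<^sup>2 - (Im z)\<^sup>2) - 7 * A * Im z)"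
        unfolding nG using gS[OF z(1)] by (intro mult_right_mono) auto
      also have "\<dots> = C * exp (5/2 * (A * r) - (4 * A / r) * ((Re z)\<^sup>2 - (Im z)\<^sup>2) - 7 * A * Im z)"
        by (simp add: exp_add[symmetric] mult_ac)
      also have "\<dots> \<le> C * 1" using that C0 by (intro mult_left_mono) auto
      finally show ?thesis by simp
    qed
    have sq: "(Im z)\<^sup>2 \<le> (r/2)\<^sup>2" using z(1) unfolding Si by (intro power_mono) auto
    consider "Im z = 0" | "\<bar>Re z\<bar> = r" | "Im z = r / 2" using z unfolding Si in_box_complex_iff by force
    then show "cmod (G z) \<le> max m C"
    proof cases
      case 1
      have "cmod (G z) \<le> cmod (g z) * 1" unfolding nG 1 using \<open>0 \<le> A\<close> \<open>2 \<le> r\<close> by (intro mult_left_mono) auto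
      moreover have "cmod (g z) \<le> m" using m[of "Re z"] z(1) 1 unfolding Si by (simp add: complex_is_Real_iff[symmetric] of_real_Re)
      ultimately show ?thesis by simp
    next
      case 2
      then have "(Re z)\<^sup>2 = r\<^sup>2" by (metis power2_abs)
      then have "3/4 * r\<^sup>2 \<le> (Re z)\<^sup>2 - (Im z)\<^sup>2" using sq by (simp add: power_divide)
      then have "(4 * A / r) * (3/4 * r\<^sup>2) \<le> (4 * A / r) * ((Re z)\<^sup>2 - (Im z)\<^sup>2)"
        using \<open>0 \<le> A\<close> \<open>2 \<le> r\<close> by (intro mult_left_mono) auto
      moreover have "(4 * A / r) * (3/4 * r\<^sup>2) = 3 * (A * r)" using \<open>2 \<le> r\<close> by (simp add: power2_eq_square)
      moreover have "0 \<le> A * r" "0 \<le> A * Im z" using \<open>0 \<le> A\<close> \<open>2 \<le> r\<close> z(1) by (auto simp: Si)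
      ultimately have "cmod (G z) \<le> C" by (intro big) linarith
      then show ?thesis by simp
    next
      case 3
      have "- ((Re z)\<^sup>2 - (Im z)\<^sup>2) \<le> (r/2)\<^sup>2" using sq by (smt (verit) zero_le_power2)
      then have "(4 * A / r) * (- ((Re z)\<^sup>2 - (Im z)\<^sup>2)) \<le> (4 * A / r) * (r/2)\<^sup>2"
        using \<open>0 \<le> A\<close> \<open>2 \<le> r\<close> by (intro mult_left_mono) auto
      moreover have "(4 * A / r) * (r/2)\<^sup>2 = A * r" using \<open>2 \<le> r\<close> by (simp add: power2_eq_square)
      moreover have "7 * A * Im z = 7/2 * (A * r)" using 3 by simp
      ultimately have "cmod (G z) \<le> C" by (intro big) linarith
      then show ?thesis by simp
    qed
  qed
  have "cmod (g w) = cmod (G w) * exp ((4 * A / r) * ((Re w)\<^sup>2 - (Im w)\<^sup>2) + 7 * A * Im w)"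
    unfolding nG by (simp add: exp_add[symmetric] mult.assoc del: exp_add)
  also have "\<dots> \<le> max m C * exp ((4 * A / r) * ((Re w)\<^sup>2 - (Im w)\<^sup>2) + 7 * A * Im w)"
    using \<open>cmod (G w) \<le> max m C\<close> by (intro mult_right_mono) auto
  also have "\<dots> \<le> max m C * exp (11 * A)"
  proof -
    have "\<bar>Re w\<bar>\<^sup>2 \<le> 1\<^sup>2" using w abs_Re_le_cmod[of w] by (intro power_mono) auto
    then have "(Re w)\<^sup>2 - (Im w)\<^sup>2 \<le> r" using \<open>2 \<le> r\<close> zero_le_power2[of "Im w"] unfolding power2_abs power_one by linarith
    then have "(4 * A / r) * ((Re w)\<^sup>2 - (Im w)\<^sup>2) \<le> (4 * A / r) * r" using \<open>0 \<le> A\<close> \<open>2 \<le> r\<close> by (intro mult_left_mono) auto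
    also have "\<dots> = 4 * A" using \<open>2 \<le> r\<close> by simp
    finally have "(4 * A / r) * ((Re w)\<^sup>2 - (Im w)\<^sup>2) \<le> 4 * A" .
    moreover have "A * Im w \<le> A * 1" using w abs_Im_le_cmod[of w] \<open>0 \<le> A\<close> by (intro mult_left_mono) auto
    ultimately have "(4 * A / r) * ((Re w)\<^sup>2 - (Im w)\<^sup>2) + 7 * A * Im w \<le> 11 * A" by linarith
    then show ?thesis using C0 by (intro mult_left_mono) (auto simp: le_max_iff_disj)
  qed
  finally show ?thesis .
qed

lemma segment_bound_near_centre:
  assumes hol: "g holomorphic_on UNIV"
    and growth: "\<And>z. cmod (g z) \<le> C * exp (A * (r + cmod z))"
    and m: "\<And>t. \<bar>t\<bar> \<le> r \<Longrightarrow> cmod (g (of_real t)) \<le> m"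
    and "0 \<le> A" "2 \<le> r" and w: "cmod w \<le> 1"
  shows "cmod (g w) \<le> max m C * exp (11 * A)"
proof (cases "0 \<le> Im w")
  case True
  then show ?thesis using segment_bound_near_centre_upper assms by blast
next
  case False
  have "(\<lambda>z. g (- z)) holomorphic_on UNIV"
    by (rule holomorphic_on_uminus_argument[OF hol])
  moreover have "cmod (g (- z)) \<le> C * exp (A * (r + cmod z))" for z using growth[of "- z"] by simp
  moreover have "cmod (g (- of_real t)) \<le> m" if "\<bar>t\<bar> \<le> r" for t using m[of "- t"] that by simp
  ultimately show ?thesis
    using segment_bound_near_centre_upper[of "\<lambda>z. g (- z)" C A r m "- w"] assms False by simp
qed

lemma deriv_bound_unit_disc:
  assumes hol: "g holomorphic_on UNIV" and B: "\<And>w. cmod (w - z) \<le> 1 \<Longrightarrow> cmod (g w) \<le> B"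
  shows "cmod (deriv g z) \<le> B"
proof -
  have "cmod ((deriv ^^ 1) g z) \<le> fact 1 * B / 1 ^ 1"
    using B by (intro Cauchy_inequality holomorphic_on_subset[OF hol] holomorphic_on_imp_continuous_on)
      (auto simp: norm_minus_commute)
  then show ?thesis by simp
qed

section \<open>Scaled bodies, weighted integrals and complex vectors\<close>

abbreviation scaled :: "real \<Rightarrow> (real ^ 'n) set \<Rightarrow> (real ^ 'n) set" where
  "scaled a S \<equiv> (\<lambda>v. a *\<^sub>R v) ` S"

text \<open>The degree of homogeneity of the measure with density \<open>power_weight \<alpha>\<close>: dilating by \<open>b\<close> multiplies it by \<open>b\<close> to
  this power.\<close>
abbreviation homogeneity :: "('n::finite \<Rightarrow> real) \<Rightarrow> real" where
  "homogeneity \<alpha> \<equiv> real CARD('n) + (\<Sum>j\<in>UNIV. \<alpha> j)"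

abbreviation power_integral :: "real \<Rightarrow> ('n \<Rightarrow> real) \<Rightarrow> (real ^ 'n \<Rightarrow> complex) \<Rightarrow> ennreal" where
  "power_integral p \<alpha> F \<equiv> \<integral>\<^sup>+ t. ennreal (cmod (F t) powr p) * power_weight \<alpha> t \<partial>lborel"

abbreviation jacobi_integral ::
  "real \<Rightarrow> ('n \<Rightarrow> real) \<Rightarrow> ('n \<Rightarrow> real) \<Rightarrow> (real ^ 'n \<Rightarrow> complex) \<Rightarrow> ennreal" where
  "jacobi_integral p \<alpha> \<beta> F \<equiv>
    \<integral>\<^sup>+ t. ennreal (cmod (F t) powr p) * jacobi_weight \<alpha> \<beta> t * indicator cube t \<partial>lborel"

definition cx :: "real ^ 'n \<Rightarrow> complex ^ 'n" where "cx x = (\<chi> j. complex_of_real (x $ j))"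
definition re_vec :: "complex ^ 'n \<Rightarrow> real ^ 'n" where "re_vec z = (\<chi> j. Re (z $ j))"
definition im_vec :: "complex ^ 'n \<Rightarrow> real ^ 'n" where "im_vec z = (\<chi> j. Im (z $ j))"

lemma cx_nth [simp]: "cx x $ j = complex_of_real (x $ j)" by (simp add: cx_def)
lemma re_vec_nth [simp]: "re_vec z $ j = Re (z $ j)" by (simp add: re_vec_def)
lemma im_vec_nth [simp]: "im_vec z $ j = Im (z $ j)" by (simp add: im_vec_def)
lemma cx_0 [simp]: "cx 0 = 0" by (simp add: vec_eq_iff)
lemma cx_add: "cx (x + y) = cx x + cx y" by (simp add: vec_eq_iff)
lemma cx_scaleR: "cx (a *\<^sub>R x) = of_real a *s cx x" by (simp add: vec_eq_iff)
lemma cx_re_im: "cx (re_vec z) + \<i> *s cx (im_vec z) = z" by (simp add: vec_eq_iff complex_eq_iff)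
lemma im_vec_cx [simp]: "im_vec (cx x) = 0" by (simp add: vec_eq_iff)
lemma real_restriction_eq: "real_restriction f x = f (cx x)" by (simp add: real_restriction_def cx_def)
lemma continuous_on_cx [continuous_intros]: "continuous_on A f \<Longrightarrow> continuous_on A (\<lambda>x. cx (f x))"
  unfolding cx_def by (intro continuous_intros)

section \<open>The body and its support function\<close>

text \<open>The form in which the hypotheses on the body are used: the \<Pi>-condition enters through \<open>solid\<close>, and the
  estimates are expressed through the radii \<open>r\<close> and \<open>R\<close>.\<close>
locale solid_body =
  fixes V :: "(real ^ 'n) set" and r R :: real
  assumes convex: "convex V" and compact: "compact V" and r_pos: "0 < r"
    and cube_sub: "(\<And>j. \<bar>s $ j\<bar> \<le> r) \<Longrightarrow> s \<in> V"
    and norm_le: "t \<in> V \<Longrightarrow> norm t \<le> R"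
    and solid: "t \<in> V \<Longrightarrow> (\<And>j. \<bar>s $ j\<bar> \<le> \<bar>t $ j\<bar>) \<Longrightarrow> s \<in> V"

text \<open>An interior point can be pushed off the coordinate hyperplanes inside the body; the box spanned by the
  resulting point contains a cube.\<close>
lemma solid_body_exists:
  fixes V :: "(real ^ 'n) set"
  assumes "convex_body V" "Pi_condition V"
  shows "\<exists>r R. solid_body V r R"
proof -
  have conv: "convex V" and comp: "compact V" and ne: "interior V \<noteq> {}"
    using assms(1) by (auto simp: convex_body_def)
  have sol0: "s \<in> V" if "t \<in> V" "\<And>j. \<bar>s $ j\<bar> \<le> \<bar>t $ j\<bar>" for s t
  proof (cases "t = 0")
    case True
    then have "s = 0" using that(2) by (auto simp: vec_eq_iff)
    then show ?thesis using True that by simp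
  next
    case False
    then show ?thesis using assms(2) that unfolding Pi_condition_def by blast
  qed
  obtain t e where e: "0 < e" "ball t e \<subseteq> V" using ne by (metis mem_interior ex_in_conv)
  define d where "d = e / (2 * real CARD('n))"
  have d: "0 < d" using e by (simp add: d_def)
  define w :: "real ^ 'n" where "w = (\<chi> j. if 0 \<le> t $ j then d else - d)"
  have "norm w \<le> (\<Sum>j\<in>UNIV. \<bar>w $ j\<bar>)" by (rule norm_le_l1_cart)
  also have "\<dots> = (\<Sum>j\<in>(UNIV::'n set). d)" by (intro sum.cong) (auto simp: w_def d less_imp_le)
  also have "\<dots> < e" using e by (simp add: d_def)
  finally have "t + w \<in> V" using e by (auto simp: dist_norm)
  moreover have "d \<le> \<bar>(t + w) $ j\<bar>" for j using d by (simp add: w_def)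
  ultimately have cube: "s \<in> V" if "\<And>j. \<bar>s $ j\<bar> \<le> d" for s
    using sol0[of "t + w" s] that by (meson order_trans)
  obtain R where "\<And>t. t \<in> V \<Longrightarrow> norm t \<le> R" using compact_imp_bounded[OF comp] unfolding bounded_iff by auto
  then have "solid_body V d R" using conv comp d cube sol0 by unfold_locales auto
  then show ?thesis by blast
qed

context solid_body
begin

abbreviation "dn \<equiv> dual_norm V"
abbreviation "supp y \<equiv> dual_norm V (cx y)"

lemma zero_in: "0 \<in> V" using cube_sub[of 0] r_pos by simp
lemma V_ne: "V \<noteq> {}" using zero_in by auto
lemma R_nonneg: "0 \<le> R" using norm_le[OF zero_in] by simp

lemma pairing_le: "t \<in> V \<Longrightarrow> cmod (\<Sum>j\<in>UNIV. complex_of_real (t $ j) * z $ j) \<le> R * (\<Sum>j\<in>UNIV. cmod (z $ j))"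
proof -
  assume t: "t \<in> V"
  have "cmod (\<Sum>j\<in>UNIV. complex_of_real (t $ j) * z $ j) \<le> (\<Sum>j\<in>UNIV. R * cmod (z $ j))"
    using component_le_norm_cart[of t] norm_le[OF t]
    by (intro sum_norm_le) (auto simp: norm_mult intro!: mult_right_mono order_trans[OF component_le_norm_cart])
  then show ?thesis by (simp add: sum_distrib_left)
qed

lemma dn_ge: "t \<in> V \<Longrightarrow> cmod (\<Sum>j\<in>UNIV. complex_of_real (t $ j) * z $ j) \<le> dn z"
  unfolding dual_norm_def by (intro cSUP_upper bdd_aboveI2[OF pairing_le])

lemma dn_le: "(\<And>t. t \<in> V \<Longrightarrow> cmod (\<Sum>j\<in>UNIV. complex_of_real (t $ j) * z $ j) \<le> B) \<Longrightarrow> dn z \<le> B"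
  unfolding dual_norm_def by (intro cSUP_least V_ne)

lemma dn_upper: "dn z \<le> R * (\<Sum>j\<in>UNIV. cmod (z $ j))" by (intro dn_le pairing_le)

lemma dn_nonneg: "0 \<le> dn z" using dn_ge[OF zero_in, of z] by simp

lemma dn_add: "dn (z + w) \<le> dn z + dn w"
proof (rule dn_le)
  fix t assume t: "t \<in> V"
  have "(\<Sum>j\<in>UNIV. complex_of_real (t $ j) * (z + w) $ j) =
    (\<Sum>j\<in>UNIV. complex_of_real (t $ j) * z $ j) + (\<Sum>j\<in>UNIV. complex_of_real (t $ j) * w $ j)"
    by (simp add: ring_distribs sum.distrib)
  then show "cmod (\<Sum>j\<in>UNIV. complex_of_real (t $ j) * (z + w) $ j) \<le> dn z + dn w"
    using norm_triangle_le[OF add_mono[OF dn_ge[OF t, of z] dn_ge[OF t, of w]]] by (simp only:)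
qed

lemma dn_scale_le: "dn (c *s z) \<le> cmod c * dn z"
proof (rule dn_le)
  fix t assume t: "t \<in> V"
  have "(\<Sum>j\<in>UNIV. complex_of_real (t $ j) * (c *s z) $ j) = c * (\<Sum>j\<in>UNIV. complex_of_real (t $ j) * z $ j)"
    by (simp add: sum_distrib_left mult_ac)
  then show "cmod (\<Sum>j\<in>UNIV. complex_of_real (t $ j) * (c *s z) $ j) \<le> cmod c * dn z"
    using dn_ge[OF t, of z] by (simp add: norm_mult mult_left_mono)
qed

lemma dn_lower: "r * cmod (z $ j) \<le> dn z"
proof -
  have "axis j r \<in> V" using r_pos by (intro cube_sub) (auto simp: axis_def)
  from dn_ge[OF this, of z] have "cmod (complex_of_real r * z $ j) \<le> dn z"
    by (simp add: axis_def if_distrib if_distribR cong: if_cong)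
  then show ?thesis using r_pos by (simp add: norm_mult)
qed

lemma supp_pos: "y \<noteq> 0 \<Longrightarrow> 0 < supp y"
proof -
  assume "y \<noteq> 0"
  then obtain j where "y $ j \<noteq> 0" by (auto simp: vec_eq_iff)
  then have "0 < r * cmod (cx y $ j)" using r_pos by simp
  then show ?thesis using dn_lower[of "cx y" j] by linarith
qed

lemma supp_eq: "cmod (\<Sum>j\<in>UNIV. complex_of_real (t $ j) * cx y $ j) = \<bar>t \<bullet> y\<bar>"
  unfolding inner_vec_def cx_nth of_real_mult[symmetric] of_real_sum[symmetric] norm_of_real inner_real_def ..

lemma supp_ge: "t \<in> V \<Longrightarrow> \<bar>t \<bullet> y\<bar> \<le> supp y"
  using dn_ge[of t "cx y"] unfolding supp_eq .

lemma supp_le: "(\<And>t. t \<in> V \<Longrightarrow> \<bar>t \<bullet> y\<bar> \<le> B) \<Longrightarrow> supp y \<le> B"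
  by (rule dn_le) (simp only: supp_eq)

text \<open>The functional \<open>y\<close> is tested against a point of the body; by the \<Pi>-condition the coordinates of that point may
  be given the signs of \<open>w\<close>.\<close>
lemma supp_mono: assumes "\<And>j. \<bar>y $ j\<bar> \<le> \<bar>w $ j\<bar>" shows "supp y \<le> supp w"
proof (rule supp_le)
  fix t assume t: "t \<in> V"
  define s where "s = (\<chi> j. \<bar>t $ j\<bar> * sgn (w $ j))"
  have "s \<in> V" by (rule solid[OF t]) (auto simp: s_def abs_mult sgn_if)
  have "\<bar>t \<bullet> y\<bar> \<le> (\<Sum>j\<in>UNIV. \<bar>t $ j\<bar> * \<bar>y $ j\<bar>)" unfolding inner_vec_def
    by (rule order_trans[OF sum_abs]) (simp add: abs_mult)
  also have "\<dots> \<le> (\<Sum>j\<in>UNIV. \<bar>t $ j\<bar> * \<bar>w $ j\<bar>)" using assms by (intro sum_mono mult_left_mono) auto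
  also have "\<dots> = s \<bullet> w" unfolding inner_vec_def s_def by (intro sum.cong) (auto simp: sgn_if)
  also have "\<dots> \<le> supp w" using supp_ge[OF \<open>s \<in> V\<close>, of w] by linarith
  finally show "\<bar>t \<bullet> y\<bar> \<le> supp w" .
qed

lemma supp_im_le: "supp (im_vec z) \<le> dn z"
proof (rule supp_le)
  fix t assume t: "t \<in> V"
  have "t \<bullet> im_vec z = Im (\<Sum>j\<in>UNIV. complex_of_real (t $ j) * z $ j)" by (simp add: inner_vec_def)
  then show "\<bar>t \<bullet> im_vec z\<bar> \<le> dn z" using dn_ge[OF t, of z] abs_Im_le_cmod order_trans by metis
qed

lemma supp_upper: "supp y \<le> R * CARD('n) * norm y"
proof -
  have "supp y \<le> R * (\<Sum>j\<in>UNIV. cmod (cx y $ j))" by (rule dn_upper)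
  also have "\<dots> \<le> R * (\<Sum>j\<in>(UNIV::'n set). norm y)" using R_nonneg component_le_norm_cart[of y] by (intro mult_left_mono sum_mono) auto
  finally show ?thesis by (simp add: mult_ac)
qed

lemma supp_scale: "supp (a *\<^sub>R y) \<le> \<bar>a\<bar> * supp y"
  using dn_scale_le[of "of_real a" "cx y"] by (simp add: cx_scaleR)

text \<open>The direction in which a frequency outside \<open>s V\<close> is separated from \<open>s V\<close>.  Normalising the separating
  functional in the maximum norm bounds its support function from below by \<open>r\<close>.\<close>
lemma separating_direction:
  assumes "0 < s" "l \<notin> scaled s V"
  shows "\<exists>u. (\<forall>j. \<bar>u $ j\<bar> \<le> 1) \<and> r \<le> supp u \<and> s * supp u \<le> l \<bullet> u"
proof -
  have "convex (scaled s V)" "closed (scaled s V)"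
    using convex compact by (auto intro: convex_scaling compact_imp_closed compact_scaling)
  from separating_hyperplane_closed_point[OF this assms(2)]
  obtain a b where ab: "a \<bullet> l < b" "\<And>v. v \<in> V \<Longrightarrow> b < a \<bullet> (s *\<^sub>R v)" by auto
  have "a \<noteq> 0" using ab(1) ab(2)[OF zero_in] by auto
  define c where "c = Max (range (\<lambda>j. \<bar>a $ j\<bar>))"
  have le: "\<bar>a $ j\<bar> \<le> c" for j unfolding c_def by (intro Max_ge) auto
  have c: "0 < c"
  proof -
    obtain j where "a $ j \<noteq> 0" using \<open>a \<noteq> 0\<close> by (auto simp: vec_eq_iff)
    then show ?thesis using le[of j] by linarith
  qed
  have "c \<in> range (\<lambda>j. \<bar>a $ j\<bar>)" unfolding c_def by (rule Max_in) auto
  then obtain i where i: "c = \<bar>a $ i\<bar>" by auto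
  define u where "u = (- 1 / c) *\<^sub>R a"
  have "supp u \<le> (l \<bullet> u) / s"
  proof (rule supp_le)
    fix t assume t: "t \<in> V"
    have mt: "- t \<in> V" by (rule solid[OF t]) auto
    have "\<bar>s * (a \<bullet> t)\<bar> < - (a \<bullet> l)" using ab(1) ab(2)[OF t] ab(2)[OF mt] by (auto simp: abs_if)
    moreover have "\<bar>s * (t \<bullet> u)\<bar> = \<bar>s * (a \<bullet> t)\<bar> / c" using c by (simp add: u_def inner_commute abs_mult)
    moreover have "l \<bullet> u = - (a \<bullet> l) / c" by (simp add: u_def inner_commute)
    ultimately have "\<bar>s * (t \<bullet> u)\<bar> \<le> l \<bullet> u" using c by (metis divide_right_mono less_imp_le)
    then show "\<bar>t \<bullet> u\<bar> \<le> (l \<bullet> u) / s" using \<open>0 < s\<close> by (simp add: abs_mult field_simps)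
  qed
  then have "s * supp u \<le> l \<bullet> u" using \<open>0 < s\<close> by (simp add: field_simps)
  moreover have "\<bar>u $ j\<bar> \<le> 1" for j using le[of j] c by (simp add: u_def abs_mult)
  moreover have "r \<le> supp u"
  proof -
    have "\<bar>u $ i\<bar> = 1" using i c by (simp add: u_def abs_mult)
    then show ?thesis using dn_lower[of "cx u" i] by simp
  qed
  ultimately show ?thesis by blast
qed

lemma scaled_sum: "0 \<le> a \<Longrightarrow> 0 \<le> b \<Longrightarrow> x \<in> scaled a V \<Longrightarrow> y \<in> scaled b V \<Longrightarrow> x + y \<in> scaled (a + b) V"
proof -
  assume a: "0 \<le> a" "0 \<le> b" "x \<in> scaled a V" "y \<in> scaled b V"
  then obtain v w where v: "x = a *\<^sub>R v" "y = b *\<^sub>R w" "v \<in> V" "w \<in> V" by auto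
  show ?thesis
  proof (cases "a + b = 0")
    case True
    then have "a = 0" "b = 0" using a by auto
    then show ?thesis using v by auto
  next
    case False
    have "(a / (a + b)) *\<^sub>R v + (b / (a + b)) *\<^sub>R w \<in> V"
      using a False v by (intro convexD[OF convex]) (auto simp: add_divide_distrib[symmetric])
    moreover have "x + y = (a + b) *\<^sub>R ((a / (a + b)) *\<^sub>R v + (b / (a + b)) *\<^sub>R w)"
      using False v by (simp add: scaleR_add_right)
    ultimately show ?thesis by blast
  qed
qed

lemma scaled_solid: "0 \<le> a \<Longrightarrow> x \<in> scaled a V \<Longrightarrow> (\<And>j. \<bar>y $ j\<bar> \<le> \<bar>x $ j\<bar>) \<Longrightarrow> y \<in> scaled a V"
proof -
  assume a: "0 \<le> a" "x \<in> scaled a V" "\<And>j. \<bar>y $ j\<bar> \<le> \<bar>x $ j\<bar>"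
  then obtain v where v: "x = a *\<^sub>R v" "v \<in> V" by auto
  show ?thesis
  proof (cases "a = 0")
    case True
    then have "y = 0" using a v by (auto simp: vec_eq_iff)
    then show ?thesis using True v by auto
  next
    case False
    have "(1 / a) *\<^sub>R y \<in> V" using a False v by (intro solid[OF v(2)]) (auto simp: abs_mult field_simps)
    then show ?thesis using False by (intro image_eqI[of _ _ "(1 / a) *\<^sub>R y"]) auto
  qed
qed

lemma scaled_cube:
  assumes "0 < a" "\<And>j. \<bar>y $ j\<bar> \<le> a * r" shows "y \<in> scaled a V"
proof (rule image_eqI[of _ _ "(1 / a) *\<^sub>R y"])
  show "(1 / a) *\<^sub>R y \<in> V" using assms by (intro cube_sub) (simp add: abs_mult field_simps)
qed (use assms in simp)

lemma scaled_component_le: "0 \<le> a \<Longrightarrow> x \<in> scaled a V \<Longrightarrow> \<bar>x $ j\<bar> \<le> a * R"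
proof -
  assume a: "0 \<le> a" "x \<in> scaled a V"
  then obtain v where v: "x = a *\<^sub>R v" "v \<in> V" by auto
  have "\<bar>v $ j\<bar> \<le> R" using norm_le[OF v(2)] component_le_norm_cart[of v j] by linarith
  then show ?thesis using a v by (simp add: abs_mult mult_left_mono)
qed

text \<open>Growth with the type \<open>s V\<close> itself and no \<open>\<epsilon>\<close>.  Finite exponential sums with frequencies in \<open>s V\<close> have it, and a
  function of exponential type \<open>V\<close> has it for each \<open>s > 1\<close>.\<close>
definition etype :: "real \<Rightarrow> (complex ^ 'n \<Rightarrow> complex) \<Rightarrow> bool" where
  "etype s f \<longleftrightarrow> entire f \<and> (\<exists>C. \<forall>z. cmod (f z) \<le> C * exp (s * dn z))"

end

section \<open>Functions of exponential type bounded on the real space\<close>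

lemma entire_continuous: "entire f \<Longrightarrow> continuous_on A f"
  unfolding entire_def by (meson continuous_at_imp_continuous_on has_derivative_continuous)

lemma entire_continuous_real: "entire f \<Longrightarrow> continuous_on A (\<lambda>x. f (cx x))"
  by (rule continuous_on_compose2[OF entire_continuous[of f UNIV] continuous_on_cx[OF continuous_on_id]]) auto

lemma entire_slice_deriv:
  fixes y :: "complex ^ 'n"
  assumes "(f has_derivative D) (at (x + \<zeta> *s y))" "\<And>c v. D (c *s v) = c * D v"
  shows "((\<lambda>\<zeta>. f (x + \<zeta> *s y)) has_field_derivative D y) (at \<zeta>)"
proof -
  have "bounded_linear (\<lambda>h::complex. h *s y)"
    unfolding linear_conv_bounded_linear[symmetric] by (rule linearI) (auto simp: vec_eq_iff ring_distribs)
  then have "((\<lambda>\<zeta>. x + \<zeta> *s y) has_derivative (\<lambda>h. h *s y)) (at \<zeta>)"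
    by (auto intro!: derivative_eq_intros bounded_linear_imp_has_derivative)
  from diff_chain_at[OF this assms(1)] have "((\<lambda>\<zeta>. f (x + \<zeta> *s y)) has_derivative (\<lambda>h. D (h *s y))) (at \<zeta>)"
    by (simp add: o_def)
  moreover have "(\<lambda>h. D (h *s y)) = (*) (D y)" using assms(2) by (auto simp: mult.commute)
  ultimately show ?thesis by (simp add: has_field_derivative_def)
qed

lemma entire_slice_holomorphic:
  fixes x y :: "complex ^ 'n"
  assumes "entire f" shows "(\<lambda>\<zeta>. f (x + \<zeta> *s y)) holomorphic_on UNIV"
proof -
  have "(\<lambda>\<zeta>. f (x + \<zeta> *s y)) field_differentiable (at \<zeta>)" for \<zeta>
    using assms entire_slice_deriv unfolding entire_def field_differentiable_def by metis
  then show ?thesis by (simp add: holomorphic_on_def)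
qed

context solid_body
begin

lemma etype_slice_growth:
  assumes "\<And>z. cmod (f z) \<le> C * exp (s * dn z)" "0 \<le> s" "0 \<le> C"
  shows "cmod (f (x + \<zeta> *s y)) \<le> (C * exp (s * dn x)) * exp (s * dn y * cmod \<zeta>)"
proof -
  have "dn (x + \<zeta> *s y) \<le> dn x + cmod \<zeta> * dn y" using dn_add[of x "\<zeta> *s y"] dn_scale_le[of \<zeta> y] by linarith
  then have "s * dn (x + \<zeta> *s y) \<le> s * dn x + s * dn y * cmod \<zeta>" using mult_left_mono[OF _ \<open>0 \<le> s\<close>] by (fastforce simp: algebra_simps)
  then have "C * exp (s * dn (x + \<zeta> *s y)) \<le> C * exp (s * dn x + s * dn y * cmod \<zeta>)" using \<open>0 \<le> C\<close> by (intro mult_left_mono) auto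
  then show ?thesis using assms(1)[of "x + \<zeta> *s y"] by (simp add: exp_add mult_ac)
qed

text \<open>The slice \<open>\<zeta> \<mapsto> f (x + \<zeta> y)\<close> through \<open>z = x + i y\<close> is bounded on the real axis, so the theorem of
  Phragmen and Lindelof removes the dependence of the growth on \<open>x\<close>.\<close>
lemma etype_bound:
  assumes "etype s f" "0 \<le> s" "s < s'" and M: "\<And>x. cmod (f (cx x)) \<le> M"
  shows "cmod (f z) \<le> M * exp (s' * supp (im_vec z))"
proof (cases "im_vec z = 0")
  case True
  then have "z = cx (re_vec z)" by (simp add: vec_eq_iff complex_eq_iff)
  then have "cmod (f z) \<le> M" using M[of "re_vec z"] by metis
  moreover have "supp (im_vec z) = 0" using True V_ne by (simp add: dual_norm_def)
  ultimately show ?thesis by simp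
next
  case False
  obtain C where C: "\<And>z. cmod (f z) \<le> C * exp (s * dn z)" using assms by (auto simp: etype_def)
  have C0: "0 \<le> C" using order_trans[OF norm_ge_zero C[of 0]] by (simp add: zero_le_mult_iff)
  have "cmod (f (cx (re_vec z) + \<i> *s cx (im_vec z))) \<le> M * exp (s' * supp (im_vec z) * \<bar>Im \<i>\<bar>)"
  proof (rule phragmen_lindelof_exponential_type)
    show "(\<lambda>\<zeta>. f (cx (re_vec z) + \<zeta> *s cx (im_vec z))) holomorphic_on UNIV"
      using assms(1) by (auto simp: etype_def intro: entire_slice_holomorphic[of f "cx (re_vec z)" "cx (im_vec z)"])
    show "cmod (f (cx (re_vec z) + of_real t *s cx (im_vec z))) \<le> M" for t
      using M[of "re_vec z + t *\<^sub>R im_vec z"] by (simp add: cx_add cx_scaleR)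
    show "cmod (f (cx (re_vec z) + \<zeta> *s cx (im_vec z))) \<le> (C * exp (s * dn (cx (re_vec z)))) * exp (s * supp (im_vec z) * cmod \<zeta>)" for \<zeta>
      by (rule etype_slice_growth[OF C assms(2) C0])
    show "s * supp (im_vec z) < s' * supp (im_vec z)" "0 \<le> s * supp (im_vec z)" using supp_pos[OF False] assms by auto
  qed
  then show ?thesis unfolding cx_re_im by simp
qed

text \<open>The constant of a Bernstein-type inequality: a function of type \<open>s V\<close> grows from the real space to imaginary
  distance one at most by this factor, so Cauchy's estimate bounds its directional derivatives.\<close>
definition lip :: "real \<Rightarrow> real" where "lip s = exp ((s + 1) * (R * CARD('n)))"

lemma lip_pos: "0 < lip s" unfolding lip_def by (rule exp_gt_zero)

lemma lip_mono: "s \<le> t \<Longrightarrow> lip s \<le> lip t"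
  unfolding lip_def using R_nonneg by (simp add: mult_right_mono)

lemma lip_ge_1: "0 \<le> s \<Longrightarrow> 1 \<le> lip s"
  unfolding lip_def using R_nonneg by (simp add: mult_nonneg_nonneg)

lemma etype_slice_deriv_le:
  assumes "etype s f" "0 \<le> s" and M: "\<And>x. cmod (f (cx x)) \<le> M" and u: "norm u \<le> 1"
  shows "cmod (deriv (\<lambda>\<zeta>. f (cx x + \<zeta> *s cx u)) (of_real t)) \<le> M * lip s"
proof -
  have ent: "entire f" using assms(1) unfolding etype_def by (rule conjunct1)
  have M0: "0 \<le> M" by (rule order_trans[OF norm_ge_zero M[of 0]])
  have bd: "cmod (f (cx x + w *s cx u)) \<le> M * lip s" if w: "cmod (w - of_real t) \<le> 1" for w
  proof -
    have "Im (w - of_real t) = Im w" by simp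
    then have Iw: "\<bar>Im w\<bar> \<le> 1" using w abs_Im_le_cmod[of "w - of_real t"] by linarith
    have iv: "im_vec (cx x + w *s cx u) = Im w *\<^sub>R u" by (simp add: vec_eq_iff)
    have "supp u \<le> R * CARD('n) * 1" using R_nonneg by (intro order_trans[OF supp_upper[of u] mult_left_mono[OF u]]) auto
    then have "\<bar>Im w\<bar> * supp u \<le> 1 * (R * CARD('n))"
      by (intro mult_mono Iw) (use dn_nonneg in auto)
    then have "supp (Im w *\<^sub>R u) \<le> R * CARD('n)" using supp_scale[of "Im w" u] by linarith
    then have "(s + 1) * supp (Im w *\<^sub>R u) \<le> (s + 1) * (R * CARD('n))" using \<open>0 \<le> s\<close> by (intro mult_left_mono) auto
    then have "M * exp ((s + 1) * supp (Im w *\<^sub>R u)) \<le> M * lip s" unfolding lip_def using M0 by (intro mult_left_mono) auto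
    moreover have "cmod (f (cx x + w *s cx u)) \<le> M * exp ((s + 1) * supp (Im w *\<^sub>R u))"
      using etype_bound[OF assms(1,2) _ M, of "s + 1" "cx x + w *s cx u"] unfolding iv by simp
    ultimately show ?thesis by linarith
  qed
  show ?thesis by (rule deriv_bound_unit_disc[OF entire_slice_holomorphic[OF ent] bd])
qed

lemma etype_lipschitz:
  assumes "etype s f" "0 \<le> s" and M: "\<And>x. cmod (f (cx x)) \<le> M"
  shows "cmod (f (cx x') - f (cx x)) \<le> M * lip s * norm (x' - x)"
proof (cases "x' = x")
  case False
  define d where "d = norm (x' - x)"
  define u where "u = (1 / d) *\<^sub>R (x' - x)"
  have d: "0 < d" using False by (simp add: d_def)
  have u: "norm u \<le> 1" using d by (simp add: u_def d_def)
  define g where "g \<zeta> = f (cx x + \<zeta> *s cx u)" for \<zeta>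
  have ent: "entire f" using assms(1) unfolding etype_def by (rule conjunct1)
  have holg: "g holomorphic_on UNIV" unfolding g_def by (rule entire_slice_holomorphic[OF ent])
  have "cmod (g (of_real d) - g (of_real 0)) \<le> M * lip s * cmod (of_real d - of_real 0)"
  proof (rule field_differentiable_bound[of "closed_segment (of_real 0) (of_real d)" g "deriv g"])
    fix z assume "z \<in> closed_segment (complex_of_real 0) (of_real d)"
    then obtain v where "z = of_real v" unfolding closed_segment_def by (auto simp: scaleR_conv_of_real simp flip: of_real_mult)
    then show "cmod (deriv g z) \<le> M * lip s" unfolding g_def using etype_slice_deriv_le[OF assms(1,2) M u, of x v] by simp
    show "(g has_field_derivative deriv g z) (at z within closed_segment (of_real 0) (of_real d))"
      by (rule has_field_derivative_at_within[OF holomorphic_derivI[OF holg open_UNIV UNIV_I]])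
  qed auto
  moreover have "cx x + of_real d *s cx u = cx x'" using d by (simp add: u_def vec_eq_iff)
  ultimately show ?thesis using d by (simp add: g_def d_def[symmetric])
qed simp

end

section \<open>Exponential sums\<close>

definition expo :: "real ^ 'n \<Rightarrow> complex ^ 'n \<Rightarrow> complex" where
  "expo l z = exp (\<i> * (\<Sum>j\<in>UNIV. of_real (l $ j) * z $ j))"

definition expsum :: "(real ^ 'n) set \<Rightarrow> (complex ^ 'n \<Rightarrow> complex) \<Rightarrow> bool" where
  "expsum K f \<longleftrightarrow> (\<exists>S c. finite S \<and> S \<subseteq> K \<and> f = (\<lambda>z. \<Sum>l\<in>S. c l * expo l z))"

lemma expo_add: "expo (l + m) z = expo l z * expo m z"
  by (simp add: expo_def ring_distribs sum.distrib exp_add)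

lemma norm_expo: "cmod (expo l z) = exp (- (l \<bullet> im_vec z))"
  by (simp add: expo_def inner_vec_def)

lemma expo_shift: "expo l (z + w) = expo l z * expo l w"
  by (simp add: expo_def ring_distribs sum.distrib exp_add)

lemma expsum_mono: "expsum K f \<Longrightarrow> K \<subseteq> L \<Longrightarrow> expsum L f"
  unfolding expsum_def by blast

lemma expsum_single: "l \<in> K \<Longrightarrow> expsum K (\<lambda>z. c * expo l z)"
  unfolding expsum_def by (rule exI[of _ "{l}"], rule exI[of _ "\<lambda>_. c"]) auto

lemma expsum_zero: "expsum K (\<lambda>z. 0)"
  unfolding expsum_def by (rule exI[of _ "{}"]) auto

lemma expsum_add:
  assumes "expsum K f" "expsum K g" shows "expsum K (\<lambda>z. f z + g z)"
proof -
  obtain S c where f: "finite S" "S \<subseteq> K" "f = (\<lambda>z. \<Sum>l\<in>S. c l * expo l z)" using assms unfolding expsum_def by blast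
  obtain T d where g: "finite T" "T \<subseteq> K" "g = (\<lambda>z. \<Sum>l\<in>T. d l * expo l z)" using assms unfolding expsum_def by blast
  define e where "e l = (if l \<in> S then c l else 0) + (if l \<in> T then d l else 0)" for l
  have "f z + g z = (\<Sum>l\<in>S \<union> T. e l * expo l z)" for z
  proof -
    have "f z = (\<Sum>l\<in>S \<union> T. (if l \<in> S then c l else 0) * expo l z)"
      unfolding f(3) using f(1) g(1) by (intro sum.mono_neutral_cong_left) auto
    moreover have "g z = (\<Sum>l\<in>S \<union> T. (if l \<in> T then d l else 0) * expo l z)"
      unfolding g(3) using f(1) g(1) by (intro sum.mono_neutral_cong_left) auto
    ultimately show ?thesis by (simp add: e_def ring_distribs sum.distrib)
  qed
  then show ?thesis unfolding expsum_def using f g by (intro exI[of _ "S \<union> T"] exI[of _ e]) auto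
qed

lemma expsum_sum: "(\<And>i. i \<in> I \<Longrightarrow> expsum K (f i)) \<Longrightarrow> expsum K (\<lambda>z. \<Sum>i\<in>I. f i z)"
  by (induction I rule: infinite_finite_induct) (auto intro: expsum_add expsum_zero)

lemma expsum_cmult: "expsum K f \<Longrightarrow> expsum K (\<lambda>z. c * f z)"
proof -
  assume "expsum K f"
  then obtain S d where f: "finite S" "S \<subseteq> K" "f = (\<lambda>z. \<Sum>l\<in>S. d l * expo l z)" unfolding expsum_def by blast
  have "expsum K (\<lambda>z. \<Sum>l\<in>S. (c * d l) * expo l z)" using f by (intro expsum_sum expsum_single) auto
  then show ?thesis using f by (simp add: sum_distrib_left mult_ac)
qed

lemma expsum_mult:
  assumes "expsum K f" "expsum L g" "\<And>k l. k \<in> K \<Longrightarrow> l \<in> L \<Longrightarrow> k + l \<in> M"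
  shows "expsum M (\<lambda>z. f z * g z)"
proof -
  obtain S c where f: "finite S" "S \<subseteq> K" "f = (\<lambda>z. \<Sum>l\<in>S. c l * expo l z)" using assms unfolding expsum_def by blast
  obtain T d where g: "finite T" "T \<subseteq> L" "g = (\<lambda>z. \<Sum>l\<in>T. d l * expo l z)" using assms unfolding expsum_def by blast
  have "expsum M (\<lambda>z. \<Sum>k\<in>S. \<Sum>l\<in>T. (c k * d l) * expo (k + l) z)"
    using f g assms(3) by (intro expsum_sum expsum_single) auto
  then show ?thesis using f g by (simp add: sum_product expo_add mult_ac)
qed

lemma expsum_scale: "expsum K f \<Longrightarrow> (\<And>k. k \<in> K \<Longrightarrow> a *\<^sub>R k \<in> L) \<Longrightarrow> expsum L (\<lambda>z. f (a *\<^sub>R z))"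
proof -
  assume "expsum K f" and KL: "\<And>k. k \<in> K \<Longrightarrow> a *\<^sub>R k \<in> L"
  then obtain S c where f: "finite S" "S \<subseteq> K" "f = (\<lambda>z. \<Sum>l\<in>S. c l * expo l z)" unfolding expsum_def by blast
  have "(\<lambda>z. f (a *\<^sub>R z)) = (\<lambda>z. \<Sum>l\<in>S. c l * expo (a *\<^sub>R l) z)"
    unfolding f(3) expo_def by (simp add: scaleR_conv_of_real[where 'a = complex] mult_ac)
  moreover have "expsum L (\<lambda>z. \<Sum>l\<in>S. c l * expo (a *\<^sub>R l) z)" using f KL by (intro expsum_sum expsum_single) auto
  ultimately show ?thesis by simp
qed

lemma expo_has_derivative:
  "(expo l has_derivative (\<lambda>v. \<Sum>j\<in>UNIV. v $ j * (\<i> * of_real (l $ j) * expo l z))) (at z)"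
proof -
  have "((\<lambda>z. \<i> * (\<Sum>j\<in>UNIV. of_real (l $ j) * z $ j)) has_derivative (\<lambda>v. \<i> * (\<Sum>j\<in>UNIV. of_real (l $ j) * v $ j))) (at z)"
    by (auto intro!: derivative_eq_intros bounded_linear.has_derivative[OF bounded_linear_vec_nth])
  from has_derivative_compose[OF this DERIV_exp[THEN has_field_derivative_imp_has_derivative]]
  have "(expo l has_derivative (\<lambda>v. expo l z * (\<i> * (\<Sum>j\<in>UNIV. of_real (l $ j) * v $ j)))) (at z)"
    unfolding expo_def by simp
  then show ?thesis by (rule has_derivative_eq_rhs) (simp add: sum_distrib_left sum_distrib_right mult_ac fun_eq_iff)
qed

lemma expsum_partials:
  assumes "expsum K f"
  shows "\<exists>f'. (\<forall>j. expsum K (f' j)) \<and> (\<forall>z. (f has_derivative (\<lambda>v. \<Sum>j\<in>UNIV. v $ j * f' j z)) (at z))"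
proof -
  obtain S c where f: "finite S" "S \<subseteq> K" "f = (\<lambda>z. \<Sum>l\<in>S. c l * expo l z)" using assms unfolding expsum_def by blast
  define f' where "f' j z = (\<Sum>l\<in>S. (c l * (\<i> * of_real (l $ j))) * expo l z)" for j z
  have "expsum K (f' j)" for j unfolding f'_def using f by (intro expsum_sum expsum_single) auto
  moreover have "(f has_derivative (\<lambda>v. \<Sum>j\<in>UNIV. v $ j * f' j z)) (at z)" for z
  proof -
    have "(f has_derivative (\<lambda>v. \<Sum>l\<in>S. c l * (\<Sum>j\<in>UNIV. v $ j * (\<i> * of_real (l $ j) * expo l z)))) (at z)"
      unfolding f(3) by (intro has_derivative_sum has_derivative_mult_right expo_has_derivative)
    then show ?thesis
    proof (rule has_derivative_eq_rhs)
      show "(\<lambda>v. \<Sum>l\<in>S. c l * (\<Sum>j\<in>UNIV. v $ j * (\<i> * of_real (l $ j) * expo l z))) = (\<lambda>v. \<Sum>j\<in>UNIV. v $ j * f' j z)"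
        unfolding f'_def sum_distrib_left by (subst sum.swap) (simp add: mult_ac)
    qed
  qed
  ultimately show ?thesis by blast
qed

lemma expsum_entire: "expsum K f \<Longrightarrow> entire f"
  unfolding entire_def
proof
  fix z assume "expsum K f"
  then obtain f' where "(f has_derivative (\<lambda>v. \<Sum>j\<in>UNIV. v $ j * f' j z)) (at z)" using expsum_partials by blast
  then show "\<exists>D. (f has_derivative D) (at z) \<and> (\<forall>c v. D (c *s v) = c * D v)"
    by (intro exI conjI) (auto simp: sum_distrib_left mult_ac)
qed

lemma (in solid_body) expsum_etype:
  assumes "expsum (scaled s V) f" "0 \<le> s"
  shows "etype s f"
  unfolding etype_def
proof
  show "entire f" using assms expsum_entire by blast
  obtain S c where f: "finite S" "S \<subseteq> scaled s V" "f = (\<lambda>z. \<Sum>l\<in>S. c l * expo l z)" using assms unfolding expsum_def by blast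
  have "cmod (f z) \<le> (\<Sum>l\<in>S. cmod (c l)) * exp (s * dn z)" for z
  proof -
    have "cmod (expo l z) \<le> exp (s * dn z)" if l: "l \<in> S" for l
    proof -
      obtain v where v: "v \<in> V" "l = s *\<^sub>R v" using subsetD[OF f(2) l] by auto
      have "- (v \<bullet> im_vec z) \<le> dn z" using supp_ge[OF v(1), of "im_vec z"] supp_im_le[of z] by linarith
      then have "- (l \<bullet> im_vec z) \<le> s * dn z" using mult_left_mono[OF _ \<open>0 \<le> s\<close>] v by fastforce
      then show ?thesis by (simp add: norm_expo)
    qed
    then show ?thesis unfolding f(3) sum_distrib_right
      by (intro sum_norm_le) (auto simp: norm_mult intro!: mult_left_mono)
  qed
  then show "\<exists>C. \<forall>z. cmod (f z) \<le> C * exp (s * dn z)" by blast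
qed

text \<open>The frequencies of the trigonometric polynomials whose degree in the \<open>j\<close>-th coordinate is at most \<open>b\<^sub>j\<close>.\<close>
definition ibox :: "real ^ 'n \<Rightarrow> (real ^ 'n) set" where
  "ibox b = {l. \<forall>j. l $ j \<in> \<int> \<and> \<bar>l $ j\<bar> \<le> b $ j}"

lemma ibox_add: "k \<in> ibox a \<Longrightarrow> l \<in> ibox b \<Longrightarrow> k + l \<in> ibox (a + b)"
  unfolding ibox_def by (auto intro: order_trans[OF abs_triangle_ineq] add_mono)

lemma finite_ibox: "finite (ibox b)"
proof -
  define I where "I = (\<Union>j. {x \<in> \<int>. \<bar>x\<bar> \<le> b $ j})"
  have "finite {x \<in> \<int>. \<bar>x\<bar> \<le> c}" for c :: real
  proof (rule finite_subset)
    show "{x \<in> \<int>. \<bar>x\<bar> \<le> c} \<subseteq> real_of_int ` {- \<lfloor>c\<rfloor>..\<lfloor>c\<rfloor>}"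
    proof
      fix x assume "x \<in> {x \<in> \<int>. \<bar>x\<bar> \<le> c}"
      then obtain i where i: "x = of_int i" "\<bar>of_int i\<bar> \<le> c" by (auto elim: Ints_cases)
      then have "\<bar>i\<bar> \<le> \<lfloor>c\<rfloor>" by (simp add: le_floor_iff)
      then have "i \<in> {- \<lfloor>c\<rfloor>..\<lfloor>c\<rfloor>}" by (auto simp: abs_le_iff)
      then show "x \<in> real_of_int ` {- \<lfloor>c\<rfloor>..\<lfloor>c\<rfloor>}" using i by blast
    qed
  qed auto
  then have "finite I" unfolding I_def by auto
  then have "finite (vec_nth ` ibox b)"
    by (intro finite_subset[OF _ finite_PiE[of UNIV "\<lambda>_. I"]]) (auto simp: ibox_def I_def)
  then show ?thesis by (rule finite_imageD) (auto simp: inj_on_def vec_nth_inject)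
qed

lemma expo_axis: "expo (axis j a) z = exp (\<i> * of_real a * z $ j)"
  by (simp add: expo_def axis_def if_distrib if_distribR mult_ac cong: if_cong)

lemma expsum_sin: "expsum (ibox (axis j 1)) (\<lambda>z. sin (z $ j))"
  and expsum_cos: "expsum (ibox (axis j 1)) (\<lambda>z. cos (z $ j))"
proof -
  have m: "axis j 1 \<in> ibox (axis j 1)" "axis j (- 1) \<in> ibox (axis j 1)" by (auto simp: ibox_def axis_def)
  have "expsum (ibox (axis j 1)) (\<lambda>z. (1 / (2 * \<i>)) * expo (axis j 1) z + (- 1 / (2 * \<i>)) * expo (axis j (- 1)) z)"
    by (intro expsum_add expsum_single m)
  moreover have "(1 / (2 * \<i>)) * expo (axis j 1) z + (- 1 / (2 * \<i>)) * expo (axis j (- 1)) z = sin (z $ j)" for z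
    by (simp add: expo_axis sin_exp_eq field_simps)
  ultimately show "expsum (ibox (axis j 1)) (\<lambda>z. sin (z $ j))" by simp
  have "expsum (ibox (axis j 1)) (\<lambda>z. (1 / 2) * expo (axis j 1) z + (1 / 2) * expo (axis j (- 1)) z)"
    by (intro expsum_add expsum_single m)
  moreover have "(1 / 2) * expo (axis j 1) z + (1 / 2) * expo (axis j (- 1)) z = cos (z $ j)" for z
    by (simp add: expo_axis cos_exp_eq add_divide_distrib)
  ultimately show "expsum (ibox (axis j 1)) (\<lambda>z. cos (z $ j))" by simp
qed

lemma expsum_const: "0 \<in> K \<Longrightarrow> expsum K (\<lambda>z. c)"
  using expsum_single[of 0 K c] by (simp add: expo_def)

lemma zero_in_ibox: "0 \<in> ibox 0" by (simp add: ibox_def)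

lemma expsum_ibox_mult: "expsum (ibox a) f \<Longrightarrow> expsum (ibox b) g \<Longrightarrow> expsum (ibox (a + b)) (\<lambda>z. f z * g z)"
  by (rule expsum_mult) (auto intro: ibox_add)

lemma expsum_ibox_power: "expsum (ibox a) f \<Longrightarrow> expsum (ibox (real n *\<^sub>R a)) (\<lambda>z. f z ^ n)"
proof (induction n)
  case 0
  then show ?case using expsum_const[OF zero_in_ibox, of 1] by simp
next
  case (Suc n)
  then show ?case using expsum_ibox_mult[of a f "real n *\<^sub>R a" "\<lambda>z. f z ^ n"] by (simp add: scaleR_add_left)
qed

lemma expsum_ibox_prod:
  "finite I \<Longrightarrow> (\<And>i. i \<in> I \<Longrightarrow> expsum (ibox (a i)) (f i)) \<Longrightarrow> expsum (ibox (\<Sum>i\<in>I. a i)) (\<lambda>z. \<Prod>i\<in>I. f i z)"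
proof (induction rule: finite_induct)
  case empty
  then show ?case using expsum_const[OF zero_in_ibox, of 1] by simp
next
  case (insert i I)
  then show ?case using expsum_ibox_mult[of "a i" "f i" "\<Sum>i\<in>I. a i"] by simp
qed

lemma sum_scaleR_axis: "(\<Sum>j\<in>UNIV. f j *\<^sub>R axis j 1) = (\<chi> j. f j)"
  by (simp add: vec_eq_iff axis_def if_distrib if_distribR cong: if_cong)

lemma expsum_prod_sin: "expsum (ibox (\<chi> j. real (k j))) (\<lambda>z. \<Prod>j\<in>UNIV. sin (z $ j) ^ k j)"
  and expsum_prod_cos: "expsum (ibox (\<chi> j. real (k j))) (\<lambda>z. \<Prod>j\<in>UNIV. cos (z $ j) ^ k j)"
  using expsum_ibox_prod[OF _ expsum_ibox_power[OF expsum_sin], of UNIV "\<lambda>j. k j" "\<lambda>j. j"]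
    expsum_ibox_prod[OF _ expsum_ibox_power[OF expsum_cos], of UNIV "\<lambda>j. k j" "\<lambda>j. j"] by (simp_all add: sum_scaleR_axis)

section \<open>Compactness of exponential sums\<close>

text \<open>The theorem of Arzela and Ascoli on each ball, followed by a diagonal argument.\<close>
lemma locally_uniform_subsequence:
  fixes F :: "nat \<Rightarrow> 'a::euclidean_space \<Rightarrow> 'b::{real_normed_vector,heine_borel}"
  assumes bd: "\<And>\<rho>. \<exists>M. \<forall>n x. norm x \<le> \<rho> \<longrightarrow> norm (F n x) \<le> M"
    and lip: "\<And>\<rho>. \<exists>L. \<forall>n x y. norm x \<le> \<rho> \<longrightarrow> norm y \<le> \<rho> \<longrightarrow> norm (F n x - F n y) \<le> L * norm (x - y)"
  obtains k G where "strict_mono (k :: nat \<Rightarrow> nat)"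
    "\<And>\<rho> e. 0 < e \<Longrightarrow> \<exists>N. \<forall>n\<ge>N. \<forall>x. norm x \<le> \<rho> \<longrightarrow> norm (F (k n) x - G x) < e"
proof -
  define P where "P m s \<longleftrightarrow> (\<exists>g. \<forall>e>0. \<exists>N. \<forall>n\<ge>N. \<forall>x\<in>cball 0 (real m). norm (F (s n) x - g x) < e)" for m :: nat and s :: "nat \<Rightarrow> nat"
  interpret subseqs P
  proof
    fix m :: nat and s :: "nat \<Rightarrow> nat" assume s: "strict_mono s"
    obtain M where M: "\<And>n x. norm x \<le> real m \<Longrightarrow> norm (F n x) \<le> M" using bd[of "real m"] by blast
    obtain L where L: "\<And>n x y. norm x \<le> real m \<Longrightarrow> norm y \<le> real m \<Longrightarrow> norm (F n x - F n y) \<le> L * norm (x - y)"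
      using lip[of "real m"] by blast
    have eq: "\<exists>d>0. \<forall>n y. y \<in> cball 0 (real m) \<and> norm (x - y) < d \<longrightarrow> norm (F (s n) x - F (s n) y) < e"
      if x: "x \<in> cball 0 (real m)" and "0 < e" for x e
    proof (intro exI conjI allI impI)
      show "0 < e / (\<bar>L\<bar> + 1)" using \<open>0 < e\<close> by simp
      fix n y assume y: "y \<in> cball 0 (real m) \<and> norm (x - y) < e / (\<bar>L\<bar> + 1)"
      have "norm (F (s n) x - F (s n) y) \<le> L * norm (x - y)" using L x y by auto
      also have "\<dots> \<le> (\<bar>L\<bar> + 1) * norm (x - y)" by (intro mult_right_mono) auto
      also have "\<dots> < e" using y by (simp add: pos_less_divide_eq mult.commute)
      finally show "norm (F (s n) x - F (s n) y) < e" .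
    qed
    have M': "\<And>n x. x \<in> cball 0 (real m) \<Longrightarrow> norm (F (s n) x) \<le> M" using M by simp
    obtain g k where "strict_mono (k :: nat \<Rightarrow> nat)"
      "\<And>e. 0 < e \<Longrightarrow> \<exists>N. \<forall>n x. n \<ge> N \<and> x \<in> cball 0 (real m) \<longrightarrow> norm (F (s (k n)) x - g x) < e"
      by (rule Arzela_Ascoli[OF compact_cball M' eq]) (assumption | rule that)+
    then show "\<exists>r'. strict_mono r' \<and> P m (s \<circ> r')" unfolding P_def o_def by blast
  qed
  have "P m (diagseq \<circ> (+) (Suc m))" for m
  proof (rule diagseq_holds)
    fix n s r assume r: "strict_mono (r :: nat \<Rightarrow> nat)" and "P n s"
    then obtain g where g: "\<And>e. 0 < e \<Longrightarrow> \<exists>N. \<forall>n'\<ge>N. \<forall>x\<in>cball 0 (real n). norm (F (s n') x - g x) < e" unfolding P_def by blast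
    show "P n (s \<circ> r)" unfolding P_def o_def
    proof (intro exI[of _ g] allI impI)
      fix e :: real assume "0 < e"
      then obtain N where "\<forall>n'\<ge>N. \<forall>x\<in>cball 0 (real n). norm (F (s n') x - g x) < e" using g by blast
      then show "\<exists>N. \<forall>n'\<ge>N. \<forall>x\<in>cball 0 (real n). norm (F (s (r n')) x - g x) < e"
        using seq_suble[OF r] by (meson order_trans)
    qed
  qed
  then have "\<forall>m. \<exists>g. \<forall>e>0. \<exists>N. \<forall>n\<ge>N. \<forall>x\<in>cball 0 (real m). norm (F (diagseq (Suc m + n)) x - g x) < e"
    unfolding P_def o_def by blast
  from choice[OF this] obtain g where
    g: "\<And>m e. 0 < e \<Longrightarrow> \<exists>N. \<forall>n\<ge>N. \<forall>x\<in>cball 0 (real m). norm (F (diagseq (Suc m + n)) x - g m x) < e"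
    by blast
  have unif: "\<exists>N. \<forall>n\<ge>N. \<forall>x\<in>cball 0 (real m). norm (F (diagseq n) x - g m x) < e" if e: "0 < e" for m e
  proof -
    obtain N where N: "\<forall>n\<ge>N. \<forall>x\<in>cball 0 (real m). norm (F (diagseq (Suc m + n)) x - g m x) < e" using g[OF e] by blast
    have "norm (F (diagseq n) x - g m x) < e" if "n \<ge> Suc m + N" "x \<in> cball 0 (real m)" for n x
      using N[rule_format, of "n - Suc m" x] that by simp
    then show ?thesis by blast
  qed
  define G where "G x = lim (\<lambda>n. F (diagseq n) x)" for x
  have G: "G x = g m x" if "x \<in> cball 0 (real m)" for m x
  proof -
    have "(\<lambda>n. F (diagseq n) x) \<longlonglongrightarrow> g m x" unfolding LIMSEQ_iff using unif that by blast
    then show ?thesis unfolding G_def by (rule limI)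
  qed
  show thesis
  proof
    show "strict_mono diagseq" by (rule subseq_diagseq)
    fix \<rho> e :: real assume "0 < e"
    obtain m :: nat where m: "\<rho> \<le> real m" using real_arch_simple by blast
    obtain N where N: "\<forall>n\<ge>N. \<forall>x\<in>cball 0 (real m). norm (F (diagseq n) x - g m x) < e" using unif[OF \<open>0 < e\<close>] by blast
    have "norm (F (diagseq n) x - G x) < e" if "n \<ge> N" "norm x \<le> \<rho>" for n x
    proof -
      have x: "x \<in> cball 0 (real m)" using that m by simp
      then show ?thesis using N that(1) unfolding G[OF x] by blast
    qed
    then show "\<exists>N. \<forall>n\<ge>N. \<forall>x. norm x \<le> \<rho> \<longrightarrow> norm (F (diagseq n) x - G x) < e" by blast
  qed
qed

lemma norm_vec_le_sum: "norm (v :: complex ^ 'n) \<le> (\<Sum>j\<in>UNIV. cmod (v $ j))"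
  unfolding norm_vec_def by (rule L2_set_le_sum) simp

lemma norm_linear_form_le:
  fixes c v :: "complex ^ 'n"
  assumes "\<And>j. cmod (c $ j) \<le> B"
  shows "cmod (\<Sum>j\<in>UNIV. v $ j * c $ j) \<le> real CARD('n) * B * norm v"
proof -
  have "cmod (\<Sum>j\<in>UNIV. v $ j * c $ j) \<le> (\<Sum>j\<in>(UNIV::'n set). norm v * B)"
    using assms by (intro sum_norm_le) (auto simp: norm_mult Finite_Cartesian_Product.norm_nth_le intro!: mult_mono)
  then show ?thesis by (simp add: mult_ac)
qed

context solid_body
begin

lemma partial_bound:
  assumes "etype s f" "0 \<le> s" and M: "\<And>x. cmod (f (cx x)) \<le> M"
    and D: "\<And>z. (f has_derivative (\<lambda>v. \<Sum>j\<in>UNIV. v $ j * f' j z)) (at z)"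
  shows "cmod (f' j (cx x)) \<le> M * lip s"
proof -
  define u :: "real ^ 'n" where "u = axis j 1"
  have u: "norm u \<le> 1" by (simp add: u_def)
  have "((\<lambda>\<zeta>. f (cx x + \<zeta> *s cx u)) has_field_derivative (\<Sum>i\<in>UNIV. cx u $ i * f' i (cx x))) (at 0)"
    by (rule entire_slice_deriv[where D = "\<lambda>v. \<Sum>i\<in>UNIV. v $ i * f' i (cx x)"]) (use D[of "cx x"] in \<open>auto simp: sum_distrib_left mult_ac\<close>)
  then have e: "deriv (\<lambda>\<zeta>. f (cx x + \<zeta> *s cx u)) (of_real 0) = (\<Sum>i\<in>UNIV. cx u $ i * f' i (cx x))"
    by (simp add: DERIV_imp_deriv)
  have "(\<Sum>i\<in>UNIV. cx u $ i * f' i (cx x)) = (\<Sum>i\<in>UNIV. if i = j then f' i (cx x) else 0)"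
    by (intro sum.cong) (auto simp: axis_def u_def)
  then have e': "(\<Sum>i\<in>UNIV. cx u $ i * f' i (cx x)) = f' j (cx x)" by simp
  show ?thesis using etype_slice_deriv_le[OF assms(1,2) M u, of x 0] unfolding e e' .
qed

text \<open>The growth factor on a ball of radius \<open>\<rho>\<close> for all types up to \<open>2 V\<close>; the factor \<open>3\<close> leaves the room that
  \<open>etype_bound\<close> needs above the type.\<close>
definition growth_radius :: "real \<Rightarrow> real" where "growth_radius \<rho> = exp (3 * (R * real CARD('n) * \<rho>))"

lemma etype_bound_ball:
  assumes "etype s f" "0 \<le> s" "s \<le> 2" and M: "\<And>x. cmod (f (cx x)) \<le> M" and z: "norm z \<le> \<rho>"
  shows "cmod (f z) \<le> M * growth_radius \<rho>"
proof -
  have "norm (im_vec z) \<le> norm z" unfolding norm_vec_def by (rule L2_set_mono) (simp_all add: abs_Im_le_cmod)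
  then have "R * real CARD('n) * norm (im_vec z) \<le> R * real CARD('n) * \<rho>" using z R_nonneg by (intro mult_left_mono) auto
  then have "supp (im_vec z) \<le> R * real CARD('n) * \<rho>" using supp_upper[of "im_vec z"] by linarith
  moreover have "0 \<le> M" by (rule order_trans[OF norm_ge_zero M[of 0]])
  ultimately have "M * exp (3 * supp (im_vec z)) \<le> M * growth_radius \<rho>"
    unfolding growth_radius_def by (intro mult_left_mono) auto
  then show ?thesis using etype_bound[OF assms(1,2) _ M, of 3 z] assms(3) by linarith
qed

lemma expsum_lipschitz_ball:
  assumes f: "expsum (scaled s V) f" and s: "0 \<le> s" "s \<le> 2" and M: "\<And>x. cmod (f (cx x)) \<le> M"
    and z: "norm z \<le> \<rho>" "norm w \<le> \<rho>"
  shows "cmod (f z - f w) \<le> real CARD('n) * (M * lip 2 * growth_radius \<rho>) * norm (z - w)"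
proof -
  obtain f' where f': "\<And>j. expsum (scaled s V) (f' j)"
    "\<And>z. (f has_derivative (\<lambda>v. \<Sum>j\<in>UNIV. v $ j * f' j z)) (at z)" using expsum_partials[OF f] by blast
  have M0: "0 \<le> M" by (rule order_trans[OF norm_ge_zero M[of 0]])
  have real: "cmod (f' j (cx x)) \<le> M * lip 2" for j x
    using partial_bound[OF expsum_etype[OF f s(1)] s(1) M f'(2), where j = j and x = x] mult_left_mono[OF lip_mono[OF s(2)] M0] by linarith
  show ?thesis
  proof (rule differentiable_bound[of "cball 0 \<rho>" f "\<lambda>z v. \<Sum>j\<in>UNIV. v $ j * f' j z"])
    fix x :: "complex ^ 'n" assume x: "x \<in> cball 0 \<rho>"
    show "(f has_derivative (\<lambda>v. \<Sum>j\<in>UNIV. v $ j * f' j x)) (at x within cball 0 \<rho>)"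
      using f'(2) has_derivative_at_withinI by blast
    have "cmod (f' j x) \<le> M * lip 2 * growth_radius \<rho>" for j
      using etype_bound_ball[OF expsum_etype[OF f'(1) s(1)] s real] x by simp
    then show "onorm (\<lambda>v. \<Sum>j\<in>UNIV. v $ j * f' j x) \<le> real CARD('n) * (M * lip 2 * growth_radius \<rho>)"
      using norm_linear_form_le[of "\<chi> j. f' j x"] by (intro onorm_le) auto
  qed (use z in auto)
qed

text \<open>The compactness principle.  The partial derivatives of an exponential sum are exponential sums with the same
  frequencies, so they obey bounds of the same kind.  Passing to a subsequence along which they converge as well
  makes the limit entire; the sharp bound of \<open>etype_bound\<close> survives the limit and gives its type.\<close>
theorem expsum_compactness:
  assumes f: "\<And>n. expsum (scaled (s n) V) (f n)" and s: "\<And>n. 0 \<le> s n" "\<And>n. s n \<le> 2" "s \<longlonglongrightarrow> 1"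
    and M: "\<And>n x. cmod (f n (cx x)) \<le> M"
  obtains k G where "strict_mono (k :: nat \<Rightarrow> nat)" "G \<in> exp_type V"
    "\<And>\<rho> e. 0 < e \<Longrightarrow> \<exists>N. \<forall>n\<ge>N. \<forall>z. norm z \<le> \<rho> \<longrightarrow> norm (f (k n) z - G z) < e"
proof -
  have "\<forall>n. \<exists>f'. (\<forall>j. expsum (scaled (s n) V) (f' j)) \<and> (\<forall>z. (f n has_derivative (\<lambda>v. \<Sum>j\<in>UNIV. v $ j * f' j z)) (at z))"
    by (intro allI expsum_partials f)
  from choice[OF this] obtain f' where f': "\<And>n j. expsum (scaled (s n) V) (f' n j)"
    "\<And>n z. (f n has_derivative (\<lambda>v. \<Sum>j\<in>UNIV. v $ j * f' n j z)) (at z)" by blast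
  have M0: "0 \<le> M" by (rule order_trans[OF norm_ge_zero M[of 0 0]])
  have real: "cmod (f' n j (cx x)) \<le> M * lip 2" for n j x
    using partial_bound[OF expsum_etype[OF f[of n] s(1)] s(1) M f'(2), where j = j and x = x] mult_left_mono[OF lip_mono[OF s(2)] M0, of n] by linarith
  define F where "F n z = (f n z, \<chi> j. f' n j z)" for n z
  have nF: "norm (F n z - F m w) \<le> cmod (f n z - f m w) + (\<Sum>j\<in>UNIV. cmod (f' n j z - f' m j w))" for n m z w
  proof -
    have "norm (F n z - F m w) \<le> cmod (f n z - f m w) + norm ((\<chi> j. f' n j z) - (\<chi> j. f' m j w))"
      unfolding F_def diff_Pair by (rule norm_Pair_le)
    also have "norm ((\<chi> j. f' n j z) - (\<chi> j. f' m j w)) \<le> (\<Sum>j\<in>UNIV. cmod (f' n j z - f' m j w))"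
      using norm_vec_le_sum[of "(\<chi> j. f' n j z) - (\<chi> j. f' m j w)"] by simp
    finally show ?thesis by simp
  qed
  have nF0: "norm (F n z) \<le> cmod (f n z) + (\<Sum>j\<in>UNIV. cmod (f' n j z))" for n z
  proof -
    have "norm (F n z) \<le> cmod (f n z) + norm (\<chi> j. f' n j z)" unfolding F_def by (rule norm_Pair_le)
    also have "norm (\<chi> j. f' n j z) \<le> (\<Sum>j\<in>UNIV. cmod (f' n j z))" using norm_vec_le_sum[of "\<chi> j. f' n j z"] by simp
    finally show ?thesis by simp
  qed
  obtain k G where k: "strict_mono (k :: nat \<Rightarrow> nat)"
    "\<And>\<rho> e. 0 < e \<Longrightarrow> \<exists>N. \<forall>n\<ge>N. \<forall>x. norm x \<le> \<rho> \<longrightarrow> norm (F (k n) x - G x) < e"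
  proof (rule locally_uniform_subsequence[of F])
    fix \<rho> :: real
    have "norm (F n x) \<le> M * growth_radius \<rho> + real CARD('n) * (M * lip 2 * growth_radius \<rho>)" if "norm x \<le> \<rho>" for n x
    proof -
      have "(\<Sum>j\<in>UNIV. cmod (f' n j x)) \<le> (\<Sum>j\<in>(UNIV :: 'n set). M * lip 2 * growth_radius \<rho>)"
        using that by (intro sum_mono etype_bound_ball[OF expsum_etype[OF f'(1) s(1)] s(1,2) real])
      then show ?thesis using nF0[of n x] etype_bound_ball[OF expsum_etype[OF f[of n] s(1)] s(1,2) M that] by simp
    qed
    then show "\<exists>B. \<forall>n x. norm x \<le> \<rho> \<longrightarrow> norm (F n x) \<le> B" by blast
    define L where "L = real CARD('n) * (M * lip 2 * growth_radius \<rho>)"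
    define L' where "L' = real CARD('n) * (M * lip 2 * lip 2 * growth_radius \<rho>)"
    have "norm (F n x - F n y) \<le> (L + real CARD('n) * L') * norm (x - y)" if "norm x \<le> \<rho>" "norm y \<le> \<rho>" for n x y
    proof -
      have "(\<Sum>j\<in>UNIV. cmod (f' n j x - f' n j y)) \<le> (\<Sum>j\<in>(UNIV :: 'n set). L' * norm (x - y))"
        unfolding L'_def using that by (intro sum_mono expsum_lipschitz_ball[OF f'(1) s(1,2) real])
      moreover have "cmod (f n x - f n y) \<le> L * norm (x - y)" unfolding L_def by (rule expsum_lipschitz_ball[OF f s(1,2) M that])
      ultimately show ?thesis using nF[of n x n y] by (simp add: algebra_simps)
    qed
    then show "\<exists>L. \<forall>n x y. norm x \<le> \<rho> \<longrightarrow> norm y \<le> \<rho> \<longrightarrow> norm (F n x - F n y) \<le> L * norm (x - y)" by blast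
  qed blast
  define g where "g z = fst (G z)" for z
  define g' where "g' j z = snd (G z) $ j" for j z
  have ug: "\<exists>N. \<forall>n\<ge>N. \<forall>z. norm z \<le> \<rho> \<longrightarrow> norm (f (k n) z - g z) < e" if "0 < e" for \<rho> e
  proof -
    have "cmod (f (k n) z - g z) \<le> norm (F (k n) z - G z)" for n z
    proof -
      have "F (k n) z - G z = (f (k n) z - g z, (\<chi> j. f' (k n) j z) - snd (G z))"
        by (simp add: F_def g_def prod_eq_iff)
      then show ?thesis by (simp add: norm_fst_le)
    qed
    then show ?thesis using k(2)[OF that, of \<rho>] by (meson order_le_less_trans)
  qed
  have ug': "\<exists>N. \<forall>n\<ge>N. \<forall>z. norm z \<le> \<rho> \<longrightarrow> (\<forall>j. norm (f' (k n) j z - g' j z) < e)" if "0 < e" for \<rho> e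
  proof -
    have "cmod (f' (k n) j z - g' j z) \<le> norm (F (k n) z - G z)" for n z j
    proof -
      have "cmod (f' (k n) j z - g' j z) \<le> norm (snd (F (k n) z - G z))"
        using Finite_Cartesian_Product.norm_nth_le[of "snd (F (k n) z - G z)" j] by (simp add: F_def g'_def)
      also have "\<dots> \<le> norm (F (k n) z - G z)" by (metis norm_snd_le prod.collapse)
      finally show ?thesis .
    qed
    then show ?thesis using k(2)[OF that, of \<rho>] by (meson order_le_less_trans)
  qed
  have lim: "(\<lambda>n. f (k n) z) \<longlonglongrightarrow> g z" for z
    unfolding LIMSEQ_iff using ug[of _ "norm z"] by (meson order_refl)
  have der: "(g has_derivative (\<lambda>v. \<Sum>j\<in>UNIV. v $ j * g' j z)) (at z)" for z
  proof -
    define S where "S = ball (0 :: complex ^ 'n) (norm z + 1)"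
    have "\<exists>h. \<forall>x\<in>S. (\<lambda>n. f (k n) x) \<longlonglongrightarrow> h x \<and> (h has_derivative (\<lambda>v. \<Sum>j\<in>UNIV. v $ j * g' j x)) (at x within S)"
    proof (rule has_derivative_sequence)
      show "convex S" "0 \<in> S" unfolding S_def by (auto intro: convex_ball add_nonneg_pos)
      show "(\<lambda>n. f (k n) 0) \<longlonglongrightarrow> g 0" by (rule lim)
      show "(f (k n) has_derivative (\<lambda>v. \<Sum>j\<in>UNIV. v $ j * f' (k n) j x)) (at x within S)" for n x
        using f'(2) has_derivative_at_withinI by blast
      fix e :: real assume "0 < e"
      define d where "d = e / real CARD('n)"
      have "0 < d" using \<open>0 < e\<close> by (simp add: d_def)
      then obtain N where N: "\<And>n z' j. n \<ge> N \<Longrightarrow> norm z' \<le> norm z + 1 \<Longrightarrow> norm (f' (k n) j z' - g' j z') < d"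
        using ug'[of d "norm z + 1"] by blast
      have "norm ((\<Sum>j\<in>UNIV. h $ j * f' (k n) j x) - (\<Sum>j\<in>UNIV. h $ j * g' j x)) \<le> e * norm h" if "n \<ge> N" "x \<in> S" for n x h
      proof -
        have "norm x \<le> norm z + 1" using that(2) by (simp add: S_def)
        then have le: "cmod ((\<chi> j. f' (k n) j x - g' j x) $ j) \<le> d" for j using less_imp_le[OF N[OF that(1), of x j]] by simp
        show ?thesis using norm_linear_form_le[of "\<chi> j. f' (k n) j x - g' j x" d h, OF le]
          by (simp add: d_def sum_subtractf[symmetric] right_diff_distrib)
      qed
      then show "\<forall>\<^sub>F n in sequentially. \<forall>x\<in>S. \<forall>h. norm ((\<Sum>j\<in>UNIV. h $ j * f' (k n) j x) - (\<Sum>j\<in>UNIV. h $ j * g' j x)) \<le> e * norm h"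
        unfolding eventually_sequentially by blast
    qed
    then obtain h where h: "\<And>x. x \<in> S \<Longrightarrow> (\<lambda>n. f (k n) x) \<longlonglongrightarrow> h x"
      "\<And>x. x \<in> S \<Longrightarrow> (h has_derivative (\<lambda>v. \<Sum>j\<in>UNIV. v $ j * g' j x)) (at x within S)" by blast
    have zS: "z \<in> S" and oS: "open S" unfolding S_def by auto
    have "h x = g x" if "x \<in> S" for x using LIMSEQ_unique[OF h(1)[OF that] lim] .
    moreover have "(h has_derivative (\<lambda>v. \<Sum>j\<in>UNIV. v $ j * g' j z)) (at z)" using h(2)[OF zS] at_within_open[OF zS oS] by simp
    ultimately show ?thesis using has_derivative_transform_within_open[OF _ oS zS, of h _ UNIV g] by simp
  qed
  have "g \<in> exp_type V" unfolding exp_type_def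
  proof (intro CollectI conjI allI impI)
    show "entire g" unfolding entire_def
      using der by (intro allI exI conjI) (auto simp: sum_distrib_left mult_ac)
    fix \<epsilon> :: real assume "0 < \<epsilon>"
    have "cmod (g z) \<le> (M + 1) * exp ((1 + \<epsilon>) * dn z)" for z
    proof -
      have "(\<lambda>n. s (k n)) \<longlonglongrightarrow> 1" using LIMSEQ_subseq_LIMSEQ[OF s(3) k(1)] by (simp add: o_def)
      then have "\<forall>\<^sub>F n in sequentially. s (k n) < 1 + \<epsilon>" using \<open>0 < \<epsilon>\<close> by (auto intro: order_tendstoD)
      then have "\<forall>\<^sub>F n in sequentially. cmod (f (k n) z) \<le> M * exp ((1 + \<epsilon>) * supp (im_vec z))"
        by eventually_elim (rule etype_bound[OF expsum_etype[OF f s(1)] s(1) _ M])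
      then have "cmod (g z) \<le> M * exp ((1 + \<epsilon>) * supp (im_vec z))"
        by (intro tendsto_upperbound[OF tendsto_norm[OF lim]]) auto
      also have "\<dots> \<le> (M + 1) * exp ((1 + \<epsilon>) * dn z)"
        using M0 supp_im_le[of z] \<open>0 < \<epsilon>\<close> by (intro mult_mono) auto
      finally show ?thesis .
    qed
    then show "\<exists>C>0. \<forall>z. cmod (g z) \<le> C * exp ((1 + \<epsilon>) * dn z)" using M0 by (intro exI[of _ "M + 1"]) auto
  qed
  then show thesis using that[OF k(1) _ ug] by blast
qed

end

section \<open>A Nikolskii inequality for polynomials on the cube\<close>

text \<open>Near each point of \<open>[- A, A]\<close> there is room for an interval on which a power of \<open>\<bar>t\<bar>\<close> is bounded below.\<close>
lemma subinterval_away_from_zero: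
  fixes x A \<delta> :: real
  assumes "\<bar>x\<bar> \<le> A" "0 < \<delta>" "\<delta> \<le> A"
  shows "\<exists>u. - A \<le> u \<and> u + \<delta> / 4 \<le> A \<and> (\<forall>t. u \<le> t \<longrightarrow> t \<le> u + \<delta> / 4 \<longrightarrow> \<bar>t - x\<bar> \<le> \<delta> \<and> \<delta> / 4 \<le> \<bar>t\<bar>)"
proof -
  define b where "b = (if x \<le> 0 then x else x - \<delta>)"
  define u where "u = (if - \<delta> / 2 \<le> b then b + 3 * \<delta> / 4 else b)"
  show ?thesis
    by (rule exI[of _ u]) (use assms in \<open>auto simp: u_def b_def abs_le_iff abs_real_def split: if_splits\<close>)
qed

lemma sin_ge: assumes "0 \<le> t" "t \<le> pi / 2" shows "2 / pi * t \<le> sin t"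
proof -
  have "convex_on {0..pi/2} (\<lambda>x. - sin x)"
    by (rule f''_ge0_imp_convex[where f' = "\<lambda>x. - cos x" and f'' = "\<lambda>x. sin x"])
       (auto intro!: derivative_eq_intros sin_ge_zero)
  from convex_onD[OF this, of "2 * t / pi" 0 "pi / 2"] assms show ?thesis by (simp add: field_simps)
qed

lemma abs_sin_ge: "\<bar>t\<bar> \<le> pi / 2 \<Longrightarrow> 2 / pi * \<bar>t\<bar> \<le> \<bar>sin t\<bar>"
  using sin_ge[of "\<bar>t\<bar>"] by (cases "0 \<le> t") auto

text \<open>The image of an interval under the sine is, up to a constant, no shorter than the derivative at any point of the
  interval predicts, uniformly up to \<open>\<plusminus> \<pi> / 2\<close>, where the cosine vanishes: on the interval the cosine never exceeds three times
  its value at the midpoint.\<close>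
lemma sin_increment_ge:
  assumes "- (pi / 2) \<le> u" "u < v" "v \<le> pi / 2" "u \<le> \<theta>" "\<theta> \<le> v"
  shows "(v - u) / 5 * cos \<theta> \<le> sin v - sin u"
proof -
  define d where "d = (v - u) / 2"
  define c where "c = (u + v) / 2"
  have d: "0 < d" "d \<le> pi / 2" using assms by (auto simp: d_def)
  have c: "\<bar>c\<bar> + d \<le> pi / 2" using assms by (auto simp: d_def c_def abs_real_def field_simps)
  have "sin v - sin u = sin (c + d) - sin (c - d)" by (simp add: c_def d_def field_simps)
  then have eq: "sin v - sin u = 2 * (cos c * sin d)" by (simp add: sin_add sin_diff)
  have sd: "2 / pi * d \<le> sin d" using sin_ge d by simp
  have "cos (pi / 2 - d) \<le> cos \<bar>c\<bar>" using c d by (intro cos_monotone_0_pi_le) auto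
  then have cd: "sin d \<le> cos c" by (simp add: cos_diff)
  have "\<bar>cos \<theta> - cos c\<bar> = 2 * (\<bar>sin ((\<theta> + c) / 2)\<bar> * \<bar>sin ((c - \<theta>) / 2)\<bar>)"
    unfolding cos_diff_cos by (simp add: abs_mult)
  also have "\<dots> \<le> 2 * (1 * \<bar>(c - \<theta>) / 2\<bar>)"
    by (intro mult_left_mono mult_mono abs_sin_x_le_abs_x) auto
  also have "\<bar>(c - \<theta>) / 2\<bar> \<le> d / 2" using assms unfolding c_def d_def by (auto simp: abs_le_iff field_simps)
  finally have ct: "cos \<theta> \<le> cos c + d" by linarith
  have "2 * d \<le> pi * cos c" using order_trans[OF sd cd] by (simp add: field_simps)
  moreover have c0: "0 \<le> cos c" using cd sin_ge_zero[of d] d by linarith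
  ultimately have "2 * d \<le> 4 * cos c" using mult_right_mono[OF less_imp_le[OF pi_less_4], of "cos c"] by linarith
  then have c3: "cos \<theta> \<le> 3 * cos c" using ct by simp
  have "(v - u) / 5 * cos \<theta> \<le> 2 / 5 * d * (3 * cos c)"
  proof -
    have "(v - u) / 5 = 2 / 5 * d" by (simp add: d_def)
    then show ?thesis using mult_left_mono[OF c3, of "2 / 5 * d"] d by (simp only:)
  qed
  also have "\<dots> = 2 * (cos c * (3 / 5 * d))" by simp
  also have "\<dots> \<le> 2 * (cos c * sin d)"
  proof -
    have "pi * (3/5) \<le> 2" using pi_approx by simp
    then have "3 / 5 \<le> 2 / pi" by (simp add: field_simps)
    then have "3 / 5 * d \<le> 2 / pi * d" using d by (intro mult_right_mono) auto
    then have "3 / 5 * d \<le> sin d" using sd by linarith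
    then show ?thesis using c0 by (intro mult_left_mono) auto
  qed
  finally show ?thesis using eq by simp
qed

lemma inner_Basis_cart: "b \<in> Basis \<Longrightarrow> \<exists>j. b = axis j (1::real)"
  by (auto simp: Basis_vec_def)

lemma prod_Basis_cart: "(\<Prod>b\<in>Basis. h ((v :: real ^ 'n) \<bullet> b)) = (\<Prod>j\<in>UNIV. h (v $ j))"
proof -
  have "(\<Prod>b\<in>Basis. h (v \<bullet> b)) = (\<Prod>b\<in>(\<lambda>j. axis j 1) ` (UNIV :: 'n set). h (v \<bullet> b))"
    by (rule prod.cong) (auto simp: Basis_vec_def)
  also have "\<dots> = (\<Prod>j\<in>UNIV. h (v $ j))"
    by (subst prod.reindex) (auto simp: inj_on_def axis_eq_axis inner_axis)
  finally show ?thesis .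
qed

lemma emeasure_box_cart:
  fixes l u :: "real ^ 'n"
  assumes "\<And>j. l $ j \<le> u $ j"
  shows "emeasure lborel (box l u) = ennreal (\<Prod>j\<in>UNIV. u $ j - l $ j)"
proof -
  have "l \<bullet> b \<le> u \<bullet> b" if "b \<in> Basis" for b
    using assms inner_Basis_cart[OF that] by (auto simp: inner_axis)
  then have "emeasure lborel (box l u) = ennreal (\<Prod>b\<in>Basis. (u - l) \<bullet> b)" by (rule emeasure_lborel_box)
  also have "(\<Prod>b\<in>Basis. (u - l) \<bullet> b) = (\<Prod>j\<in>UNIV. u $ j - l $ j)" using prod_Basis_cart[of "\<lambda>x. x" "u - l"] by simp
  finally show ?thesis .
qed

lemma jacobi_weight_real:
  assumes "\<And>j. 0 < \<bar>t $ j\<bar> \<and> \<bar>t $ j\<bar> < 1"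
  shows "jacobi_weight \<alpha> \<beta> t = ennreal (\<Prod>j\<in>UNIV. \<bar>t $ j\<bar> powr \<alpha> j * (1 - (t $ j)\<^sup>2) powr \<beta> j)"
proof -
  have "epow \<bar>t $ j\<bar> (\<alpha> j) * epow (1 - (t $ j)\<^sup>2) (\<beta> j) = ennreal (\<bar>t $ j\<bar> powr \<alpha> j * (1 - (t $ j)\<^sup>2) powr \<beta> j)" for j
  proof -
    have "(t $ j)\<^sup>2 < 1" using assms[of j] by (simp add: abs_square_less_1)
    then show ?thesis using assms[of j] by (simp add: epow_def ennreal_mult)
  qed
  then show ?thesis unfolding jacobi_weight_def by (simp add: prod_ennreal)
qed

context solid_body
begin

text \<open>A Nikolskii inequality.  Near a point where \<open>G\<close> attains its maximum it stays above half of the maximum on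
  a cube of side comparable to \<open>1 / a\<close>, by the Bernstein-type estimate \<open>etype_lipschitz\<close>; so the integral is
  at least the weight of that cube.  The factor \<open>\<Prod>\<^sub>j cos\<^sup>2\<^sup>N \<theta>\<^sub>j\<close> makes the remaining exponent of
  \<open>1 - t\<^sub>j\<^sup>2\<close> at most \<open>- 1 / 2\<close>, that of the substitution \<open>t\<^sub>j = sin \<theta>\<^sub>j\<close>.\<close>
lemma nikolskii:
  fixes \<alpha> \<beta> :: "'n \<Rightarrow> real" and P :: "real ^ 'n \<Rightarrow> complex"
  defines "\<kappa> \<equiv> 1 / (2 * real CARD('n) * lip 2)"
  assumes p: "0 < p" and \<alpha>: "\<And>j. 0 \<le> \<alpha> j" and N: "\<And>j. \<beta> j - real N * p \<le> - 1 / 2"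
    and a: "1 \<le> a" "0 \<le> c" "c \<le> a"
    and G: "expsum (scaled (a + c) V) G"
    and GP: "\<And>\<theta>. G (cx \<theta>) = P (\<chi> j. sin (\<theta> $ j)) * of_real (\<Prod>j\<in>UNIV. (1 - (sin (\<theta> $ j))\<^sup>2) ^ N)"
  shows "\<exists>M. (\<forall>\<theta>. cmod (G (cx \<theta>)) \<le> M) \<and>
    ennreal ((M / 2) powr p * (\<Prod>j\<in>UNIV. (\<kappa> / (2 * pi)) powr \<alpha> j * (\<kappa> / 20)) * a powr - homogeneity \<alpha>)
      \<le> jacobi_integral p \<alpha> \<beta> P"
proof -
  have \<kappa>: "0 < \<kappa>" "\<kappa> \<le> 1 / 2"
  proof -
    have "1 * 1 \<le> real CARD('n) * lip 2" using lip_ge_1[of 2] by (intro mult_mono) auto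
    then show "0 < \<kappa>" "\<kappa> \<le> 1 / 2" unfolding \<kappa>_def using lip_pos by (auto simp: field_simps)
  qed
  define \<delta> where "\<delta> = \<kappa> / a"
  have \<delta>: "0 < \<delta>" "\<delta> \<le> pi / 2"
  proof -
    have "\<kappa> / a \<le> \<kappa> / 1" using a \<kappa> by (intro divide_left_mono) auto
    then have "\<delta> \<le> 1 / 2" unfolding \<delta>_def div_by_1 using \<kappa>(2) by linarith
    then show "\<delta> \<le> pi / 2" using pi_ge_two by linarith
    show "0 < \<delta>" unfolding \<delta>_def using \<kappa> a by simp
  qed
  define g where "g \<theta> = cmod (G (cx \<theta>))" for \<theta>
  define C where "C = cbox (\<chi> j. - (pi / 2)) ((\<chi> j. pi / 2) :: real ^ 'n)"
  have Ci: "\<theta> \<in> C \<longleftrightarrow> (\<forall>j. \<bar>\<theta> $ j\<bar> \<le> pi / 2)" for \<theta>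
  proof -
    have "\<bar>x\<bar> \<le> pi / 2 \<longleftrightarrow> - (pi / 2) \<le> x \<and> x \<le> pi / 2" for x by arith
    then show ?thesis by (simp only: C_def mem_box_cart vec_lambda_beta)
  qed
  have "continuous_on C g" unfolding g_def
    by (intro continuous_intros entire_continuous_real expsum_entire[OF G])
  moreover have "compact C" "C \<noteq> {}" using Ci[of 0] by (auto simp: C_def)
  ultimately obtain \<tau> where \<tau>: "\<tau> \<in> C" "\<And>\<theta>. \<theta> \<in> C \<Longrightarrow> g \<theta> \<le> g \<tau>"
    using continuous_attains_sup[of C g] by blast
  define M where "M = g \<tau>"
  have M: "g \<theta> \<le> M" for \<theta>
  proof -
    have "(\<chi> j. arcsin (sin (\<theta> $ j))) \<in> C" unfolding Ci
    proof
      fix j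
      show "\<bar>(\<chi> j. arcsin (sin (\<theta> $ j))) $ j\<bar> \<le> pi / 2" using arcsin_bounded[OF sin_ge_minus_one sin_le_one, of "\<theta> $ j"] unfolding vec_lambda_beta by linarith
    qed
    from \<tau>(2)[OF this] show ?thesis unfolding g_def GP M_def by simp
  qed
  have M0: "0 \<le> M" by (simp add: M_def g_def)
  have half: "M / 2 \<le> g \<theta>" if "\<And>j. \<bar>\<theta> $ j - \<tau> $ j\<bar> \<le> \<delta>" for \<theta>
  proof -
    define f where "f z = G ((1 / a) *\<^sub>R z)" for z
    define s where "s = (a + c) / a"
    have s: "0 \<le> s" "s \<le> 2" using a by (auto simp: s_def field_simps)
    have ef: "expsum (scaled s V) f" unfolding f_def
      by (rule expsum_scale[OF G]) (auto simp: s_def)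
    have scx: "(1 / a) *\<^sub>R cx x = cx ((1 / a) *\<^sub>R x)" for x by (simp add: vec_eq_iff scaleR_conv_of_real[where 'a = complex])
    have fM: "cmod (f (cx x)) \<le> M" for x using M[of "(1 / a) *\<^sub>R x"] unfolding f_def g_def scx .
    have fG: "f (cx (a *\<^sub>R x)) = G (cx x)" for x unfolding f_def scx using a by simp
    have "norm (\<theta> - \<tau>) \<le> (\<Sum>j\<in>UNIV. \<bar>(\<theta> - \<tau>) $ j\<bar>)" by (rule norm_le_l1_cart)
    also have "\<dots> \<le> (\<Sum>j\<in>(UNIV :: 'n set). \<delta>)" using that by (intro sum_mono) auto
    finally have n: "norm (\<theta> - \<tau>) \<le> real CARD('n) * \<delta>" by simp
    have "cmod (f (cx (a *\<^sub>R \<theta>)) - f (cx (a *\<^sub>R \<tau>))) \<le> M * lip s * norm (a *\<^sub>R \<theta> - a *\<^sub>R \<tau>)"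
      by (rule etype_lipschitz[OF expsum_etype[OF ef s(1)] s(1) fM])
    also have "\<dots> \<le> M * lip 2 * (a * (real CARD('n) * \<delta>))"
    proof (intro mult_mono)
      show "norm (a *\<^sub>R \<theta> - a *\<^sub>R \<tau>) \<le> a * (real CARD('n) * \<delta>)"
        using n a by (simp add: scaleR_diff_right[symmetric])
    qed (use M0 lip_mono[OF s(2)] less_imp_le[OF lip_pos[of 2]] less_imp_le[OF lip_pos[of s]] in auto)
    also have "\<dots> = M / 2" using a lip_pos[of 2] by (simp add: \<delta>_def \<kappa>_def)
    finally have "cmod (G (cx \<theta>) - G (cx \<tau>)) \<le> M / 2" unfolding fG .
    then show ?thesis using norm_triangle_ineq2[of "G (cx \<tau>)" "G (cx \<theta>)"] by (simp add: g_def M_def norm_minus_commute)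
  qed
  \<comment> \<open>The small cube on which the integrand is bounded below; it avoids the coordinate hyperplanes, where the weight
      may vanish.\<close>
  have "\<forall>j. \<exists>u. - (pi/2) \<le> u \<and> u + \<delta> / 4 \<le> pi/2 \<and> (\<forall>t. u \<le> t \<longrightarrow> t \<le> u + \<delta> / 4 \<longrightarrow> \<bar>t - \<tau> $ j\<bar> \<le> \<delta> \<and> \<delta> / 4 \<le> \<bar>t\<bar>)"
    using \<tau>(1) \<delta> unfolding Ci by (intro allI subinterval_away_from_zero) auto
  from choice[OF this] obtain u where u: "\<And>j. - (pi/2) \<le> u j" "\<And>j. u j + \<delta> / 4 \<le> pi/2"
    "\<And>j t. u j \<le> t \<Longrightarrow> t \<le> u j + \<delta> / 4 \<Longrightarrow> \<bar>t - \<tau> $ j\<bar> \<le> \<delta> \<and> \<delta> / 4 \<le> \<bar>t\<bar>" by blast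
  define lo where "lo = (\<chi> j. sin (u j))"
  define hi where "hi = (\<chi> j. sin (u j + \<delta> / 4))"
  define len where "len j = hi $ j - lo $ j" for j
  have len: "0 < len j" for j unfolding len_def lo_def hi_def using u[of j] \<delta> by (simp add: sin_monotone_2pi)
  \<comment> \<open>Dividing by the length of the side in the variable \<open>t\<close> makes the integral over the cube independent of it.\<close>
  define K where "K = (M / 2) powr p * (\<Prod>j\<in>UNIV. (\<delta> / (2 * pi)) powr \<alpha> j * (\<delta> / 20 / len j))"
  have pt: "ennreal K \<le> ennreal (cmod (P t) powr p) * jacobi_weight \<alpha> \<beta> t * indicator cube t" if "t \<in> box lo hi" for t
  proof -
    have t: "sin (u j) < t $ j" "t $ j < sin (u j + \<delta> / 4)" for j using that by (auto simp: mem_box_cart lo_def hi_def)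
    have t1: "\<bar>t $ j\<bar> < 1" for j using t[of j] sin_ge_minus_one[of "u j"] sin_le_one[of "u j + \<delta> / 4"] by linarith
    define \<theta> where "\<theta> = (\<chi> j. arcsin (t $ j))"
    have st: "sin (\<theta> $ j) = t $ j" for j using t1[of j] by (simp add: \<theta>_def)
    have \<theta>: "u j \<le> \<theta> $ j" "\<theta> $ j \<le> u j + \<delta> / 4" for j
    proof -
      have "arcsin (sin (u j)) \<le> arcsin (t $ j)" "arcsin (t $ j) \<le> arcsin (sin (u j + \<delta> / 4))"
        using t[of j] t1[of j] by (auto intro!: arcsin_le_arcsin)
      moreover have "arcsin (sin (u j)) = u j" "arcsin (sin (u j + \<delta> / 4)) = u j + \<delta> / 4" using u[of j] \<delta> by (auto intro!: arcsin_sin)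
      ultimately show "u j \<le> \<theta> $ j" "\<theta> $ j \<le> u j + \<delta> / 4" by (simp_all add: \<theta>_def)
    qed
    have th: "\<bar>\<theta> $ j - \<tau> $ j\<bar> \<le> \<delta>" "\<delta> / 4 \<le> \<bar>\<theta> $ j\<bar>" for j using u(3)[OF \<theta>] by auto
    have tl: "\<delta> / (2 * pi) \<le> \<bar>t $ j\<bar>" for j
    proof -
      have "\<bar>\<theta> $ j\<bar> \<le> pi / 2" using \<theta>[of j] u(1,2)[of j] by (auto simp: abs_le_iff)
      then have "2 / pi * \<bar>\<theta> $ j\<bar> \<le> \<bar>t $ j\<bar>" using abs_sin_ge[of "\<theta> $ j"] st[of j] by simp
      moreover have "2 / pi * (\<delta> / 4) \<le> 2 / pi * \<bar>\<theta> $ j\<bar>" using th(2)[of j] by (intro mult_left_mono) auto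
      ultimately show ?thesis by simp
    qed
    have t0: "0 < \<bar>t $ j\<bar>" for j using tl[of j] \<delta> pi_gt_zero by (smt (verit) divide_pos_pos)
    have D: "0 < 1 - (t $ j)\<^sup>2" "1 - (t $ j)\<^sup>2 \<le> 1" for j using t1[of j] by (auto simp: abs_square_less_1)
    define D where "D = (\<Prod>j\<in>UNIV. (1 - (t $ j)\<^sup>2) ^ N)"
    have D0: "0 < D" unfolding D_def using D by (intro prod_pos) auto
    have "M / 2 \<le> cmod (P t) * D"
      using half[of \<theta>, OF th(1)] D0 unfolding g_def GP st D_def[symmetric] by (simp add: norm_mult vec_lambda_eta)
    then have "(M / 2) powr p \<le> (cmod (P t) * D) powr p" using M0 p by (intro powr_mono2) auto
    also have "\<dots> = cmod (P t) powr p * (\<Prod>j\<in>UNIV. (1 - (t $ j)\<^sup>2) powr (real N * p))"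
    proof -
      have "D powr p = (\<Prod>j\<in>UNIV. ((1 - (t $ j)\<^sup>2) ^ N) powr p)" unfolding D_def
        by (rule prod_powr_distrib)
      also have "\<dots> = (\<Prod>j\<in>UNIV. (1 - (t $ j)\<^sup>2) powr (real N * p))"
        using D by (intro prod.cong) (auto simp: powr_powr[symmetric] powr_realpow)
      finally show ?thesis using D0 by (simp add: powr_mult)
    qed
    finally have m1: "(M / 2) powr p \<le> cmod (P t) powr p * (\<Prod>j\<in>UNIV. (1 - (t $ j)\<^sup>2) powr (real N * p))" .
    have fac: "(\<delta> / (2 * pi)) powr \<alpha> j * (\<delta> / 20 / len j) \<le> \<bar>t $ j\<bar> powr \<alpha> j * (1 - (t $ j)\<^sup>2) powr (\<beta> j - real N * p)" for j
    proof (intro mult_mono)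
      show "(\<delta> / (2 * pi)) powr \<alpha> j \<le> \<bar>t $ j\<bar> powr \<alpha> j" using tl[of j] \<delta> \<alpha>[of j] by (intro powr_mono2) auto
      have c: "0 < cos (\<theta> $ j)" "cos (\<theta> $ j) = sqrt (1 - (t $ j)\<^sup>2)"
        using t1[of j] D[of j] by (auto simp: \<theta>_def cos_arcsin abs_less_iff)
      have "\<delta> / 20 * cos (\<theta> $ j) \<le> len j" using sin_increment_ge[OF u(1) _ u(2) \<theta>, of j] \<delta> by (simp add: len_def lo_def hi_def)
      then have "\<delta> / 20 / len j \<le> 1 / cos (\<theta> $ j)" using c(1) len[of j] by (simp add: field_simps)
      also have "\<dots> = (1 - (t $ j)\<^sup>2) powr (- (1 / 2))" unfolding c(2) using D[of j]
        by (simp add: powr_minus powr_half_sqrt inverse_eq_divide)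
      also have "\<dots> \<le> (1 - (t $ j)\<^sup>2) powr (\<beta> j - real N * p)"
        using N[of j] D[of j] by (intro powr_mono') auto
      finally show "\<delta> / 20 / len j \<le> (1 - (t $ j)\<^sup>2) powr (\<beta> j - real N * p)" .
    qed (use \<delta> len[of j] in auto)
    have "K \<le> cmod (P t) powr p * (\<Prod>j\<in>UNIV. (1 - (t $ j)\<^sup>2) powr (real N * p)) *
      (\<Prod>j\<in>UNIV. \<bar>t $ j\<bar> powr \<alpha> j * (1 - (t $ j)\<^sup>2) powr (\<beta> j - real N * p))"
      unfolding K_def
    proof (rule mult_mono[OF m1])
      have nn: "0 \<le> (\<delta> / (2 * pi)) powr \<alpha> j * (\<delta> / 20 / len j)" for j using \<delta> len[of j] by simp
      then show "0 \<le> (\<Prod>j\<in>UNIV. (\<delta> / (2 * pi)) powr \<alpha> j * (\<delta> / 20 / len j))" by (intro prod_nonneg) auto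
      show "(\<Prod>j\<in>UNIV. (\<delta> / (2 * pi)) powr \<alpha> j * (\<delta> / 20 / len j)) \<le> (\<Prod>j\<in>UNIV. \<bar>t $ j\<bar> powr \<alpha> j * (1 - (t $ j)\<^sup>2) powr (\<beta> j - real N * p))"
        using nn fac by (intro prod_mono) auto
      show "0 \<le> cmod (P t) powr p * (\<Prod>j\<in>UNIV. (1 - (t $ j)\<^sup>2) powr (real N * p))" by (intro mult_nonneg_nonneg prod_nonneg) auto
    qed
    also have "\<dots> = cmod (P t) powr p * (\<Prod>j\<in>UNIV. \<bar>t $ j\<bar> powr \<alpha> j * (1 - (t $ j)\<^sup>2) powr \<beta> j)"
    proof -
      have "(1 - (t $ j)\<^sup>2) powr (real N * p) * (1 - (t $ j)\<^sup>2) powr (\<beta> j - real N * p) = (1 - (t $ j)\<^sup>2) powr \<beta> j" for j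
        by (simp add: powr_add[symmetric])
      then show ?thesis by (simp add: mult.assoc prod.distrib[symmetric]) (simp add: mult.left_commute)
    qed
    finally have "ennreal K \<le> ennreal (cmod (P t) powr p) * jacobi_weight \<alpha> \<beta> t"
      using jacobi_weight_real[of t \<alpha> \<beta>] t0 t1 by (simp add: ennreal_mult[symmetric] prod_nonneg ennreal_leI)
    moreover have "t \<in> cube" using t1 by (auto simp: cube_def less_imp_le)
    ultimately show ?thesis by simp
  qed
  have "ennreal (K * (\<Prod>j\<in>UNIV. len j)) = ennreal K * emeasure lborel (box lo hi)"
  proof -
    have "emeasure lborel (box lo hi) = ennreal (\<Prod>j\<in>UNIV. len j)"
      unfolding len_def by (rule emeasure_box_cart) (use len in \<open>auto simp: len_def intro: less_imp_le\<close>)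
    moreover have "0 \<le> K" unfolding K_def using \<delta> len by (intro mult_nonneg_nonneg prod_nonneg) (auto intro: less_imp_le)
    ultimately show ?thesis using len by (simp add: ennreal_mult prod_nonneg less_imp_le)
  qed
  also have "\<dots> = (\<integral>\<^sup>+ t. ennreal K * indicator (box lo hi) t \<partial>lborel)" by (simp add: nn_integral_cmult_indicator)
  also have "\<dots> \<le> jacobi_integral p \<alpha> \<beta> P"
  proof (rule nn_integral_mono)
    fix t
    show "ennreal K * indicator (box lo hi) t \<le> ennreal (cmod (P t) powr p) * jacobi_weight \<alpha> \<beta> t * indicator cube t"
      using pt[of t] by (cases "t \<in> box lo hi") simp_all
  qed
  also have "K * (\<Prod>j\<in>UNIV. len j) = (M / 2) powr p * (\<Prod>j\<in>UNIV. (\<kappa> / (2 * pi)) powr \<alpha> j * (\<kappa> / 20)) * a powr - homogeneity \<alpha>"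
  proof -
    have "K * (\<Prod>j\<in>UNIV. len j) = (M / 2) powr p * (\<Prod>j\<in>UNIV. (\<delta> / (2 * pi)) powr \<alpha> j * (\<delta> / 20))"
    proof -
      have "(\<delta> / (2 * pi)) powr \<alpha> j * (\<delta> / 20 / len j) * len j = (\<delta> / (2 * pi)) powr \<alpha> j * (\<delta> / 20)" for j using len[of j] by simp
      then have "(\<Prod>j\<in>UNIV. (\<delta> / (2 * pi)) powr \<alpha> j * (\<delta> / 20 / len j)) * (\<Prod>j\<in>UNIV. len j) = (\<Prod>j\<in>UNIV. (\<delta> / (2 * pi)) powr \<alpha> j * (\<delta> / 20))"
        by (simp only: prod.distrib[symmetric])
      then show ?thesis unfolding K_def by (simp only: mult.assoc)
    qed
    also have "(\<Prod>j\<in>UNIV. (\<delta> / (2 * pi)) powr \<alpha> j * (\<delta> / 20)) = (\<Prod>j\<in>UNIV. ((\<kappa> / (2 * pi)) powr \<alpha> j * (\<kappa> / 20)) * a powr - (1 + \<alpha> j))"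
    proof (rule prod.cong[OF refl])
      fix j
      have "(\<delta> / (2 * pi)) powr \<alpha> j = (\<kappa> / (2 * pi)) powr \<alpha> j * a powr - \<alpha> j"
        using \<kappa> a by (simp add: \<delta>_def powr_mult[symmetric] powr_minus powr_divide field_simps)
      moreover have "\<delta> / 20 = \<kappa> / 20 * a powr - 1" using a by (simp add: \<delta>_def powr_minus inverse_eq_divide)
      moreover have "a powr - (1 + \<alpha> j) = a powr - \<alpha> j * a powr - 1"
      proof -
        have "- (1 + \<alpha> j) = - \<alpha> j + - 1" by simp
        then show ?thesis by (simp only: powr_add)
      qed
      ultimately show "(\<delta> / (2 * pi)) powr \<alpha> j * (\<delta> / 20) = ((\<kappa> / (2 * pi)) powr \<alpha> j * (\<kappa> / 20)) * a powr - (1 + \<alpha> j)"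
        by (simp only: mult_ac)
    qed
    also have "\<dots> = (\<Prod>j\<in>UNIV. (\<kappa> / (2 * pi)) powr \<alpha> j * (\<kappa> / 20)) * (\<Prod>j\<in>UNIV. a powr - (1 + \<alpha> j))" by (rule prod.distrib)
    also have "(\<Prod>j\<in>UNIV. a powr - (1 + \<alpha> j)) = a powr - homogeneity \<alpha>"
    proof -
      have "(\<Sum>j\<in>UNIV. - (1 + \<alpha> j)) = - homogeneity \<alpha>" by (simp only: sum_negf sum.distrib) simp
      then show ?thesis using powr_sum[of a "\<lambda>j. - (1 + \<alpha> j)" "UNIV :: 'n set"] a by simp
    qed
    finally show ?thesis by (simp add: mult_ac)
  qed
  finally show ?thesis using M unfolding g_def by blast
qed

end

section \<open>Weights, norms and polynomials\<close>

lemma nn_integral_lebesgue_on: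
  assumes "\<Omega> \<in> sets lebesgue"
  shows "(\<integral>\<^sup>+ t. F t \<partial>(lebesgue_on \<Omega>)) = (\<integral>\<^sup>+ t. F t * indicator \<Omega> t \<partial>lborel)"
  using assms by (simp add: nn_integral_restrict_space nn_integral_completion)

lemma nn_integral_scale:
  fixes F :: "real ^ 'n \<Rightarrow> ennreal"
  assumes [measurable]: "F \<in> borel_measurable borel" and b: "0 < b"
  shows "(\<integral>\<^sup>+ x. F ((1 / b) *\<^sub>R x) \<partial>lborel) = ennreal (b ^ CARD('n)) * (\<integral>\<^sup>+ x. F x \<partial>lborel)"
proof -
  have "(\<integral>\<^sup>+ x. F x \<partial>lborel) = (\<integral>\<^sup>+ x. F x \<partial>(density (distr lborel borel (\<lambda>x. 0 + (1 / b) *\<^sub>R x)) (\<lambda>_. ennreal (\<bar>1 / b\<bar> ^ DIM(real ^ 'n)))))"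
    using b by (subst lborel_affine[of "1 / b" 0]) auto
  also have "\<dots> = ennreal ((1 / b) ^ CARD('n)) * (\<integral>\<^sup>+ x. F ((1 / b) *\<^sub>R x) \<partial>lborel)"
    using b by (simp add: nn_integral_density nn_integral_distr nn_integral_cmult)
  finally have "ennreal (b ^ CARD('n)) * (\<integral>\<^sup>+ x. F x \<partial>lborel) =
    (ennreal (b ^ CARD('n)) * ennreal ((1 / b) ^ CARD('n))) * (\<integral>\<^sup>+ x. F ((1 / b) *\<^sub>R x) \<partial>lborel)"
    by (simp add: mult.assoc)
  also have "ennreal (b ^ CARD('n)) * ennreal ((1 / b) ^ CARD('n)) = 1"
    using b by (simp add: ennreal_mult[symmetric] power_mult_distrib[symmetric])
  finally show ?thesis by simp
qed

lemma Lnorm_finite_imp: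
  assumes "\<Omega> \<in> sets lebesgue" "Lnorm p W \<Omega> F < \<infinity>"
  obtains I where "0 \<le> I" "(\<integral>\<^sup>+ t. ennreal (cmod (F t) powr p) * W t * indicator \<Omega> t \<partial>lborel) = ennreal I"
    "Lnorm p W \<Omega> F = ennreal (I powr (1 / p))"
proof -
  define J where "J = (\<integral>\<^sup>+ t. ennreal (cmod (F t) powr p) * W t \<partial>(lebesgue_on \<Omega>))"
  have J: "J = (\<integral>\<^sup>+ t. ennreal (cmod (F t) powr p) * W t * indicator \<Omega> t \<partial>lborel)"
    unfolding J_def by (rule nn_integral_lebesgue_on[OF assms(1)])
  have "J \<noteq> \<infinity>" using assms(2) unfolding Lnorm_def Let_def J_def[symmetric] by (auto split: if_splits)
  then have "J = ennreal (enn2real J)" by (simp add: less_top)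
  then show thesis using that[of "enn2real J"] \<open>J \<noteq> \<infinity>\<close> unfolding J[symmetric] Lnorm_def Let_def J_def[symmetric] by simp
qed

lemma mem_BL_intro:
  fixes \<phi> :: "complex ^ 'n \<Rightarrow> complex"
  assumes \<phi>: "\<phi> \<in> exp_type V" and p: "0 < p"
    and fin: "(\<integral>\<^sup>+ x. ennreal (cmod (\<phi> (cx x)) powr p) * W x \<partial>lborel) < \<infinity>"
  shows "real_restriction \<phi> \<in> BL V p W"
  unfolding BL_def Lspace_def
proof (intro IntI CollectI conjI imageI \<phi>)
  have ent: "entire \<phi>" using \<phi> by (simp add: exp_type_def)
  have eq: "real_restriction \<phi> = (\<lambda>x. \<phi> (cx x))" by (rule ext) (rule real_restriction_eq)
  have "continuous_on UNIV (real_restriction \<phi>)" unfolding eq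
    by (rule entire_continuous_real[OF ent])
  then have "real_restriction \<phi> \<in> borel_measurable borel" by (rule borel_measurable_continuous_onI)
  then show "real_restriction \<phi> \<in> borel_measurable (lebesgue_on UNIV)"
    unfolding lebesgue_on_UNIV_eq by (intro measurable_completion) simp
  have "(\<integral>\<^sup>+ t. ennreal (cmod (real_restriction \<phi> t) powr p) * W t \<partial>(lebesgue_on UNIV)) < \<infinity>"
    using fin by (subst nn_integral_lebesgue_on) (auto simp: eq)
  then show "Lnorm p W UNIV (real_restriction \<phi>) < \<infinity>" unfolding Lnorm_def Let_def by auto
qed

lemma Lnorm_le:
  assumes "0 < p" "\<Omega> \<in> sets lebesgue" "0 \<le> Z"
    and "(\<integral>\<^sup>+ t. ennreal (cmod (F t) powr p) * W t * indicator \<Omega> t \<partial>lborel) \<le> ennreal Z"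
  shows "Lnorm p W \<Omega> F \<le> ennreal (Z powr (1 / p))"
proof -
  define I where "I = (\<integral>\<^sup>+ t. ennreal (cmod (F t) powr p) * W t \<partial>(lebesgue_on \<Omega>))"
  have "I \<le> ennreal Z" unfolding I_def using assms by (simp add: nn_integral_lebesgue_on)
  then have "I \<noteq> \<infinity>" "enn2real I \<le> Z" using assms(3) by (auto simp: enn2real_leI top_unique)
  then show ?thesis unfolding Lnorm_def Let_def I_def[symmetric] using assms by (auto intro!: ennreal_leI powr_mono2)
qed

lemma epow_measurable [measurable]: "(\<lambda>x. epow x b) \<in> borel_measurable borel"
  unfolding epow_def by measurable

lemma vec_nth_measurable [measurable]: "(\<lambda>x :: real ^ 'n. x $ j) \<in> borel_measurable borel"
  by (intro borel_measurable_continuous_onI continuous_intros)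

lemma jacobi_weight_measurable [measurable]: "jacobi_weight \<alpha> \<beta> \<in> borel_measurable borel"
  unfolding jacobi_weight_def[abs_def]
  by (intro borel_measurable_prod_ennreal borel_measurable_times_ennreal measurable_compose[OF _ epow_measurable]) measurable

lemma power_weight_measurable [measurable]: "power_weight \<alpha> \<in> borel_measurable borel"
  unfolding power_weight_def[abs_def]
  by (intro borel_measurable_prod_ennreal measurable_compose[OF _ epow_measurable]) measurable

lemma cube_eq_cbox: "cube = cbox (\<chi> j. - 1) (\<chi> j. 1 :: real ^ 'n)"
proof -
  have "\<bar>x\<bar> \<le> 1 \<longleftrightarrow> - 1 \<le> x \<and> x \<le> 1" for x :: real by arith
  then show ?thesis by (intro set_eqI) (simp only: cube_def mem_Collect_eq mem_box_cart vec_lambda_beta)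
qed

lemma closed_cube: "closed (cube :: (real ^ 'n) set)"
  unfolding cube_eq_cbox by (rule closed_cbox)

lemma polys_continuous: "P \<in> polys a V \<Longrightarrow> continuous_on A P"
  unfolding polys_def by (auto intro!: continuous_intros)

lemma polys_measurable: "P \<in> polys a V \<Longrightarrow> P \<in> borel_measurable borel"
  by (intro borel_measurable_continuous_onI polys_continuous)

lemma epow_scale: "0 \<le> \<alpha> \<Longrightarrow> 0 < b \<Longrightarrow> ennreal (b powr \<alpha>) * epow \<bar>x / b\<bar> \<alpha> = epow \<bar>x\<bar> \<alpha>"
  by (auto simp: epow_def ennreal_mult[symmetric] powr_divide)

lemma epow_finite: "0 \<le> \<alpha> \<Longrightarrow> epow x \<alpha> < \<infinity>"
  by (auto simp: epow_def)

lemma power_weight_finite: "(\<And>j. 0 \<le> \<alpha> j) \<Longrightarrow> power_weight \<alpha> x < \<infinity>"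
proof -
  assume \<alpha>: "\<And>j. 0 \<le> \<alpha> j"
  have "power_weight \<alpha> x = (\<Prod>j\<in>UNIV. ennreal (enn2real (epow \<bar>x $ j\<bar> (\<alpha> j))))"
    unfolding power_weight_def using epow_finite[OF \<alpha>] by (intro prod.cong refl) (simp add: less_top)
  also have "\<dots> = ennreal (\<Prod>j\<in>UNIV. enn2real (epow \<bar>x $ j\<bar> (\<alpha> j)))" by (rule prod_ennreal) simp
  finally show ?thesis by simp
qed

context solid_body
begin

text \<open>Under \<open>t\<^sub>j = sin \<theta>\<^sub>j\<close> a monomial with exponent \<open>k\<close> becomes a trigonometric polynomial with frequencies in the box
  spanned by \<open>k\<close>, which lies in \<open>a V\<close> by the \<Pi>-condition.  The factor \<open>\<Prod>\<^sub>j cos\<^sup>2\<^sup>N \<theta>\<^sub>j\<close> enlarges the body by an amount that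
  does not grow with \<open>a\<close>.\<close>
lemma poly_expsum:
  assumes "P \<in> polys a V" "0 \<le> a" "0 < N"
  shows "\<exists>G. expsum (scaled (a + 2 * real N / r) V) G \<and>
    (\<forall>\<theta>. G (cx \<theta>) = P (\<chi> j. sin (\<theta> $ j)) * of_real (\<Prod>j\<in>UNIV. (1 - (sin (\<theta> $ j))\<^sup>2) ^ N))"
proof -
  obtain d where P: "P = (\<lambda>x. \<Sum>k \<in> lattice_points (scaled a V). d k * (\<Prod>j\<in>UNIV. complex_of_real (x $ j) ^ (k $ j)))"
    using assms(1) unfolding polys_def by blast
  define c where "c = 2 * real N / r"
  have c: "0 < c" using assms r_pos by (simp add: c_def)
  define G where "G z = (\<Sum>k \<in> lattice_points (scaled a V). d k * ((\<Prod>j\<in>UNIV. sin (z $ j) ^ (k $ j)) * (\<Prod>j\<in>UNIV. cos (z $ j) ^ (2 * N))))" for z :: "complex ^ 'n"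
  have "expsum (scaled (a + c) V) G" unfolding G_def
  proof (intro expsum_sum expsum_cmult)
    fix k assume k: "k \<in> lattice_points (scaled a V)"
    have k: "(\<chi> j. real (k $ j)) \<in> scaled a V" using k by (simp add: lattice_points_def)
    have "(\<chi> j. real (2 * N)) \<in> scaled c V" using c r_pos by (intro scaled_cube) (auto simp: c_def)
    from scaled_sum[OF assms(2) less_imp_le[OF c] k this]
    have sum: "(\<chi> j. real (k $ j)) + (\<chi> j. real (2 * N)) \<in> scaled (a + c) V" .
    have "ibox ((\<chi> j. real (k $ j)) + (\<chi> j. real (2 * N))) \<subseteq> scaled (a + c) V"
    proof
      fix l assume "l \<in> ibox ((\<chi> j. real (k $ j)) + (\<chi> j. real (2 * N)))"
      then have "\<bar>l $ j\<bar> \<le> \<bar>((\<chi> j. real (k $ j)) + (\<chi> j. real (2 * N))) $ j\<bar>" for j by (auto simp: ibox_def)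
      then show "l \<in> scaled (a + c) V" using assms(2) c by (intro scaled_solid[OF _ sum]) auto
    qed
    then show "expsum (scaled (a + c) V) (\<lambda>z. (\<Prod>j\<in>UNIV. sin (z $ j) ^ (k $ j)) * (\<Prod>j\<in>UNIV. cos (z $ j) ^ (2 * N)))"
      by (rule expsum_mono[OF expsum_ibox_mult[OF expsum_prod_sin expsum_prod_cos]])
  qed
  moreover have "G (cx \<theta>) = P (\<chi> j. sin (\<theta> $ j)) * of_real (\<Prod>j\<in>UNIV. (1 - (sin (\<theta> $ j))\<^sup>2) ^ N)" for \<theta>
  proof -
    have "(1 - (sin (\<theta> $ j))\<^sup>2) ^ N = cos (\<theta> $ j) ^ (2 * N)" for j by (simp add: cos_squared_eq[symmetric] power_mult)
    then show ?thesis unfolding G_def P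
      by (simp add: sum_distrib_right mult.assoc sin_of_real cos_of_real)
  qed
  ultimately show ?thesis unfolding c_def by blast
qed

end

section \<open>Limits of rescaled polynomials\<close>

lemma tendsto_mult_arcsin_div:
  fixes x :: real
  assumes b: "filterlim b at_top sequentially"
  shows "(\<lambda>n. b n * arcsin (x / b n)) \<longlonglongrightarrow> x"
proof (cases "x = 0")
  case False
  have "(arcsin has_real_derivative inverse (sqrt (1 - 0\<^sup>2))) (at 0)" by (rule DERIV_arcsin) auto
  then have d: "((\<lambda>h. arcsin h / h) \<longlongrightarrow> 1) (at 0)" unfolding DERIV_def by simp
  have "(\<lambda>n. x / b n) \<longlonglongrightarrow> 0" by (rule real_tendsto_divide_at_top[OF tendsto_const b])
  moreover have "\<forall>\<^sub>F n in sequentially. x / b n \<noteq> 0"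
    using filterlim_at_top_dense[THEN iffD1, OF b, rule_format, of 0] by eventually_elim (use False in auto)
  ultimately have "filterlim (\<lambda>n. x / b n) (at 0) sequentially" by (simp add: filterlim_at)
  from filterlim_compose[OF d this] have "(\<lambda>n. x * (arcsin (x / b n) / (x / b n))) \<longlonglongrightarrow> x * 1" by (intro tendsto_intros)
  then show ?thesis using False by (simp add: mult.commute)
qed simp

context solid_body
begin

text \<open>Normalised polynomials with bounded weighted norm converge, after rescaling and along a subsequence, to an
  entire function of type \<open>V\<close>: the Nikolskii inequality bounds the associated exponential sums uniformly, and these
  converge by compactness.  The norm can only drop, by Fatou's lemma, because the rescaled Jacobi weight tends
  to the power weight pointwise.\<close>
theorem limit_of_rescaled_polynomials:
  fixes \<alpha> \<beta> :: "'n \<Rightarrow> real"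
  defines "q \<equiv> homogeneity \<alpha>"
  assumes p: "0 < p" and \<alpha>: "\<And>j. 0 \<le> \<alpha> j"
    and a: "\<And>n. 1 \<le> a n" "\<And>n. 2 * real N / r \<le> a n" "filterlim a at_top sequentially"
    and N: "0 < N" "\<And>j. \<beta> j - real N * p \<le> - 1 / 2"
    and P: "\<And>n. P n \<in> polys (a n) V" "\<And>n. P n 0 = 1"
    and J: "\<And>n. jacobi_integral p \<alpha> \<beta> (P n) \<le> ennreal (a n powr - q * J n)"
    and J0: "\<And>n. 0 \<le> J n" "J \<longlonglongrightarrow> L"
  shows "\<exists>f \<in> BL V p (power_weight \<alpha>). f 0 = 1 \<and>
    power_integral p \<alpha> f \<le> ennreal L"
proof -
  define c where "c = 2 * real N / r"
  have c: "0 < c" "\<And>n. c \<le> a n" using N r_pos a by (auto simp: c_def)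
  have a0: "0 < a n" for n using a(1)[of n] by simp
  have "\<forall>n. \<exists>G. expsum (scaled (a n + c) V) G \<and>
    (\<forall>\<theta>. G (cx \<theta>) = P n (\<chi> j. sin (\<theta> $ j)) * of_real (\<Prod>j\<in>UNIV. (1 - (sin (\<theta> $ j))\<^sup>2) ^ N))"
    unfolding c_def using poly_expsum[OF P(1) less_imp_le[OF a0] N(1)] by blast
  from choice[OF this] obtain G where G: "\<And>n. expsum (scaled (a n + c) V) (G n)"
    "\<And>n \<theta>. G n (cx \<theta>) = P n (\<chi> j. sin (\<theta> $ j)) * of_real (\<Prod>j\<in>UNIV. (1 - (sin (\<theta> $ j))\<^sup>2) ^ N)" by blast
  define K where "K = (\<Prod>j\<in>(UNIV :: 'n set). (1 / (2 * real CARD('n) * lip 2) / (2 * pi)) powr \<alpha> j * (1 / (2 * real CARD('n) * lip 2) / 20))"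
  have K: "0 < K" unfolding K_def using lip_pos[of 2] by (intro prod_pos) auto
  obtain Jb where Jb: "\<And>n. J n \<le> Jb"
    using convergent_imp_Bseq[OF convergentI[OF J0(2)]] unfolding Bseq_def by (auto simp: abs_le_iff)
  have Jb0: "0 \<le> Jb" using Jb[of 0] J0(1)[of 0] by linarith
  define B where "B = 2 * (Jb / K) powr (1 / p)"
  have GB: "cmod (G n (cx \<theta>)) \<le> B" for n \<theta>
  proof -
    obtain M where M: "\<And>\<theta>. cmod (G n (cx \<theta>)) \<le> M"
      "ennreal ((M / 2) powr p * K * a n powr - q) \<le> jacobi_integral p \<alpha> \<beta> (P n)"
      using nikolskii[where \<alpha> = \<alpha> and \<beta> = \<beta> and N = N and p = p, OF p \<alpha> N(2) a(1) less_imp_le[OF c(1)] c(2) G(1) G(2)] unfolding K_def q_def by blast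
    have M0: "0 \<le> M" by (rule order_trans[OF norm_ge_zero M(1)[of 0]])
    have "ennreal ((M / 2) powr p * K * a n powr - q) \<le> ennreal (a n powr - q * J n)" using M(2) J[of n] by (rule order_trans)
    then have "(M / 2) powr p * K * a n powr - q \<le> a n powr - q * J n" using J0(1)[of n] by (subst (asm) ennreal_le_iff) auto
    then have "(M / 2) powr p * K \<le> J n" using a0[of n] by (simp add: mult.commute)
    also have "\<dots> \<le> Jb" by (rule Jb)
    finally have "(M / 2) powr p \<le> Jb / K" using K by (simp add: field_simps)
    then have "((M / 2) powr p) powr (1 / p) \<le> (Jb / K) powr (1 / p)" using p by (intro powr_mono2) auto
    then have "M \<le> B" using M0 p by (simp add: powr_powr B_def)
    then show ?thesis using M(1)[of \<theta>] by linarith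
  qed
  define s where "s n = (a n + c) / a n" for n
  define f where "f n z = G n ((1 / a n) *\<^sub>R z)" for n z
  have scx: "b *\<^sub>R cx x = cx (b *\<^sub>R x)" for b and x :: "real ^ 'n" by (simp add: vec_eq_iff scaleR_conv_of_real[where 'a = complex])
  have inv: "(\<lambda>n. y / a n) \<longlonglongrightarrow> 0" for y by (rule real_tendsto_divide_at_top[OF tendsto_const a(3)])
  obtain k g where k: "strict_mono (k :: nat \<Rightarrow> nat)" and g: "g \<in> exp_type V"
    and u: "\<And>\<rho> e. 0 < e \<Longrightarrow> \<exists>M. \<forall>n\<ge>M. \<forall>z. norm z \<le> \<rho> \<longrightarrow> norm (f (k n) z - g z) < e"
  proof (rule expsum_compactness[of s f B])
    show "expsum (scaled (s n) V) (f n)" for n unfolding f_def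
      by (rule expsum_scale[OF G(1)[of n]]) (auto simp: s_def)
    show "0 \<le> s n" "s n \<le> 2" for n using a0[of n] c(1) c(2)[of n] by (auto simp: s_def field_simps)
    have "(\<lambda>n. 1 + c / a n) \<longlonglongrightarrow> 1 + 0" by (intro tendsto_intros inv)
    moreover have "1 + c / a n = s n" for n using a0[of n] by (simp add: s_def add_divide_distrib)
    ultimately show "s \<longlonglongrightarrow> 1" by simp
    show "cmod (f n (cx x)) \<le> B" for n x unfolding f_def scx by (rule GB)
  qed blast
  define b where "b n = a (k n)" for n
  have b: "filterlim b at_top sequentially" unfolding b_def using filterlim_compose[OF a(3) filterlim_subseq[OF k]] by simp
  have b0: "0 < b n" for n using a0 by (simp add: b_def)
  have invb: "(\<lambda>n. y / b n) \<longlonglongrightarrow> 0" for y by (rule real_tendsto_divide_at_top[OF tendsto_const b])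
  have contg: "continuous_on UNIV g" using g by (intro entire_continuous) (auto simp: exp_type_def)
  define f0 where "f0 = real_restriction g"
  have f0: "f0 x = g (cx x)" for x by (simp add: f0_def real_restriction_eq)
  have D1: "(\<lambda>n. (\<Prod>j\<in>UNIV. (1 - (x $ j / b n)\<^sup>2) powr \<gamma> j)) \<longlonglongrightarrow> 1" for x :: "real ^ 'n" and \<gamma>
  proof -
    have "(\<lambda>n. (1 - (x $ j / b n)\<^sup>2) powr \<gamma> j) \<longlonglongrightarrow> (1 - 0\<^sup>2) powr \<gamma> j" for j by (intro tendsto_intros invb) auto
    then have "(\<lambda>n. (\<Prod>j\<in>UNIV. (1 - (x $ j / b n)\<^sup>2) powr \<gamma> j)) \<longlonglongrightarrow> (\<Prod>j\<in>UNIV. (1 - 0\<^sup>2) powr \<gamma> j)" by (intro tendsto_prod)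
    then show ?thesis by simp
  qed
  have small: "\<forall>\<^sub>F n in sequentially. \<forall>j. \<bar>x $ j\<bar> < b n" for x :: "real ^ 'n"
    using filterlim_at_top_dense[THEN iffD1, OF b, rule_format, of "norm x"]
    by eventually_elim (use component_le_norm_cart[of x] in \<open>auto intro: order_le_less_trans\<close>)
  have Plim: "(\<lambda>n. P (k n) ((1 / b n) *\<^sub>R x)) \<longlonglongrightarrow> f0 x" for x
  proof -
    \<comment> \<open>The rescaled polynomial at \<open>x\<close> is the rescaled exponential sum at a point \<open>y\<^sub>n\<close> that tends to \<open>x\<close>,
        up to a factor that tends to \<open>1\<close>.\<close>
    define y where "y n = (\<chi> j. b n * arcsin (x $ j / b n))" for n
    have y: "y \<longlonglongrightarrow> x" by (rule vec_tendstoI) (simp add: y_def tendsto_mult_arcsin_div[OF b])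
    then have "(\<lambda>n. cx (y n)) \<longlonglongrightarrow> cx x" by (intro vec_tendstoI) (simp add: tendsto_of_real tendsto_vec_nth)
    then have gy: "(\<lambda>n. g (cx (y n))) \<longlonglongrightarrow> g (cx x)" using contg by (auto intro: continuous_on_tendsto_compose)
    obtain \<rho> where \<rho>: "\<And>n. norm (cx (y n)) \<le> \<rho>"
      using convergent_imp_Bseq[OF convergentI[OF \<open>(\<lambda>n. cx (y n)) \<longlonglongrightarrow> cx x\<close>]] unfolding Bseq_def by auto
    have "(\<lambda>n. f (k n) (cx (y n)) - g (cx (y n))) \<longlonglongrightarrow> 0"
    proof (rule LIMSEQ_I)
      fix e :: real assume "0 < e"
      from u[OF this, of \<rho>] obtain M where M: "\<forall>n\<ge>M. \<forall>z. norm z \<le> \<rho> \<longrightarrow> norm (f (k n) z - g z) < e" by blast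
      show "\<exists>no. \<forall>n\<ge>no. norm (f (k n) (cx (y n)) - g (cx (y n)) - 0) < e"
        using M \<rho> by (intro exI[of _ M]) simp
    qed
    from tendsto_add[OF this gy] have fy: "(\<lambda>n. f (k n) (cx (y n))) \<longlonglongrightarrow> f0 x" by (simp add: f0)
    have "(\<lambda>n. of_real (\<Prod>j\<in>UNIV. (1 - (x $ j / b n)\<^sup>2) powr real N)) \<longlonglongrightarrow> (of_real 1 :: complex)" by (intro tendsto_of_real D1)
    from tendsto_divide[OF fy this] have "(\<lambda>n. f (k n) (cx (y n)) / of_real (\<Prod>j\<in>UNIV. (1 - (x $ j / b n)\<^sup>2) powr real N)) \<longlonglongrightarrow> f0 x" by simp
    moreover have "\<forall>\<^sub>F n in sequentially. f (k n) (cx (y n)) / of_real (\<Prod>j\<in>UNIV. (1 - (x $ j / b n)\<^sup>2) powr real N) = P (k n) ((1 / b n) *\<^sub>R x)"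
      using small[of x]
    proof eventually_elim
      fix n assume x: "\<forall>j. \<bar>x $ j\<bar> < b n"
      have lt: "\<bar>x $ j / b n\<bar> < 1" for j using x b0[of n] by simp
      have s: "sin (arcsin (x $ j / b n)) = x $ j / b n" for j using lt[of j] by (intro sin_arcsin) linarith+
      have pos: "0 < 1 - (x $ j / b n)\<^sup>2" for j using lt[of j] by (simp add: abs_square_less_1)
      have ye: "(1 / a (k n)) *\<^sub>R y n = (\<chi> j. arcsin (x $ j / b n))"
        using a0[of "k n"] by (simp add: vec_eq_iff y_def b_def)
      have "f (k n) (cx (y n)) = G (k n) (cx (\<chi> j. arcsin (x $ j / b n)))"
        unfolding f_def scx ye ..
      also have "\<dots> = P (k n) (\<chi> j. x $ j / b n) * of_real (\<Prod>j\<in>UNIV. (1 - (x $ j / b n)\<^sup>2) ^ N)"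
        unfolding G(2) by (simp add: s)
      also have "(\<Prod>j\<in>UNIV. (1 - (x $ j / b n)\<^sup>2) ^ N) = (\<Prod>j\<in>UNIV. (1 - (x $ j / b n)\<^sup>2) powr real N)"
        using pos by (simp add: powr_realpow)
      also have "(\<chi> j. x $ j / b n) = (1 / b n) *\<^sub>R x" by (simp add: vec_eq_iff)
      finally have e: "f (k n) (cx (y n)) = P (k n) ((1 / b n) *\<^sub>R x) * of_real (\<Prod>j\<in>UNIV. (1 - (x $ j / b n)\<^sup>2) powr real N)" .
      have "(\<Prod>j\<in>UNIV. (1 - (x $ j / b n)\<^sup>2) powr real N) \<noteq> 0" using pos by (auto simp: less_le)
      then have "complex_of_real (\<Prod>j\<in>UNIV. (1 - (x $ j / b n)\<^sup>2) powr real N) \<noteq> 0" unfolding of_real_eq_0_iff .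
      then show "f (k n) (cx (y n)) / of_real (\<Prod>j\<in>UNIV. (1 - (x $ j / b n)\<^sup>2) powr real N) = P (k n) ((1 / b n) *\<^sub>R x)"
        unfolding e by (rule nonzero_mult_div_cancel_right)
    qed
    ultimately show ?thesis by (rule Lim_transform_eventually)
  qed
  have one: "f0 0 = 1" using LIMSEQ_unique[OF Plim[of 0]] P(2) by simp
  define h where "h n x = ennreal (b n powr (\<Sum>j\<in>UNIV. \<alpha> j)) *
    (ennreal (cmod (P (k n) ((1 / b n) *\<^sub>R x)) powr p) * jacobi_weight \<alpha> \<beta> ((1 / b n) *\<^sub>R x) * indicator cube ((1 / b n) *\<^sub>R x))" for n x
  have hm: "h n \<in> borel_measurable lborel" for n
  proof -
    have [measurable]: "P (k n) \<in> borel_measurable borel" by (rule polys_measurable[OF P(1)])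
    have [measurable]: "cube \<in> sets (borel :: (real ^ 'n) measure)" using closed_cube by (rule borel_closed)
    show ?thesis unfolding h_def by measurable
  qed
  have hint: "(\<integral>\<^sup>+ x. h n x \<partial>lborel) \<le> ennreal (J (k n))" for n
  proof -
    have [measurable]: "P (k n) \<in> borel_measurable borel" by (rule polys_measurable[OF P(1)])
    have [measurable]: "cube \<in> sets (borel :: (real ^ 'n) measure)" using closed_cube by (rule borel_closed)
    define F where "F t = ennreal (cmod (P (k n) t) powr p) * jacobi_weight \<alpha> \<beta> t * indicator cube t" for t
    have Fm: "F \<in> borel_measurable borel" unfolding F_def by measurable
    have "(\<integral>\<^sup>+ x. h n x \<partial>lborel) = ennreal (b n powr (\<Sum>j\<in>UNIV. \<alpha> j)) * (\<integral>\<^sup>+ x. F ((1 / b n) *\<^sub>R x) \<partial>lborel)"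
      unfolding h_def F_def[symmetric] by (rule nn_integral_cmult) (use Fm in measurable)
    also have "\<dots> = ennreal (b n powr (\<Sum>j\<in>UNIV. \<alpha> j)) * (ennreal (b n ^ CARD('n)) * (\<integral>\<^sup>+ x. F x \<partial>lborel))"
      by (simp only: nn_integral_scale[OF Fm b0])
    also have "\<dots> \<le> ennreal (b n powr (\<Sum>j\<in>UNIV. \<alpha> j)) * (ennreal (b n ^ CARD('n)) * ennreal (b n powr - q * J (k n)))"
      using J[of "k n"] unfolding F_def b_def by (intro mult_left_mono) auto
    also have "\<dots> = ennreal (b n powr (\<Sum>j\<in>UNIV. \<alpha> j) * b n ^ CARD('n) * (b n powr - q * J (k n)))"
      using J0(1)[of "k n"] b0[of n] by (simp add: ennreal_mult[symmetric] mult.assoc)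
    also have "b n powr (\<Sum>j\<in>UNIV. \<alpha> j) * b n ^ CARD('n) * (b n powr - q * J (k n)) = b n powr ((\<Sum>j\<in>UNIV. \<alpha> j) + real CARD('n) + - q) * J (k n)"
      by (simp only: powr_add powr_realpow[OF b0] mult.assoc)
    also have "\<dots> = J (k n)" using b0[of n] by (simp add: q_def)
    finally show ?thesis .
  qed
  have hlim: "(\<lambda>n. h n x) \<longlonglongrightarrow> ennreal (cmod (f0 x) powr p) * power_weight \<alpha> x" for x
  proof -
    have "(\<lambda>n. cmod (P (k n) ((1 / b n) *\<^sub>R x)) powr p) \<longlonglongrightarrow> cmod (f0 x) powr p"
      using p by (intro tendsto_powr' tendsto_norm Plim tendsto_const) auto
    from tendsto_mult[OF this D1[of x \<beta>]]
    have "(\<lambda>n. ennreal (cmod (P (k n) ((1 / b n) *\<^sub>R x)) powr p * (\<Prod>j\<in>UNIV. (1 - (x $ j / b n)\<^sup>2) powr \<beta> j)) * power_weight \<alpha> x)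
      \<longlonglongrightarrow> ennreal (cmod (f0 x) powr p * 1) * power_weight \<alpha> x"
      using power_weight_finite[of \<alpha> x] \<alpha> by (intro tendsto_mult_ennreal tendsto_const tendsto_ennrealI) auto
    moreover have "\<forall>\<^sub>F n in sequentially. ennreal (cmod (P (k n) ((1 / b n) *\<^sub>R x)) powr p * (\<Prod>j\<in>UNIV. (1 - (x $ j / b n)\<^sup>2) powr \<beta> j)) * power_weight \<alpha> x = h n x"
      using small[of x]
    proof eventually_elim
      fix n assume x: "\<forall>j. \<bar>x $ j\<bar> < b n"
      have lt: "\<bar>x $ j / b n\<bar> < 1" for j using x b0[of n] by simp
      have pos: "0 < 1 - (x $ j / b n)\<^sup>2" for j using lt[of j] by (simp add: abs_square_less_1)
      have ep: "epow (1 - (x $ j / b n)\<^sup>2) (\<beta> j) = ennreal ((1 - (x $ j / b n)\<^sup>2) powr \<beta> j)" for j using pos[of j] by (simp add: epow_def)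
      have mem: "(1 / b n) *\<^sub>R x \<in> cube" using lt b0[of n] by (auto simp: cube_def less_imp_le)
      have "ennreal (b n powr (\<Sum>j\<in>UNIV. \<alpha> j)) * jacobi_weight \<alpha> \<beta> ((1 / b n) *\<^sub>R x) =
        (\<Prod>j\<in>UNIV. ennreal (b n powr \<alpha> j)) * (\<Prod>j\<in>UNIV. epow \<bar>x $ j / b n\<bar> (\<alpha> j) * ennreal ((1 - (x $ j / b n)\<^sup>2) powr \<beta> j))"
        using b0[of n] ep by (simp add: jacobi_weight_def powr_sum prod_ennreal)
      also have "\<dots> = (\<Prod>j\<in>UNIV. epow \<bar>x $ j\<bar> (\<alpha> j) * ennreal ((1 - (x $ j / b n)\<^sup>2) powr \<beta> j))"
        unfolding prod.distrib[symmetric] mult.assoc[symmetric] using epow_scale[OF \<alpha> b0] by simp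
      also have "\<dots> = power_weight \<alpha> x * ennreal (\<Prod>j\<in>UNIV. (1 - (x $ j / b n)\<^sup>2) powr \<beta> j)"
        by (simp add: power_weight_def prod.distrib prod_ennreal)
      finally have w: "ennreal (b n powr (\<Sum>j\<in>UNIV. \<alpha> j)) * jacobi_weight \<alpha> \<beta> ((1 / b n) *\<^sub>R x) = power_weight \<alpha> x * ennreal (\<Prod>j\<in>UNIV. (1 - (x $ j / b n)\<^sup>2) powr \<beta> j)" .
      have "h n x = ennreal (cmod (P (k n) ((1 / b n) *\<^sub>R x)) powr p) * (ennreal (b n powr (\<Sum>j\<in>UNIV. \<alpha> j)) * jacobi_weight \<alpha> \<beta> ((1 / b n) *\<^sub>R x))"
        unfolding h_def using mem by (simp add: mult_ac)
      then show "ennreal (cmod (P (k n) ((1 / b n) *\<^sub>R x)) powr p * (\<Prod>j\<in>UNIV. (1 - (x $ j / b n)\<^sup>2) powr \<beta> j)) * power_weight \<alpha> x = h n x"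
        unfolding w by (simp add: ennreal_mult prod_nonneg mult_ac)
    qed
    ultimately show ?thesis by (simp add: Lim_transform_eventually)
  qed
  have "power_integral p \<alpha> f0 = (\<integral>\<^sup>+ x. liminf (\<lambda>n. h n x) \<partial>lborel)"
    by (intro nn_integral_cong) (simp add: lim_imp_Liminf[OF _ hlim])
  also have "\<dots> \<le> liminf (\<lambda>n. \<integral>\<^sup>+ x. h n x \<partial>lborel)" by (rule nn_integral_liminf[OF hm])
  also have "\<dots> \<le> liminf (\<lambda>n. ennreal (J (k n)))" by (intro Liminf_mono always_eventually allI hint)
  also have "\<dots> = ennreal L"
  proof (rule lim_imp_Liminf)
    show "(\<lambda>n. ennreal (J (k n))) \<longlonglongrightarrow> ennreal L" using LIMSEQ_subseq_LIMSEQ[OF J0(2) k] by (intro tendsto_ennrealI) (simp add: o_def)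
  qed simp
  finally have le: "power_integral p \<alpha> f0 \<le> ennreal L" .
  have "f0 \<in> BL V p (power_weight \<alpha>)" unfolding f0_def
    by (rule mem_BL_intro[OF g p]) (use le in \<open>auto simp: f0 intro: order_le_less_trans\<close>)
  with one le show ?thesis by blast
qed

end

section \<open>Functions of finite weighted norm are bounded\<close>

text \<open>Iterating the step \<open>n\<close> times multiplies the linear bound at the radius \<open>\<rho> / \<eta>\<^sup>n\<close> by \<open>\<theta>\<^sup>n\<close>, which tends to \<open>0\<close> since
  \<open>\<theta> < \<eta>\<close>.\<close>
lemma bounded_of_contracting_iteration:
  fixes u :: "real \<Rightarrow> real"
  assumes \<theta>: "0 \<le> \<theta>" "\<theta> < \<eta>" "\<eta> < 1" and "0 < \<rho>\<^sub>0"
    and step: "\<And>\<rho>. \<rho>\<^sub>0 \<le> \<rho> \<Longrightarrow> u (\<eta> * \<rho>) \<le> \<kappa> + \<theta> * u \<rho>"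
    and lin: "\<And>\<rho>. \<rho>\<^sub>0 \<le> \<rho> \<Longrightarrow> u \<rho> \<le> A * \<rho> + C"
    and \<rho>: "\<rho>\<^sub>0 \<le> \<rho>"
  shows "u \<rho> \<le> \<kappa> / (1 - \<theta>)"
proof -
  have it: "u \<rho> \<le> \<kappa> / (1 - \<theta>) + \<theta> ^ n * (A * (\<rho> / \<eta> ^ n) + (C - \<kappa> / (1 - \<theta>)))" if "\<rho>\<^sub>0 \<le> \<rho>" for n \<rho>
    using that
  proof (induction n arbitrary: \<rho>)
    case 0
    then show ?case using lin[of \<rho>] by simp
  next
    case (Suc n)
    have "\<rho> * \<eta> \<le> \<rho> * 1" using \<theta> Suc(2) \<open>0 < \<rho>\<^sub>0\<close> by (intro mult_left_mono) auto
    then have "\<rho> \<le> \<rho> / \<eta>" using \<theta> by (simp add: pos_le_divide_eq)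
    then have ge: "\<rho>\<^sub>0 \<le> \<rho> / \<eta>" using Suc(2) by linarith
    have "u \<rho> = u (\<eta> * (\<rho> / \<eta>))" using \<theta> by simp
    also have "\<dots> \<le> \<kappa> + \<theta> * u (\<rho> / \<eta>)" by (rule step[OF ge])
    also have "\<dots> \<le> \<kappa> + \<theta> * (\<kappa> / (1 - \<theta>) + \<theta> ^ n * (A * (\<rho> / \<eta> / \<eta> ^ n) + (C - \<kappa> / (1 - \<theta>))))"
      using mult_left_mono[OF Suc(1)[OF ge] \<theta>(1)] by simp
    also have "\<dots> = (\<kappa> + \<theta> * (\<kappa> / (1 - \<theta>))) + \<theta> ^ Suc n * (A * (\<rho> / \<eta> ^ Suc n) + (C - \<kappa> / (1 - \<theta>)))"
      by (simp add: algebra_simps)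
    also have "\<kappa> + \<theta> * (\<kappa> / (1 - \<theta>)) = \<kappa> / (1 - \<theta>)" using \<theta> by (simp add: field_simps)
    finally show ?case .
  qed
  have "(\<lambda>n. \<kappa> / (1 - \<theta>) + (A * \<rho> * (\<theta> / \<eta>) ^ n + \<theta> ^ n * (C - \<kappa> / (1 - \<theta>)))) \<longlonglongrightarrow> \<kappa> / (1 - \<theta>) + (A * \<rho> * 0 + 0 * (C - \<kappa> / (1 - \<theta>)))"
    using \<theta> by (intro tendsto_intros LIMSEQ_power_zero) auto
  moreover have "u \<rho> \<le> \<kappa> / (1 - \<theta>) + (A * \<rho> * (\<theta> / \<eta>) ^ n + \<theta> ^ n * (C - \<kappa> / (1 - \<theta>)))" for n
    using it[OF \<rho>, of n] by (simp add: ring_distribs power_divide mult_ac)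
  ultimately show ?thesis using tendsto_lowerbound[of _ "\<kappa> / (1 - \<theta>)" sequentially "u \<rho>"] by simp
qed

lemma power_weight_real:
  assumes "\<And>j. x $ j \<noteq> 0"
  shows "power_weight \<alpha> x = ennreal (\<Prod>j\<in>UNIV. \<bar>x $ j\<bar> powr \<alpha> j)"
  unfolding power_weight_def using assms by (simp add: epow_def prod_ennreal)

text \<open>If \<open>F\<close> stays above \<open>\<mu>\<close> on the points of a large cube near \<open>x\<close>, then the integral dominates the weight of
  a small cube near \<open>x\<close> that keeps away from the zeros of the weight.\<close>
lemma weighted_integral_ge_near_point:
  fixes x :: "real ^ 'n" and \<alpha> :: "'n \<Rightarrow> real"
  assumes p: "0 < p" and \<alpha>: "\<And>j. 0 \<le> \<alpha> j" and \<delta>: "0 < \<delta>" "\<delta> \<le> A" and x: "\<And>j. \<bar>x $ j\<bar> \<le> A" and "0 \<le> \<mu>"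
    and F: "\<And>y. (\<And>j. \<bar>y $ j\<bar> \<le> A) \<Longrightarrow> (\<And>j. \<bar>y $ j - x $ j\<bar> \<le> \<delta>) \<Longrightarrow> \<mu> \<le> cmod (F y)"
  shows "ennreal (\<mu> powr p * (\<delta> / 4) powr homogeneity \<alpha>)
    \<le> power_integral p \<alpha> F"
proof -
  have "\<forall>j. \<exists>u. - A \<le> u \<and> u + \<delta> / 4 \<le> A \<and> (\<forall>t. u \<le> t \<longrightarrow> t \<le> u + \<delta> / 4 \<longrightarrow> \<bar>t - x $ j\<bar> \<le> \<delta> \<and> \<delta> / 4 \<le> \<bar>t\<bar>)"
    using x \<delta> by (intro allI subinterval_away_from_zero) auto
  from choice[OF this] obtain u where u: "\<And>j. - A \<le> u j" "\<And>j. u j + \<delta> / 4 \<le> A"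
    "\<And>j t. u j \<le> t \<Longrightarrow> t \<le> u j + \<delta> / 4 \<Longrightarrow> \<bar>t - x $ j\<bar> \<le> \<delta> \<and> \<delta> / 4 \<le> \<bar>t\<bar>" by blast
  define lo where "lo = (\<chi> j. u j)"
  define hi where "hi = (\<chi> j. u j + \<delta> / 4)"
  define K where "K = \<mu> powr p * (\<Prod>j\<in>UNIV. (\<delta> / 4) powr \<alpha> j)"
  have K0: "0 \<le> K" unfolding K_def by (intro mult_nonneg_nonneg prod_nonneg) auto
  have pt: "ennreal K \<le> ennreal (cmod (F y) powr p) * power_weight \<alpha> y" if "y \<in> box lo hi" for y
  proof -
    have y: "u j \<le> y $ j" "y $ j \<le> u j + \<delta> / 4" for j using that by (auto simp: mem_box_cart lo_def hi_def less_imp_le)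
    have a: "\<delta> / 4 \<le> \<bar>y $ j\<bar>" "\<bar>y $ j - x $ j\<bar> \<le> \<delta>" for j using u(3)[OF y] by auto
    have nz: "y $ j \<noteq> 0" for j using a(1)[of j] \<delta> by auto
    have "\<mu> \<le> cmod (F y)"
    proof (rule F)
      show "\<bar>y $ j\<bar> \<le> A" for j using y[of j] u(1,2)[of j] by linarith
    qed (rule a(2))
    then have "K \<le> cmod (F y) powr p * (\<Prod>j\<in>UNIV. \<bar>y $ j\<bar> powr \<alpha> j)"
      unfolding K_def
    proof (intro mult_mono prod_mono conjI)
      show "\<mu> powr p \<le> cmod (F y) powr p" using \<open>\<mu> \<le> cmod (F y)\<close> p \<open>0 \<le> \<mu>\<close> by (intro powr_mono2) auto
      show "(\<delta> / 4) powr \<alpha> j \<le> \<bar>y $ j\<bar> powr \<alpha> j" for j using \<alpha>[of j] a(1)[of j] \<delta> by (intro powr_mono2) auto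
    qed (auto intro!: prod_nonneg)
    then show ?thesis unfolding power_weight_real[OF nz] by (simp add: ennreal_mult[symmetric] prod_nonneg ennreal_leI)
  qed
  have "emeasure lborel (box lo hi) = ennreal ((\<delta> / 4) ^ CARD('n))"
    using emeasure_box_cart[of lo hi] \<delta> by (simp add: lo_def hi_def)
  then have "ennreal (K * (\<delta> / 4) ^ CARD('n)) = ennreal K * emeasure lborel (box lo hi)"
    using K0 \<delta> by (simp add: ennreal_mult)
  also have "\<dots> = (\<integral>\<^sup>+ y. ennreal K * indicator (box lo hi) y \<partial>lborel)" by (simp add: nn_integral_cmult_indicator)
  also have "\<dots> \<le> power_integral p \<alpha> F"
  proof (rule nn_integral_mono)
    fix y
    show "ennreal K * indicator (box lo hi) y \<le> ennreal (cmod (F y) powr p) * power_weight \<alpha> y"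
      using pt[of y] by (cases "y \<in> box lo hi") simp_all
  qed
  also have "K * (\<delta> / 4) ^ CARD('n) = \<mu> powr p * (\<delta> / 4) powr homogeneity \<alpha>"
    unfolding K_def using \<delta> by (simp add: powr_add powr_sum powr_realpow)
  finally show ?thesis .
qed

context solid_body
begin

text \<open>Through each point of the smaller cube the slice parallel to an axis contains a segment of half-length
  \<open>(1 - \<eta>) \<rho>\<close> inside the large cube, so \<open>segment_bound_near_centre\<close> bounds the function on a complex disc of radius
  one, and Cauchy's estimate bounds the derivative.\<close>
lemma partial_bound_from_cube:
  fixes f :: "complex ^ 'n \<Rightarrow> complex" and x :: "real ^ 'n"
  assumes f: "entire f" and C: "\<And>z. cmod (f z) \<le> C * exp (A * (\<Sum>j\<in>UNIV. cmod (z $ j)))" and A: "0 \<le> A" "0 \<le> C"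
    and \<eta>: "0 < \<eta>" "\<eta> < 1" and \<rho>: "2 \<le> (1 - \<eta>) * \<rho>"
    and m: "\<And>x. (\<And>j. \<bar>x $ j\<bar> \<le> \<rho>) \<Longrightarrow> cmod (f (cx x)) \<le> m"
    and x: "\<And>j. \<bar>x $ j\<bar> \<le> \<eta> * \<rho>" and D: "(f has_derivative D) (at (cx x))" "\<And>c v. D (c *s v) = c * D v"
  shows "cmod (D (cx (axis i 1))) \<le> max m C * exp (11 * (A * real CARD('n) / (1 - \<eta>)))"
proof -
  define e where "e = cx (axis i 1 :: real ^ 'n)"
  have "((\<lambda>\<zeta>. f (cx x + \<zeta> *s e)) has_field_derivative D e) (at 0)"
    by (rule entire_slice_deriv) (use D in auto)
  then have der: "deriv (\<lambda>\<zeta>. f (cx x + \<zeta> *s e)) 0 = D e" by (rule DERIV_imp_deriv)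
  have \<rho>0: "0 < \<rho>" using \<rho> \<eta> by (smt (verit) zero_less_mult_iff)
  have "cmod (deriv (\<lambda>\<zeta>. f (cx x + \<zeta> *s e)) 0) \<le> max m C * exp (11 * (A * real CARD('n) / (1 - \<eta>)))"
  proof (rule deriv_bound_unit_disc[OF entire_slice_holomorphic[OF f]])
    fix w assume w: "cmod (w - 0) \<le> 1"
    show "cmod (f (cx x + w *s e)) \<le> max m C * exp (11 * (A * real CARD('n) / (1 - \<eta>)))"
    proof (rule segment_bound_near_centre[OF entire_slice_holomorphic[OF f], where r = "(1 - \<eta>) * \<rho>"])
      show "2 \<le> (1 - \<eta>) * \<rho>" "cmod w \<le> 1" "0 \<le> A * real CARD('n) / (1 - \<eta>)" using \<rho> w A \<eta> by auto
      fix t assume t: "\<bar>t\<bar> \<le> (1 - \<eta>) * \<rho>"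
      have "cx x + of_real t *s e = cx (x + t *\<^sub>R axis i 1)" unfolding e_def by (simp add: cx_add cx_scaleR)
      moreover have "\<bar>(x + t *\<^sub>R axis i 1) $ j\<bar> \<le> \<rho>" for j
        using x[of j] t \<eta> \<rho>0 by (auto simp: axis_def algebra_simps abs_le_iff)
      ultimately show "cmod (f (cx x + of_real t *s e)) \<le> m" using m by simp
    next
      fix \<zeta>
      have "(\<Sum>j\<in>UNIV. cmod ((cx x + \<zeta> *s e) $ j)) \<le> (\<Sum>j\<in>(UNIV :: 'n set). \<eta> * \<rho> + cmod \<zeta> * (if j = i then 1 else 0))"
      proof (rule sum_mono)
        fix j
        have "cmod ((cx x + \<zeta> *s e) $ j) \<le> cmod (cx x $ j) + cmod ((\<zeta> *s e) $ j)" unfolding vector_add_component by (rule norm_triangle_ineq)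
        also have "cmod (cx x $ j) \<le> \<eta> * \<rho>" using x[of j] by simp
        also have "cmod ((\<zeta> *s e) $ j) = cmod \<zeta> * (if j = i then 1 else 0)" by (simp add: e_def axis_def norm_mult)
        finally show "cmod ((cx x + \<zeta> *s e) $ j) \<le> \<eta> * \<rho> + cmod \<zeta> * (if j = i then 1 else 0)" by simp
      qed
      also have "\<dots> = real CARD('n) * (\<eta> * \<rho>) + cmod \<zeta>" by (simp add: sum.distrib sum_distrib_left[symmetric])
      also have "\<dots> \<le> real CARD('n) * \<rho> + real CARD('n) / (1 - \<eta>) * cmod \<zeta>"
      proof (rule add_mono)
        show "real CARD('n) * (\<eta> * \<rho>) \<le> real CARD('n) * \<rho>" using \<eta> \<rho>0 by (intro mult_left_mono) auto
        have "1 \<le> CARD('n)" by (simp add: Suc_leI)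
        then have "1 \<le> real CARD('n)" by linarith
        then have "1 - \<eta> \<le> real CARD('n)" using \<eta> by linarith
        then have "1 \<le> real CARD('n) / (1 - \<eta>)" using \<eta> by (simp add: le_divide_eq)
        then show "cmod \<zeta> \<le> real CARD('n) / (1 - \<eta>) * cmod \<zeta>" using mult_right_mono[of 1 "real CARD('n) / (1 - \<eta>)" "cmod \<zeta>"] by (simp only: mult_1 norm_ge_zero)
      qed
      also have "\<dots> = real CARD('n) / (1 - \<eta>) * ((1 - \<eta>) * \<rho> + cmod \<zeta>)" using \<eta> by (simp add: field_simps)
      finally have "A * (\<Sum>j\<in>UNIV. cmod ((cx x + \<zeta> *s e) $ j)) \<le> A * (real CARD('n) / (1 - \<eta>) * ((1 - \<eta>) * \<rho> + cmod \<zeta>))"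
        using A by (intro mult_left_mono)
      then have "A * (\<Sum>j\<in>UNIV. cmod ((cx x + \<zeta> *s e) $ j)) \<le> A * real CARD('n) / (1 - \<eta>) * ((1 - \<eta>) * \<rho> + cmod \<zeta>)" by simp
      then have "C * exp (A * (\<Sum>j\<in>UNIV. cmod ((cx x + \<zeta> *s e) $ j))) \<le> C * exp (A * real CARD('n) / (1 - \<eta>) * ((1 - \<eta>) * \<rho> + cmod \<zeta>))"
        using A by (intro mult_left_mono) auto
      then show "cmod (f (cx x + \<zeta> *s e)) \<le> C * exp (A * real CARD('n) / (1 - \<eta>) * ((1 - \<eta>) * \<rho> + cmod \<zeta>))"
        using C[of "cx x + \<zeta> *s e"] by linarith
    qed
  qed
  then have "cmod (D e) \<le> max m C * exp (11 * (A * real CARD('n) / (1 - \<eta>)))" by (simp only: der)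
  then show ?thesis by (simp only: e_def)
qed

text \<open>The real axis carries no a priori bound on a function in the weighted space beyond exponential growth.
  The maximum \<open>m(\<rho>)\<close> over the cube of side \<open>2 \<rho>\<close> controls the gradient on the smaller cube, so a maximum point
  there has a neighbourhood of side comparable to \<open>m(\<eta> \<rho>) / m(\<rho>)\<close> on which the function is large; finiteness of
  the integral turns this into \<open>m(\<eta> \<rho>)\<^bsup>p+q\<^esup> \<le> K m(\<rho>)\<^sup>q\<close>, which iterates to a bound.\<close>
theorem bounded_of_finite_norm:
  fixes \<alpha> :: "'n \<Rightarrow> real"
  assumes f: "f \<in> exp_type V" and p: "0 < p" and \<alpha>: "\<And>j. 0 \<le> \<alpha> j"
    and fin: "power_integral p \<alpha> (\<lambda>x. f (cx x)) < \<infinity>"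
  shows "\<exists>M. \<forall>x. cmod (f (cx x)) \<le> M"
proof -
  have ent: "entire f" using f by (simp add: exp_type_def)
  obtain C0 where C0: "0 < C0" "\<And>z. cmod (f z) \<le> C0 * exp ((1 + 1) * dn z)" using f unfolding exp_type_def by (auto dest: spec[of _ 1])
  define C where "C = max C0 1"
  define A where "A = 2 * R"
  have A: "0 \<le> A" "1 \<le> C" using R_nonneg by (auto simp: A_def C_def)
  have C: "cmod (f z) \<le> C * exp (A * (\<Sum>j\<in>UNIV. cmod (z $ j)))" for z
  proof -
    have "(1 + 1) * dn z \<le> A * (\<Sum>j\<in>UNIV. cmod (z $ j))" using dn_upper[of z] by (simp add: A_def)
    then have "C0 * exp ((1 + 1) * dn z) \<le> C * exp (A * (\<Sum>j\<in>UNIV. cmod (z $ j)))"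
      using C0(1) by (intro mult_mono) (auto simp: C_def)
    then show ?thesis using C0(2)[of z] by linarith
  qed
  define q where "q = homogeneity \<alpha>"
  have q: "0 < q" unfolding q_def using \<alpha> by (intro add_pos_nonneg sum_nonneg) auto
  define Q where "Q \<rho> = {x :: real ^ 'n. \<forall>j. \<bar>x $ j\<bar> \<le> \<rho>}" for \<rho> :: real
  have Qbox: "Q \<rho> = cbox (\<chi> j. - \<rho>) (\<chi> j. \<rho>)" for \<rho>
  proof -
    have "\<bar>x\<bar> \<le> \<rho> \<longleftrightarrow> - \<rho> \<le> x \<and> x \<le> \<rho>" for x :: real by arith
    then show ?thesis by (intro set_eqI) (simp only: Q_def mem_Collect_eq mem_box_cart vec_lambda_beta)
  qed
  have contf: "continuous_on S (\<lambda>x. cmod (f (cx x)))" for S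
    by (intro continuous_intros entire_continuous_real ent)
  have "\<forall>\<rho>. \<exists>x. 0 \<le> \<rho> \<longrightarrow> x \<in> Q \<rho> \<and> (\<forall>y\<in>Q \<rho>. cmod (f (cx y)) \<le> cmod (f (cx x)))"
  proof (intro allI)
    fix \<rho> :: real
    show "\<exists>x. 0 \<le> \<rho> \<longrightarrow> x \<in> Q \<rho> \<and> (\<forall>y\<in>Q \<rho>. cmod (f (cx y)) \<le> cmod (f (cx x)))"
    proof (cases "0 \<le> \<rho>")
      case True
      then have "0 \<in> Q \<rho>" by (simp add: Q_def)
      then have "Q \<rho> \<noteq> {}" by blast
      moreover have "compact (Q \<rho>)" unfolding Qbox by (rule compact_cbox)
      ultimately show ?thesis using continuous_attains_sup[OF _ _ contf] by blast
    qed simp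
  qed
  from choice[OF this] obtain xm where xm: "\<And>\<rho>. 0 \<le> \<rho> \<Longrightarrow> xm \<rho> \<in> Q \<rho>"
    "\<And>\<rho> y. 0 \<le> \<rho> \<Longrightarrow> y \<in> Q \<rho> \<Longrightarrow> cmod (f (cx y)) \<le> cmod (f (cx (xm \<rho>)))" by blast
  define m where "m \<rho> = cmod (f (cx (xm \<rho>)))" for \<rho>
  define B where "B \<rho> = max (m \<rho>) C" for \<rho>
  have B1: "1 \<le> B \<rho>" for \<rho> using A by (simp add: B_def)
  define I where "I = enn2real (power_integral p \<alpha> (\<lambda>x. f (cx x)))"
  have I: "power_integral p \<alpha> (\<lambda>x. f (cx x)) = ennreal I" "0 \<le> I"
    unfolding I_def using fin by (auto simp: less_top)
  \<comment> \<open>The iteration runs on the logarithm of the maximum, with contraction factor \<open>\<theta>\<close>; the ratio \<open>\<eta>\<close> of the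
      radii only has to lie strictly between \<open>\<theta>\<close> and \<open>1\<close>.\<close>
  define \<theta> where "\<theta> = q / (p + q)"
  define \<eta> where "\<eta> = (1 + \<theta>) / 2"
  have \<theta>: "0 < \<theta>" "\<theta> < 1" using q p by (auto simp: \<theta>_def)
  have \<eta>: "0 < \<eta>" "\<eta> < 1" "\<theta> < \<eta>" using \<theta> by (auto simp: \<eta>_def)
  define E where "E = exp (11 * (A * real CARD('n) / (1 - \<eta>)))"
  have E1: "1 \<le> E" unfolding E_def using A \<eta> by simp
  define K where "K = 8 * (real CARD('n))\<^sup>2 * E"
  have K1: "1 \<le> K"
  proof -
    have "1 * 1 \<le> (real CARD('n))\<^sup>2 * E" using E1 by (intro mult_mono) auto
    then show ?thesis by (simp add: K_def)
  qed
  define L where "L = max C ((2 powr p * K powr q * I) powr (1 / (p + q)))"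
  have step: "B (\<eta> * \<rho>) \<le> L * B \<rho> powr \<theta>" if \<rho>: "2 / (1 - \<eta>) + 1 / \<eta> \<le> \<rho>" for \<rho>
  proof (cases "m (\<eta> * \<rho>) \<le> C")
    case True
    have "C * 1 \<le> L * B \<rho> powr \<theta>" using A B1[of \<rho>] \<theta> by (intro mult_mono ge_one_powr_ge_zero) (auto simp: L_def)
    then show ?thesis using True by (simp add: B_def)
  next
    case False
    have p1: "2 / (1 - \<eta>) \<le> \<rho>" "1 / \<eta> \<le> \<rho>" using \<rho> \<eta> by (smt (verit) divide_pos_pos)+
    have \<rho>2: "2 \<le> (1 - \<eta>) * \<rho>" using p1(1) \<eta> by (simp add: divide_le_eq mult.commute)
    have \<rho>1: "1 \<le> \<eta> * \<rho>" using p1(2) \<eta> by (simp add: divide_le_eq mult.commute)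
    have \<rho>0: "0 \<le> \<rho>" using \<rho>1 \<eta> by (smt (verit) zero_less_mult_iff)
    define \<mu> where "\<mu> = m (\<eta> * \<rho>)"
    have \<mu>: "1 \<le> \<mu>" "B (\<eta> * \<rho>) = \<mu>" using False A by (auto simp: \<mu>_def B_def)
    have xr: "xm (\<eta> * \<rho>) \<in> Q (\<eta> * \<rho>)" using xm(1) \<rho>1 by simp
    have "\<eta> * \<rho> \<le> 1 * \<rho>" using \<eta> \<rho>0 by (intro mult_right_mono) auto
    then have "Q (\<eta> * \<rho>) \<subseteq> Q \<rho>" by (auto simp: Q_def intro: order_trans)
    then have \<mu>B: "\<mu> \<le> B \<rho>" using xm(2)[OF \<rho>0] xr unfolding \<mu>_def m_def B_def by (auto simp: le_max_iff_disj)
    have "\<forall>z. \<exists>D. (f has_derivative D) (at z) \<and> (\<forall>c v. D (c *s v) = c * D v)" using ent unfolding entire_def .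
    from choice[OF this] obtain D where D: "\<And>z. (f has_derivative D z) (at z)" "\<And>z c v. D z (c *s v) = c * D z v" by blast
    have Lip: "cmod (f (cx y) - f (cx x)) \<le> real CARD('n) * (B \<rho> * E) * norm (y - x)" if "x \<in> Q (\<eta> * \<rho>)" "y \<in> Q (\<eta> * \<rho>)" for x y
    proof (rule differentiable_bound[of "Q (\<eta> * \<rho>)" "\<lambda>x. f (cx x)" "\<lambda>x v. D (cx x) (cx v)"])
      show "convex (Q (\<eta> * \<rho>))" unfolding Qbox by (rule convex_box)
      fix x assume x: "x \<in> Q (\<eta> * \<rho>)"
      have blcx: "bounded_linear (cx :: real ^ 'n \<Rightarrow> complex ^ 'n)"
        unfolding linear_conv_bounded_linear[symmetric] by (rule linearI) (auto simp: vec_eq_iff scaleR_conv_of_real[where 'a = complex])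
      show "((\<lambda>x. f (cx x)) has_derivative (\<lambda>v. D (cx x) (cx v))) (at x within Q (\<eta> * \<rho>))"
        using diff_chain_within[OF bounded_linear_imp_has_derivative[OF blcx] has_derivative_at_withinI[OF D(1)]] by (simp add: o_def)
      have Dj: "cmod (D (cx x) (cx (axis j 1))) \<le> B \<rho> * E" for j
        unfolding B_def E_def
        by (rule partial_bound_from_cube[OF ent C A(1) _ \<eta>(1,2) \<rho>2 _ _ D]) (use A x xm(2)[OF \<rho>0] in \<open>auto simp: Q_def m_def\<close>)
      have "cmod (D (cx x) (cx v)) \<le> real CARD('n) * (B \<rho> * E) * norm v" for v
      proof -
        have "cx v = (\<Sum>j\<in>UNIV. v $ j *\<^sub>R cx (axis j 1))"
          by (simp add: vec_eq_iff axis_def if_distrib if_distribR scaleR_conv_of_real[where 'a = complex] cong: if_cong)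
        then have "D (cx x) (cx v) = (\<Sum>j\<in>UNIV. v $ j *\<^sub>R D (cx x) (cx (axis j 1)))"
          using has_derivative_linear[OF D(1)[of "cx x"]] by (simp add: linear_sum linear_scale)
        also have "cmod \<dots> \<le> (\<Sum>j\<in>(UNIV :: 'n set). norm v * (B \<rho> * E))"
          using Dj component_le_norm_cart[of v] by (intro sum_norm_le) (auto intro!: mult_mono)
        finally show ?thesis by (simp add: mult_ac)
      qed
      then show "onorm (\<lambda>v. D (cx x) (cx v)) \<le> real CARD('n) * (B \<rho> * E)" by (rule onorm_le)
    qed (use that in auto)
    define \<delta> where "\<delta> = \<mu> / (2 * (real CARD('n))\<^sup>2 * E * B \<rho>)"
    have den: "1 \<le> 2 * (real CARD('n))\<^sup>2 * E"
    proof -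
      have "1 * 1 \<le> (real CARD('n))\<^sup>2 * E" using E1 by (intro mult_mono) auto
      then show ?thesis by simp
    qed
    have \<delta>: "0 < \<delta>" "\<delta> \<le> 1"
    proof -
      show "0 < \<delta>" unfolding \<delta>_def using \<mu>(1) E1 B1[of \<rho>] by (intro divide_pos_pos mult_pos_pos) auto
      have "1 * \<mu> \<le> (2 * (real CARD('n))\<^sup>2 * E) * B \<rho>"
        by (rule mult_mono[OF den \<mu>B]) (use \<mu>(1) den in linarith)+
      then have "\<mu> \<le> 2 * (real CARD('n))\<^sup>2 * E * B \<rho>" by (simp only: mult_1)
      then show "\<delta> \<le> 1" unfolding \<delta>_def using \<mu>(1) by (intro divide_le_eq_1_pos[THEN iffD2]) linarith+
    qed
    have "ennreal ((\<mu> / 2) powr p * (\<delta> / 4) powr q) \<le> ennreal I"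
      unfolding q_def I(1)[symmetric]
    proof (rule weighted_integral_ge_near_point[OF p \<alpha> \<delta>(1), where A = "\<eta> * \<rho>" and x = "xm (\<eta> * \<rho>)"])
      show "\<delta> \<le> \<eta> * \<rho>" using \<delta>(2) \<rho>1 by linarith
      show "\<bar>xm (\<eta> * \<rho>) $ j\<bar> \<le> \<eta> * \<rho>" for j using xr by (simp add: Q_def)
      show "0 \<le> \<mu> / 2" using \<mu> by simp
      fix y assume y: "\<And>j. \<bar>y $ j\<bar> \<le> \<eta> * \<rho>" "\<And>j. \<bar>y $ j - xm (\<eta> * \<rho>) $ j\<bar> \<le> \<delta>"
      have yQ: "y \<in> Q (\<eta> * \<rho>)" using y(1) by (simp add: Q_def)
      have "norm (y - xm (\<eta> * \<rho>)) \<le> (\<Sum>j\<in>UNIV. \<bar>(y - xm (\<eta> * \<rho>)) $ j\<bar>)" by (rule norm_le_l1_cart)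
      also have "\<dots> \<le> (\<Sum>j\<in>(UNIV :: 'n set). \<delta>)" using y(2) by (intro sum_mono) auto
      finally have "norm (y - xm (\<eta> * \<rho>)) \<le> real CARD('n) * \<delta>" by simp
      then have "real CARD('n) * (B \<rho> * E) * norm (y - xm (\<eta> * \<rho>)) \<le> real CARD('n) * (B \<rho> * E) * (real CARD('n) * \<delta>)"
        using B1[of \<rho>] E1 by (intro mult_left_mono) auto
      also have "\<dots> = \<mu> / 2" using B1[of \<rho>] E1 by (simp add: \<delta>_def power2_eq_square)
      finally have "cmod (f (cx y) - f (cx (xm (\<eta> * \<rho>)))) \<le> \<mu> / 2" using Lip[OF xr yQ] by linarith
      then show "\<mu> / 2 \<le> cmod (f (cx y))"
        using norm_triangle_ineq2[of "f (cx (xm (\<eta> * \<rho>)))" "f (cx y)"] by (simp add: \<mu>_def m_def norm_minus_commute)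
    qed
    then have "(\<mu> / 2) powr p * (\<delta> / 4) powr q \<le> I" using I(2) by (simp add: ennreal_le_iff)
    moreover have "\<delta> / 4 = \<mu> / (K * B \<rho>)" by (simp add: \<delta>_def K_def)
    ultimately have "(\<mu> / 2) powr p * (\<mu> / (K * B \<rho>)) powr q \<le> I" by simp
    moreover have "(\<mu> / 2) powr p * (\<mu> / (K * B \<rho>)) powr q = \<mu> powr (p + q) / (2 powr p * K powr q * B \<rho> powr q)"
      using \<mu>(1) K1 B1[of \<rho>] by (simp add: powr_divide powr_mult powr_add)
    ultimately have "\<mu> powr (p + q) \<le> (2 powr p * K powr q * I) * B \<rho> powr q"
      using K1 B1[of \<rho>] by (simp add: pos_divide_le_eq mult_ac)
    then have "(\<mu> powr (p + q)) powr (1 / (p + q)) \<le> ((2 powr p * K powr q * I) * B \<rho> powr q) powr (1 / (p + q))"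
      using p q by (intro powr_mono2) auto
    also have "\<dots> = (2 powr p * K powr q * I) powr (1 / (p + q)) * B \<rho> powr \<theta>"
      using I(2) by (simp add: powr_mult powr_powr \<theta>_def)
    also have "\<dots> \<le> L * B \<rho> powr \<theta>" by (intro mult_right_mono) (auto simp: L_def)
    finally have "\<mu> \<le> L * B \<rho> powr \<theta>" using \<mu>(1) p q by (simp add: powr_powr)
    then show ?thesis using \<mu>(2) by simp
  qed
  have L1: "1 \<le> L" using A by (simp add: L_def)
  define \<rho>\<^sub>0 where "\<rho>\<^sub>0 = 2 / (1 - \<eta>) + 1 / \<eta>"
  have \<rho>0: "0 < \<rho>\<^sub>0" unfolding \<rho>\<^sub>0_def using \<eta> by (intro add_pos_pos) auto
  have bound: "ln (B \<rho>) \<le> ln L / (1 - \<theta>)" if "\<rho>\<^sub>0 \<le> \<rho>" for \<rho>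
  proof (rule bounded_of_contracting_iteration[OF less_imp_le[OF \<theta>(1)] \<eta>(3,2) \<rho>0 _ _ that])
    fix \<rho> assume \<rho>: "\<rho>\<^sub>0 \<le> \<rho>"
    have "ln (B (\<eta> * \<rho>)) \<le> ln (L * B \<rho> powr \<theta>)" using step \<rho> B1[of "\<eta> * \<rho>"] L1 B1[of \<rho>] unfolding \<rho>\<^sub>0_def
      by (intro ln_mono) (auto intro: less_le_trans[OF zero_less_one])
    then show "ln (B (\<eta> * \<rho>)) \<le> ln L + \<theta> * ln (B \<rho>)" using L1 B1[of \<rho>] by (simp add: ln_mult_pos)
    have "0 \<le> \<rho>" using \<rho> \<rho>0 by simp
    have "m \<rho> \<le> C * exp (A * (\<Sum>j\<in>UNIV. cmod (cx (xm \<rho>) $ j)))" unfolding m_def by (rule C)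
    also have "\<dots> \<le> C * exp (A * (real CARD('n) * \<rho>))"
    proof -
      have "(\<Sum>j\<in>UNIV. cmod (cx (xm \<rho>) $ j)) \<le> (\<Sum>j\<in>(UNIV :: 'n set). \<rho>)" using xm(1)[OF \<open>0 \<le> \<rho>\<close>] by (intro sum_mono) (simp add: Q_def)
      then have "A * (\<Sum>j\<in>UNIV. cmod (cx (xm \<rho>) $ j)) \<le> A * (real CARD('n) * \<rho>)" using A by (intro mult_left_mono) auto
      then show ?thesis using A by (intro mult_left_mono) auto
    qed
    finally have "m \<rho> \<le> C * exp (A * (real CARD('n) * \<rho>))" .
    moreover have "C * 1 \<le> C * exp (A * (real CARD('n) * \<rho>))" using A \<open>0 \<le> \<rho>\<close> by (intro mult_left_mono) auto
    ultimately have "B \<rho> \<le> C * exp (A * (real CARD('n) * \<rho>))" by (simp add: B_def)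
    then have "ln (B \<rho>) \<le> ln (C * exp (A * (real CARD('n) * \<rho>)))" using B1[of \<rho>] by (intro ln_mono) auto
    then show "ln (B \<rho>) \<le> (A * real CARD('n)) * \<rho> + ln C" using A by (simp add: ln_mult_pos)
  qed
  have "cmod (f (cx x)) \<le> exp (ln L / (1 - \<theta>))" for x
  proof -
    define \<rho> where "\<rho> = max \<rho>\<^sub>0 (norm x)"
    have "x \<in> Q \<rho>" using component_le_norm_cart[of x] by (auto simp: Q_def \<rho>_def le_max_iff_disj)
    then have "cmod (f (cx x)) \<le> B \<rho>" using xm(2)[of \<rho> x] \<rho>0 by (simp add: B_def m_def \<rho>_def le_max_iff_disj)
    also have "\<dots> = exp (ln (B \<rho>))" using B1[of \<rho>] by simp
    also have "\<dots> \<le> exp (ln L / (1 - \<theta>))" using bound[of \<rho>] by (simp add: \<rho>_def)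
    finally show ?thesis .
  qed
  then show ?thesis by blast
qed

end

section \<open>Trigonometric interpolation\<close>

definition unit_root :: "nat \<Rightarrow> complex" where "unit_root n = exp (2 * of_real pi * \<i> / of_nat n)"

lemma norm_unit_root [simp]: "cmod (unit_root n) = 1"
  by (simp add: unit_root_def)

lemma exp_multiple_unit_root: "exp (2 * of_real pi * \<i> * of_int d * of_nat k / of_nat n) = (unit_root n powi d) ^ k"
  by (simp add: unit_root_def exp_power_int exp_of_nat_mult[symmetric] mult_ac)

lemma sum_unit_roots:
  assumes "\<bar>d\<bar> < int n"
  shows "(\<Sum>k<n. (unit_root n powi d) ^ k) = (if d = 0 then of_nat n else 0)"
proof (cases "d = 0")
  case False
  have n: "0 < n" using assms by auto
  define w where "w = unit_root n powi d"
  have w: "w = exp (2 * of_real pi * \<i> * of_int d / of_nat n)" by (simp add: w_def unit_root_def exp_power_int mult_ac)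
  have "w ^ n = exp ((2 * of_int d * of_real pi) * \<i>)" unfolding w using n by (simp add: exp_of_nat_mult[symmetric] mult_ac)
  also have "\<dots> = 1" unfolding exp_eq_1 by (auto intro: exI[of _ d])
  finally have wn: "w ^ n = 1" .
  have "w \<noteq> 1"
  proof
    assume "w = 1"
    then obtain m :: int where "Im (2 * of_real pi * \<i> * of_int d / of_nat n) = of_int (2 * m) * pi" unfolding w exp_eq_1 by auto
    then have "of_int d = of_int m * real n" using n by (simp add: field_simps)
    then have "d = m * int n" by (metis of_int_eq_iff of_int_mult of_int_of_nat_eq)
    then have "\<bar>d\<bar> = \<bar>m\<bar> * int n" "m \<noteq> 0" using False by (auto simp: abs_mult)
    moreover have "1 * int n \<le> \<bar>m\<bar> * int n" using \<open>m \<noteq> 0\<close> by (intro mult_right_mono) auto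
    ultimately show False using assms by simp
  qed
  then show ?thesis using False wn geometric_sum[of w n] by (simp add: w_def)
qed simp

text \<open>Interpolation at the \<open>n\<close>-th roots of unity reproduces polynomials of degree below \<open>n\<close>, so its error is
  governed by the tail of the Taylor series.\<close>
lemma roots_of_unity_interpolation:
  assumes hol: "g holomorphic_on UNIV" and B: "\<And>z. cmod z \<le> 3 * R \<Longrightarrow> cmod (g z) \<le> B"
    and R: "0 < R" and n: "0 < n" and z: "cmod z \<le> R"
  defines "l \<equiv> \<lambda>j z. (\<Sum>s<n. (z / (of_real R * unit_root n ^ j)) ^ s) / of_nat n"
  shows "cmod (g z - (\<Sum>j<n. g (of_real R * unit_root n ^ j) * l j z)) \<le> 2 * B * (1 + real n) * exp (- real n)"
    and "\<And>j. cmod (l j z) \<le> 1"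
proof -
  show l1: "cmod (l j z) \<le> 1" for j
  proof -
    have "cmod (\<Sum>s<n. (z / (of_real R * unit_root n ^ j)) ^ s) \<le> (\<Sum>s<n. 1)"
      using z R by (intro sum_norm_le) (auto simp: norm_power norm_divide norm_mult intro!: power_le_one)
    then show ?thesis using n unfolding l_def by (simp add: norm_divide divide_le_eq)
  qed
  define b where "b s = (deriv ^^ s) g 0 / fact s" for s
  have B0: "0 \<le> B" using order_trans[OF norm_ge_zero B[of 0]] R by simp
  have bs: "cmod (b s) * R ^ s \<le> B * exp (- 1) ^ s" for s
  proof -
    \<comment> \<open>Cauchy's estimate on the circle of radius \<open>e R\<close> gives Taylor terms decaying like \<open>e\<^sup>-\<^sup>s\<close> on the disc.\<close>
    have eR: "0 < exp 1 * R" using R by simp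
    have "exp 1 * R \<le> 3 * R" using exp_le R by simp
    then have "cmod x = exp 1 * R \<Longrightarrow> cmod (g x) \<le> B" for x by (intro B) linarith
    then have "cmod ((deriv ^^ s) g 0) \<le> fact s * B / (exp 1 * R) ^ s"
      by (intro Cauchy_inequality[OF _ _ eR] holomorphic_on_subset[OF hol] holomorphic_on_imp_continuous_on)
        (simp_all add: norm_minus_commute)
    then have "cmod ((deriv ^^ s) g 0) / fact s \<le> fact s * B / (exp 1 * R) ^ s / fact s" by (intro divide_right_mono) auto
    then have "cmod (b s) \<le> B / (exp 1 * R) ^ s" unfolding b_def by (simp add: norm_divide)
    then have "cmod (b s) * R ^ s \<le> B / (exp 1 * R) ^ s * R ^ s" using R by (intro mult_right_mono) auto
    also have "\<dots> = B * exp (- 1) ^ s" using R by (simp add: power_mult_distrib exp_minus power_inverse divide_inverse)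
    finally show ?thesis .
  qed
  define h where "h w = g w - (\<Sum>s<n. b s * w ^ s)" for w
  have hb: "cmod (h w) \<le> 2 * B * exp (- real n)" if w: "cmod w \<le> R" for w
  proof -
    have "(\<lambda>s. (deriv ^^ s) g 0 / fact s * (w - 0) ^ s) sums g w"
      by (rule holomorphic_power_series[of g 0 "cmod w + 1"]) (auto intro: holomorphic_on_subset[OF hol])
    then have "(\<lambda>s. b s * w ^ s) sums g w" by (simp add: b_def)
    then have su: "(\<lambda>s. b (s + n) * w ^ (s + n)) sums h w" unfolding h_def by (rule sums_split_initial_segment)
    have "(\<lambda>s. (B * exp (- real n)) * exp (- 1) ^ s) sums ((B * exp (- real n)) * (1 / (1 - exp (- 1))))"
      by (intro sums_mult geometric_sums) simp
    moreover have "cmod (b (s + n) * w ^ (s + n)) \<le> (B * exp (- real n)) * exp (- 1) ^ s" for s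
    proof -
      have "cmod (b (s + n) * w ^ (s + n)) \<le> cmod (b (s + n)) * R ^ (s + n)"
        using w by (simp add: norm_mult norm_power mult_left_mono power_mono)
      also have "\<dots> \<le> B * exp (- 1) ^ (s + n)" by (rule bs)
      also have "\<dots> = (B * exp (- real n)) * exp (- 1) ^ s" by (simp add: power_add exp_of_nat_mult[symmetric])
      finally show ?thesis .
    qed
    ultimately have "cmod (h w) \<le> (B * exp (- real n)) * (1 / (1 - exp (- 1)))"
      using norm_sums_le[OF su] by blast
    also have "\<dots> \<le> (B * exp (- real n)) * 2"
    proof -
      have "exp (-1 :: real) \<le> 1 / 2" using exp_ge_add_one_self[of "1::real"] by (simp add: exp_minus inverse_eq_divide divide_le_eq)
      then have "1 / (1 - exp (-1 :: real)) \<le> 2" by (simp add: divide_le_eq)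
      then show ?thesis using B0 by (intro mult_left_mono) auto
    qed
    finally show ?thesis by simp
  qed
  have exact: "(\<Sum>j<n. (of_real R * unit_root n ^ j) ^ s * l j z) = z ^ s" if s: "s < n" for s
  proof -
    have u0: "unit_root n \<noteq> 0" "complex_of_real R \<noteq> 0" using R by (auto simp: unit_root_def)
    have "(of_real R * unit_root n ^ j) ^ s * l j z = (\<Sum>t<n. z ^ t * (of_real R powi (int s - int t)) / of_nat n * (unit_root n powi (int s - int t)) ^ j)" for j
      unfolding l_def sum_divide_distrib sum_distrib_left
    proof (rule sum.cong[OF refl])
      fix t
      have "(of_real R * unit_root n ^ j) ^ s * (z / (of_real R * unit_root n ^ j)) ^ t =
         z ^ t * (of_real R ^ s / of_real R ^ t) * ((unit_root n ^ s) ^ j / (unit_root n ^ t) ^ j)"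
        by (simp add: power_mult_distrib power_divide power_mult[symmetric] mult_ac)
      also have "\<dots> = z ^ t * (of_real R powi (int s - int t)) * (unit_root n powi (int s - int t)) ^ j"
        using u0 by (simp add: power_int_diff power_divide)
      finally show "(of_real R * unit_root n ^ j) ^ s * ((z / (of_real R * unit_root n ^ j)) ^ t / of_nat n) = z ^ t * (of_real R powi (int s - int t)) / of_nat n * (unit_root n powi (int s - int t)) ^ j"
        by simp
    qed
    then have "(\<Sum>j<n. (of_real R * unit_root n ^ j) ^ s * l j z) =
      (\<Sum>j<n. \<Sum>t<n. z ^ t * (of_real R powi (int s - int t)) / of_nat n * (unit_root n powi (int s - int t)) ^ j)" by simp
    also have "\<dots> = (\<Sum>t<n. \<Sum>j<n. z ^ t * (of_real R powi (int s - int t)) / of_nat n * (unit_root n powi (int s - int t)) ^ j)"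
      by (rule sum.swap)
    also have "\<dots> = (\<Sum>t<n. z ^ t * (of_real R powi (int s - int t)) / of_nat n * (\<Sum>j<n. (unit_root n powi (int s - int t)) ^ j))"
      by (simp only: sum_distrib_left)
    also have "\<dots> = (\<Sum>t<n. if t = s then z ^ s else 0)"
      using s n by (intro sum.cong refl) (auto simp: sum_unit_roots)
    also have "\<dots> = z ^ s" using s by simp
    finally show ?thesis .
  qed
  have "(\<Sum>j<n. g (of_real R * unit_root n ^ j) * l j z) =
     (\<Sum>j<n. h (of_real R * unit_root n ^ j) * l j z) + (\<Sum>j<n. \<Sum>s<n. b s * ((of_real R * unit_root n ^ j) ^ s * l j z))"
    unfolding h_def by (simp add: sum.distrib[symmetric] sum_distrib_right[symmetric] ring_distribs sum_distrib_left mult_ac sum_subtractf)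
  also have "(\<Sum>j<n. \<Sum>s<n. b s * ((of_real R * unit_root n ^ j) ^ s * l j z)) = (\<Sum>s<n. b s * z ^ s)"
    by (subst sum.swap) (simp add: sum_distrib_left[symmetric] exact)
  finally have "g z - (\<Sum>j<n. g (of_real R * unit_root n ^ j) * l j z) = h z - (\<Sum>j<n. h (of_real R * unit_root n ^ j) * l j z)"
    by (simp add: h_def)
  also have "cmod \<dots> \<le> 2 * B * exp (- real n) + (\<Sum>j<n. 2 * B * exp (- real n) * 1)"
  proof (intro order_trans[OF norm_triangle_ineq4] add_mono hb z sum_norm_le)
    fix j
    show "cmod (h (of_real R * unit_root n ^ j) * l j z) \<le> 2 * B * exp (- real n) * 1"
      unfolding norm_mult[of "h _"] using R B0 by (intro mult_mono hb l1) (auto simp: norm_mult norm_power)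
  qed
  finally show "cmod (g z - (\<Sum>j<n. g (of_real R * unit_root n ^ j) * l j z)) \<le> 2 * B * (1 + real n) * exp (- real n)"
    by (simp add: algebra_simps)
qed

definition vupd :: "complex ^ 'n \<Rightarrow> 'n \<Rightarrow> complex \<Rightarrow> complex ^ 'n" where
  "vupd z i w = (\<chi> k. if k = i then w else z $ k)"

lemma vupd_nth: "vupd z i w $ k = (if k = i then w else z $ k)" by (simp add: vupd_def)
lemma vupd_same: "vupd z i (z $ i) = z" by (simp add: vec_eq_iff vupd_nth)
lemma vupd_vupd: "vupd (vupd z i v) i w = vupd z i w" by (simp add: vec_eq_iff vupd_nth)
lemma vupd_commute: "i \<noteq> k \<Longrightarrow> vupd (vupd z i v) k w = vupd (vupd z k w) i v" by (simp add: vec_eq_iff vupd_nth)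

text \<open>Interpolation variable by variable.  The set \<open>J\<close> collects the variables already treated; in these the
  approximant becomes a trigonometric polynomial after \<open>z\<^sub>i = sin \<theta>\<^sub>i\<close>.\<close>
lemma trigonometric_approximation:
  fixes J :: "'n::finite set"
  assumes R: "0 < R" and n: "0 < n" and B0: "0 \<le> B"
  shows "\<lbrakk>\<And>z i. (\<lambda>\<zeta>. f (vupd z i \<zeta>)) holomorphic_on UNIV; \<And>z. (\<And>i. cmod (z $ i) \<le> 3 * R) \<Longrightarrow> cmod (f z) \<le> B\<rbrakk> \<Longrightarrow>
    \<exists>T. (\<forall>z. (\<forall>i. cmod (z $ i) \<le> R) \<longrightarrow> cmod (f z - T z) \<le> real (card J) * (2 * B * (1 + real n) ^ card J * exp (- real n))) \<and>
      (\<forall>w. expsum (ibox (\<chi> i. if i \<in> J then real n else 0)) (\<lambda>\<theta>. T (\<chi> i. if i \<in> J then sin (\<theta> $ i) else w $ i)))"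
  using finite[of J]
proof (induction J arbitrary: f rule: finite_induct)
  case empty
  have "expsum (ibox (\<chi> i. 0)) (\<lambda>\<theta> :: complex ^ 'n. f (\<chi> i. w $ i))" for w
    by (rule expsum_const) (simp add: ibox_def)
  then show ?case by (intro exI[of _ f]) simp
next
  case (insert i J f)
  define \<omega> where "\<omega> j = of_real R * unit_root n ^ j" for j
  define l where "l j z = (\<Sum>s<n. (z / \<omega> j) ^ s) / of_nat n" for j z
  have cw: "cmod (\<omega> j) = R" for j using R by (simp add: \<omega>_def norm_mult norm_power)
  define e where "e = real (card J) * (2 * B * (1 + real n) ^ card J * exp (- real n))"
  have "\<forall>j. \<exists>T. (\<forall>z. (\<forall>i. cmod (z $ i) \<le> R) \<longrightarrow> cmod (f (vupd z i (\<omega> j)) - T z) \<le> e) \<and>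
      (\<forall>w. expsum (ibox (\<chi> i. if i \<in> J then real n else 0)) (\<lambda>\<theta>. T (\<chi> i. if i \<in> J then sin (\<theta> $ i) else w $ i)))"
  proof
    fix j
    show "\<exists>T. (\<forall>z. (\<forall>i. cmod (z $ i) \<le> R) \<longrightarrow> cmod (f (vupd z i (\<omega> j)) - T z) \<le> e) \<and>
      (\<forall>w. expsum (ibox (\<chi> i. if i \<in> J then real n else 0)) (\<lambda>\<theta>. T (\<chi> i. if i \<in> J then sin (\<theta> $ i) else w $ i)))"
      unfolding e_def
    proof (rule insert.IH)
      fix z k
      show "(\<lambda>\<zeta>. f (vupd (vupd z k \<zeta>) i (\<omega> j))) holomorphic_on UNIV"
      proof (cases "k = i")
        case True
        then show ?thesis by (simp add: vupd_vupd)
      next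
        case False
        then show ?thesis using insert.prems(1)[of "vupd z i (\<omega> j)" k] by (simp add: vupd_commute)
      qed
    next
      fix z :: "complex ^ 'n" assume "\<And>i. cmod (z $ i) \<le> 3 * R"
      then show "cmod (f (vupd z i (\<omega> j))) \<le> B" using R by (intro insert.prems(2)) (simp add: vupd_nth cw)
    qed
  qed
  from choice[OF this] obtain T where
    T: "\<And>j z. (\<And>i. cmod (z $ i) \<le> R) \<Longrightarrow> cmod (f (vupd z i (\<omega> j)) - T j z) \<le> e"
       "\<And>j w. expsum (ibox (\<chi> i. if i \<in> J then real n else 0)) (\<lambda>\<theta>. T j (\<chi> i. if i \<in> J then sin (\<theta> $ i) else w $ i))" by blast
  define S where "S z = (\<Sum>j<n. T j (vupd z i 0) * l j (z $ i))" for z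
  have e0: "0 \<le> e" unfolding e_def using B0 by simp
  have err: "cmod (f z - S z) \<le> real (card (insert i J)) * (2 * B * (1 + real n) ^ card (insert i J) * exp (- real n))"
    if z: "\<And>i. cmod (z $ i) \<le> R" for z
  proof -
    have z3: "cmod (z $ k) \<le> 3 * R" for k using z[of k] R by linarith
    have 1: "cmod (f (vupd z i (z $ i)) - (\<Sum>j<n. f (vupd z i (\<omega> j)) * l j (z $ i))) \<le> 2 * B * (1 + real n) * exp (- real n)"
      unfolding l_def \<omega>_def
      by (rule roots_of_unity_interpolation(1)[of "\<lambda>\<zeta>. f (vupd z i \<zeta>)", OF insert.prems(1) _ R n z])
         (use z3 in \<open>auto intro!: insert.prems(2) simp: vupd_nth\<close>)
    have l1: "cmod (l j (z $ i)) \<le> 1" for j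
      unfolding l_def \<omega>_def
      by (rule roots_of_unity_interpolation(2)[of "\<lambda>\<zeta>. 0" R 0, OF _ _ R n z]) auto
    have 2: "cmod ((\<Sum>j<n. f (vupd z i (\<omega> j)) * l j (z $ i)) - S z) \<le> (\<Sum>j<n. e * 1)"
      unfolding S_def sum_subtractf[symmetric] left_diff_distrib[symmetric]
    proof (rule sum_norm_le)
      fix j
      have "cmod (f (vupd (vupd z i 0) i (\<omega> j)) - T j (vupd z i 0)) \<le> e" using z R by (intro T(1)) (simp add: vupd_nth)
      then show "cmod ((f (vupd z i (\<omega> j)) - T j (vupd z i 0)) * l j (z $ i)) \<le> e * 1"
        unfolding norm_mult vupd_vupd using l1[of j] e0 by (intro mult_mono) auto
    qed
    have "cmod (f z - S z) \<le> 2 * B * (1 + real n) * exp (- real n) + real n * e"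
      using norm_triangle_le[OF add_mono[OF 1 2]] by (simp add: vupd_same)
    also have "\<dots> \<le> (2 * B * exp (- real n)) * (1 + real n) ^ Suc (card J) + (2 * B * exp (- real n)) * (real (card J) * (1 + real n) ^ Suc (card J))"
    proof (rule add_mono)
      have "(1 + real n) ^ 1 \<le> (1 + real n) ^ Suc (card J)" by (intro power_increasing) auto
      then have "(2 * B * exp (- real n)) * (1 + real n) ^ 1 \<le> (2 * B * exp (- real n)) * (1 + real n) ^ Suc (card J)" using B0 by (intro mult_left_mono) auto
      then show "2 * B * (1 + real n) * exp (- real n) \<le> (2 * B * exp (- real n)) * (1 + real n) ^ Suc (card J)" by (simp only: power_one_right mult_ac)
      have "real n * e \<le> (1 + real n) * e" using e0 by (intro mult_right_mono) auto
      then show "real n * e \<le> (2 * B * exp (- real n)) * (real (card J) * (1 + real n) ^ Suc (card J))" unfolding e_def by (simp add: mult_ac)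
    qed
    also have "\<dots> = real (card (insert i J)) * (2 * B * (1 + real n) ^ card (insert i J) * exp (- real n))"
      using insert.hyps by (simp add: algebra_simps)
    finally show ?thesis .
  qed
  have "expsum (ibox (\<chi> k. if k \<in> insert i J then real n else 0)) (\<lambda>\<theta>. S (\<chi> k. if k \<in> insert i J then sin (\<theta> $ k) else w $ k))" for w
  proof -
    have lj: "expsum (ibox (axis i (real n))) (\<lambda>\<theta>. l j (sin (\<theta> $ i)))" for j
    proof -
      have "expsum (ibox (axis i (real n))) (\<lambda>\<theta>. \<Sum>s<n. (1 / (\<omega> j ^ s * of_nat n)) * sin (\<theta> $ i) ^ s)"
      proof (intro expsum_sum expsum_cmult)
        fix s assume "s \<in> {..<n}"
        then show "expsum (ibox (axis i (real n))) (\<lambda>\<theta>. sin (\<theta> $ i) ^ s)"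
          by (intro expsum_mono[OF expsum_ibox_power[OF expsum_sin]]) (auto simp: ibox_def axis_def split: if_splits, (meson less_imp_le of_nat_le_iff order_trans)?)
      qed
      then show ?thesis unfolding l_def by (simp add: power_divide sum_divide_distrib mult_ac)
    qed
    have Tj: "expsum (ibox (\<chi> k. if k \<in> J then real n else 0)) (\<lambda>\<theta>. T j (vupd (\<chi> k. if k \<in> insert i J then sin (\<theta> $ k) else w $ k) i 0))" for j
    proof -
      have "vupd (\<chi> k. if k \<in> insert i J then sin (\<theta> $ k) else w $ k) i 0 = (\<chi> k. if k \<in> J then sin (\<theta> $ k) else vupd w i 0 $ k)" for \<theta> :: "complex ^ 'n"
        using insert.hyps by (auto simp: vec_eq_iff vupd_nth)
      then show ?thesis using T(2)[of j "vupd w i 0"] by simp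
    qed
    have "expsum (ibox (\<chi> k. if k \<in> insert i J then real n else 0))
      (\<lambda>\<theta>. T j (vupd (\<chi> k. if k \<in> insert i J then sin (\<theta> $ k) else w $ k) i 0) * l j (sin (\<theta> $ i)))" for j
    proof (rule expsum_mono[OF expsum_ibox_mult[OF Tj lj]])
      show "ibox ((\<chi> k. if k \<in> J then real n else 0) + axis i (real n)) \<subseteq> ibox (\<chi> k. if k \<in> insert i J then real n else 0)"
        using insert.hyps by (auto simp: ibox_def axis_def split: if_splits)
    qed
    then show ?thesis unfolding S_def by (intro expsum_sum) simp
  qed
  with err show ?case by blast
qed

section \<open>Coefficients of exponential sums and polynomials in sines\<close>

text \<open>Averaging over a grid of \<open>2 n + 1\<close> points in each variable isolates a Fourier coefficient.  The averages may be
  taken on any translate of the real space by \<open>i y\<close>, and this costs or gains the factor \<open>exp (m \<bullet> y)\<close>.\<close>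
lemma expsum_coeff_bound:
  fixes S :: "(real ^ 'n) set"
  assumes S: "finite S" "S \<subseteq> ibox (\<chi> i. real n)" and m: "m \<in> S"
    and B: "\<And>x. cmod (\<Sum>l\<in>S. c l * expo l (cx x + \<i> *s cx y)) \<le> B"
  shows "cmod (c m) \<le> B * exp (m \<bullet> y)"
proof -
  define N where "N = 2 * n + 1"
  define G where "G = PiE (UNIV :: 'n set) (\<lambda>_. {..<N})"
  define t where "t h = (\<chi> j. 2 * pi * real (h j) / real N)" for h :: "'n \<Rightarrow> nat"
  define v where "v = \<i> *s cx y"
  have cG: "card G = N ^ CARD('n)" by (simp add: G_def card_PiE)
  have orth: "(\<Sum>h\<in>G. expo (l - m) (cx (t h))) = (if l = m then of_nat (N ^ CARD('n)) else 0)" if l: "l \<in> S" for l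
  proof -
    have "\<exists>d. (l - m) $ j = of_int d \<and> \<bar>d\<bar> < int N" for j
    proof -
      have lm: "l $ j \<in> \<int>" "m $ j \<in> \<int>" "\<bar>l $ j\<bar> \<le> real n" "\<bar>m $ j\<bar> \<le> real n" using S l m by (auto simp: ibox_def)
      then obtain d where d: "(l - m) $ j = of_int d" by (metis Ints_cases Ints_diff vector_minus_component)
      moreover have "\<bar>(l - m) $ j\<bar> \<le> 2 * real n" using lm by (simp add: abs_le_iff)
      ultimately have "\<bar>d\<bar> < int N" unfolding N_def by linarith
      with d show ?thesis by blast
    qed
    then obtain d where d: "\<And>j. (l - m) $ j = of_int (d j)" "\<And>j. \<bar>d j\<bar> < int N" by metis
    have "expo (l - m) (cx (t h)) = (\<Prod>j\<in>UNIV. (unit_root N powi d j) ^ h j)" for h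
    proof -
      have "expo (l - m) (cx (t h)) = exp (\<Sum>j\<in>UNIV. 2 * of_real pi * \<i> * of_int (d j) * of_nat (h j) / of_nat N)"
        unfolding expo_def sum_distrib_left by (intro arg_cong[where f = exp] sum.cong refl) (simp add: d(1)[simplified] t_def)
      then show ?thesis by (simp add: exp_sum exp_multiple_unit_root)
    qed
    then have "(\<Sum>h\<in>G. expo (l - m) (cx (t h))) = (\<Prod>j\<in>UNIV. \<Sum>k<N. (unit_root N powi d j) ^ k)"
      unfolding G_def by (simp add: prod_sum_PiE)
    also have "\<dots> = (\<Prod>j\<in>UNIV. if d j = 0 then of_nat N else 0)" using d(2) by (simp add: sum_unit_roots)
    also have "\<dots> = (if l = m then of_nat (N ^ CARD('n)) else 0)"
    proof (cases "l = m")
      case True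
      then have "d j = 0" for j using d(1)[of j] by simp
      then show ?thesis using True by simp
    next
      case False
      then obtain j where "l $ j \<noteq> m $ j" by (auto simp: vec_eq_iff)
      then have "d j \<noteq> 0" using d(1)[of j] by auto
      then have "(\<Prod>j\<in>UNIV. if d j = 0 then of_nat N else 0) = (0 :: complex)" by (intro prod_zero) auto
      then show ?thesis using False by simp
    qed
    finally show ?thesis .
  qed
  have eq: "(\<Sum>h\<in>G. (\<Sum>l\<in>S. c l * expo l (cx (t h) + v)) * expo (- m) (cx (t h))) = c m * expo m v * of_nat (N ^ CARD('n))"
  proof -
    have "(\<Sum>h\<in>G. (\<Sum>l\<in>S. c l * expo l (cx (t h) + v)) * expo (- m) (cx (t h))) = (\<Sum>h\<in>G. \<Sum>l\<in>S. c l * expo l v * expo (l - m) (cx (t h)))"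
      unfolding sum_distrib_right by (intro sum.cong refl) (simp add: expo_shift diff_conv_add_uminus expo_add del: add_uminus_conv_diff)
    also have "\<dots> = (\<Sum>l\<in>S. c l * expo l v * (\<Sum>h\<in>G. expo (l - m) (cx (t h))))"
      by (subst sum.swap) (simp only: sum_distrib_left)
    also have "\<dots> = (\<Sum>l\<in>S. if l = m then c m * expo m v * of_nat (N ^ CARD('n)) else 0)"
      using orth by (intro sum.cong refl) auto
    finally show ?thesis using S m by simp
  qed
  have "cmod (\<Sum>h\<in>G. (\<Sum>l\<in>S. c l * expo l (cx (t h) + v)) * expo (- m) (cx (t h))) \<le> (\<Sum>h\<in>G. B)"
    using B by (intro sum_norm_le) (simp add: norm_mult norm_expo v_def)
  then have "cmod (c m) * cmod (expo m v) * real (N ^ CARD('n)) \<le> B * real (N ^ CARD('n))"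
    unfolding eq by (simp add: norm_mult cG mult.commute norm_power del: of_nat_power)
  then have "cmod (c m) * cmod (expo m v) \<le> B" by (simp add: N_def)
  moreover have "cmod (expo m v) = exp (- (m \<bullet> y))"
  proof -
    have "im_vec v = y" by (simp add: v_def vec_eq_iff)
    then show ?thesis by (simp add: norm_expo)
  qed
  ultimately show ?thesis by (simp add: exp_minus field_simps)
qed

text \<open>With \<open>u = e\<^bsup>i\<theta>\<^esup>\<close> and \<open>w = e\<^bsup>i(\<pi> - \<theta>)\<^esup>\<close> one has \<open>u w = - 1\<close> and \<open>u + w = 2 i sin \<theta>\<close>, whence a Chebyshev
  recurrence for \<open>u\<^sup>k + w\<^sup>k\<close>.\<close>
lemma reflected_power_sum_polynomial:
  "\<exists>Q :: complex poly. degree Q \<le> k \<and> (\<forall>\<theta>. exp (\<i> * \<theta>) ^ k + exp (\<i> * (of_real pi - \<theta>)) ^ k = poly Q (sin \<theta>))"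
proof -
  define s where "s k \<theta> = exp (\<i> * \<theta>) ^ k + exp (\<i> * (of_real pi - \<theta>)) ^ k" for k \<theta>
  have uw: "exp (\<i> * \<theta>) * exp (\<i> * (of_real pi - \<theta>)) = -1" for \<theta>
    by (simp add: exp_add[symmetric] algebra_simps)
  have upw: "exp (\<i> * \<theta>) + exp (\<i> * (of_real pi - \<theta>)) = 2 * \<i> * sin \<theta>" for \<theta>
  proof -
    have "exp (\<i> * (of_real pi - \<theta>)) = - exp (- (\<i> * \<theta>))"
      by (simp add: right_diff_distrib exp_diff exp_minus divide_inverse)
    then show ?thesis by (simp add: sin_exp_eq)
  qed
  have rec: "s (Suc (Suc k)) \<theta> = 2 * \<i> * sin \<theta> * s (Suc k) \<theta> + s k \<theta>" for k \<theta>
  proof -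
    define u where "u = exp (\<i> * \<theta>)"
    define w where "w = exp (\<i> * (of_real pi - \<theta>))"
    have "u ^ Suc (Suc k) + w ^ Suc (Suc k) = (u + w) * (u ^ Suc k + w ^ Suc k) - (u * w) * (u ^ k + w ^ k)" by (simp add: algebra_simps)
    then show ?thesis using uw[of \<theta>] upw[of \<theta>] by (simp add: s_def u_def[symmetric] w_def[symmetric])
  qed
  have "(\<exists>Q :: complex poly. degree Q \<le> k \<and> (\<forall>\<theta>. s k \<theta> = poly Q (sin \<theta>))) \<and>
    (\<exists>Q :: complex poly. degree Q \<le> Suc k \<and> (\<forall>\<theta>. s (Suc k) \<theta> = poly Q (sin \<theta>)))"
  proof (induction k)
    case 0
    have "degree [:0, 2 * \<i>:] \<le> Suc 0" by simp
    moreover have "s 1 \<theta> = poly [:0, 2 * \<i>:] (sin \<theta>)" for \<theta> using upw[of \<theta>] by (simp add: s_def)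
    moreover have "s 0 \<theta> = poly [:2:] (sin \<theta>)" for \<theta> by (simp add: s_def)
    ultimately show ?case by (metis One_nat_def degree_pCons_0 le_refl)
  next
    case (Suc k)
    then obtain Q Q' :: "complex poly" where Q: "degree Q \<le> k" "\<And>\<theta>. s k \<theta> = poly Q (sin \<theta>)"
      "degree Q' \<le> Suc k" "\<And>\<theta>. s (Suc k) \<theta> = poly Q' (sin \<theta>)" by blast
    have "degree ([:0, 2 * \<i>:] * Q' + Q) \<le> Suc (Suc k)"
      using Q(1,3) degree_mult_le[of "[:0, 2 * \<i>:]" Q'] by (intro degree_add_le) auto
    moreover have "s (Suc (Suc k)) \<theta> = poly ([:0, 2 * \<i>:] * Q' + Q) (sin \<theta>)" for \<theta>
      unfolding rec Q(2,4) by simp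
    ultimately show ?case using Q(3,4) by blast
  qed
  then show ?thesis unfolding s_def by blast
qed

lemma reflected_exponential_polynomial:
  assumes "l \<in> \<int>"
  shows "\<exists>Q :: complex poly. real (degree Q) \<le> \<bar>l\<bar> \<and>
    (\<forall>\<theta>. exp (\<i> * of_real l * \<theta>) + exp (\<i> * of_real l * (of_real pi - \<theta>)) = poly Q (sin \<theta>))"
proof -
  obtain d where d: "l = of_int d" using assms by (auto elim: Ints_cases)
  obtain Q :: "complex poly" where Q: "degree Q \<le> nat \<bar>d\<bar>" "\<And>\<theta>. exp (\<i> * \<theta>) ^ nat \<bar>d\<bar> + exp (\<i> * (of_real pi - \<theta>)) ^ nat \<bar>d\<bar> = poly Q (sin \<theta>)"
    using reflected_power_sum_polynomial[of "nat \<bar>d\<bar>"] by blast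
  have dQ: "real (degree Q) \<le> \<bar>l\<bar>" using Q(1) unfolding d by linarith
  show ?thesis
  proof (cases "0 \<le> d")
    case True
    then have "exp (\<i> * of_real l * \<theta>) = exp (\<i> * \<theta>) ^ nat \<bar>d\<bar>" for \<theta>
      by (simp add: d exp_of_nat_mult[symmetric] mult_ac)
    then show ?thesis using Q(2) dQ by metis
  next
    case False
    have e: "exp (\<i> * of_real l * \<theta>) = (- 1) ^ nat \<bar>d\<bar> * exp (\<i> * (of_real pi - \<theta>)) ^ nat \<bar>d\<bar>" for \<theta>
    proof -
      have "exp (\<i> * of_real l * \<theta>) = exp (- (\<i> * \<theta>)) ^ nat \<bar>d\<bar>"
        using False by (simp add: d exp_of_nat_mult[symmetric] mult_ac)
      also have "exp (- (\<i> * \<theta>)) = (- 1) * exp (\<i> * (of_real pi - \<theta>))"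
        by (simp add: right_diff_distrib exp_diff exp_minus divide_inverse)
      finally show ?thesis by (simp only: power_mult_distrib)
    qed
    have "exp (\<i> * of_real l * \<theta>) + exp (\<i> * of_real l * (of_real pi - \<theta>)) = poly (smult ((- 1) ^ nat \<bar>d\<bar>) Q) (sin \<theta>)" for \<theta>
      unfolding e[of \<theta>] e[of "of_real pi - \<theta>"] poly_smult Q(2)[symmetric] by (simp add: distrib_left add.commute)
    moreover have "real (degree (smult ((- 1) ^ nat \<bar>d\<bar>) Q)) \<le> \<bar>l\<bar>" using dQ by simp
    ultimately show ?thesis by blast
  qed
qed

lemma norm_sin_le_cosh: "cmod (sin z) \<le> cosh (Im z)"
proof -
  have "cmod (sin z) = cmod (exp (\<i> * z) - exp (- (\<i> * z))) / 2" by (simp add: sin_exp_eq norm_divide norm_mult)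
  also have "\<dots> \<le> (cmod (exp (\<i> * z)) + cmod (exp (- (\<i> * z)))) / 2" by (intro divide_right_mono norm_triangle_ineq4) auto
  also have "\<dots> = cosh (Im z)" by (simp add: cosh_field_def)
  finally show ?thesis .
qed

lemma Im_sin_sinh: "Im (sin z) = cos (Re z) * sinh (Im z)"
  by (simp add: Im_sin sinh_field_def)

lemma abs_sinh_le: "\<bar>sinh t\<bar> \<le> \<bar>t\<bar> * cosh (t :: real)"
proof -
  have *: "sinh t \<le> t * cosh t" if "0 \<le> t" for t :: real
  proof -
    have "(\<lambda>t. t * cosh t - sinh t) 0 \<le> (\<lambda>t. t * cosh t - sinh t) t"
    proof (rule DERIV_nonneg_imp_nondecreasing[OF that])
      fix x :: real assume "0 \<le> x"
      then have "0 \<le> x * sinh x" by simp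
      moreover have "((\<lambda>t. t * cosh t - sinh t) has_real_derivative x * sinh x) (at x)" by (auto intro!: derivative_eq_intros)
      ultimately show "\<exists>y. ((\<lambda>t. t * cosh t - sinh t) has_real_derivative y) (at x) \<and> 0 \<le> y" by blast
    qed
    then show ?thesis by simp
  qed
  show ?thesis using *[of "\<bar>t\<bar>"] by (cases "0 \<le> t") auto
qed

lemma cosh_le:
  fixes s :: real
  assumes "0 \<le> s" "s \<le> 1" shows "cosh s \<le> 1 + s\<^sup>2"
proof -
  have "exp s \<le> 1 + s + s\<^sup>2" by (rule exp_bound) (use assms in auto)
  moreover have "exp (- s) \<le> 1 - s + s\<^sup>2"
  proof -
    have "1 \<le> (1 - s + s\<^sup>2) * (1 + s)" using assms by (simp add: algebra_simps power2_eq_square)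
    also have "\<dots> \<le> (1 - s + s\<^sup>2) * exp s" using exp_ge_add_one_self[of s] assms by (intro mult_left_mono) auto
    finally show ?thesis by (simp add: exp_minus field_simps)
  qed
  ultimately show ?thesis by (simp add: cosh_field_def)
qed

lemma polys_add: "P \<in> polys a V \<Longrightarrow> Q \<in> polys a V \<Longrightarrow> (\<lambda>x. P x + Q x) \<in> polys a V"
proof -
  assume "P \<in> polys a V" "Q \<in> polys a V"
  then obtain c d where "P = (\<lambda>x. \<Sum>k \<in> lattice_points (scaled a V). c k * (\<Prod>j\<in>UNIV. complex_of_real (x $ j) ^ (k $ j)))"
    "Q = (\<lambda>x. \<Sum>k \<in> lattice_points (scaled a V). d k * (\<Prod>j\<in>UNIV. complex_of_real (x $ j) ^ (k $ j)))" unfolding polys_def by blast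
  then have "(\<lambda>x. P x + Q x) = (\<lambda>x. \<Sum>k \<in> lattice_points (scaled a V). (c k + d k) * (\<Prod>j\<in>UNIV. complex_of_real (x $ j) ^ (k $ j)))"
    by (simp add: sum.distrib ring_distribs)
  then show ?thesis unfolding polys_def by (intro CollectI exI)
qed

lemma polys_zero: "(\<lambda>x. 0) \<in> polys a V"
  unfolding polys_def by (intro CollectI exI[of _ "\<lambda>_. 0"]) simp

lemma polys_cmult: "P \<in> polys a V \<Longrightarrow> (\<lambda>x. b * P x) \<in> polys a V"
proof -
  assume "P \<in> polys a V"
  then obtain c where "P = (\<lambda>x. \<Sum>k \<in> lattice_points (scaled a V). c k * (\<Prod>j\<in>UNIV. complex_of_real (x $ j) ^ (k $ j)))"
    unfolding polys_def by blast
  then have "(\<lambda>x. b * P x) = (\<lambda>x. \<Sum>k \<in> lattice_points (scaled a V). (b * c k) * (\<Prod>j\<in>UNIV. complex_of_real (x $ j) ^ (k $ j)))"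
    by (simp add: sum_distrib_left mult_ac)
  then show ?thesis unfolding polys_def by (intro CollectI exI)
qed

lemma polys_sum: "(\<And>i. i \<in> I \<Longrightarrow> P i \<in> polys a V) \<Longrightarrow> (\<lambda>x. \<Sum>i\<in>I. P i x) \<in> polys a V"
  by (induction I rule: infinite_finite_induct) (auto intro: polys_add polys_zero)

context solid_body
begin

lemma finite_lattice_points: "0 \<le> a \<Longrightarrow> finite (lattice_points (scaled a V))"
proof -
  assume a: "0 \<le> a"
  have "(\<lambda>k. \<chi> j. real (k $ j)) ` lattice_points (scaled a V) \<subseteq> ibox (\<chi> j. a * R)"
  proof clarify
    fix k assume "k \<in> lattice_points (scaled a V)"
    then have "(\<chi> j. real (k $ j)) \<in> scaled a V" by (simp add: lattice_points_def)
    from scaled_component_le[OF a this] show "(\<chi> j. real (k $ j)) \<in> ibox (\<chi> j. a * R)" by (simp add: ibox_def)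
  qed
  then have "finite ((\<lambda>k. \<chi> j. real (k $ j)) ` lattice_points (scaled a V))" using finite_ibox finite_subset by blast
  then show ?thesis by (rule finite_imageD) (auto simp: inj_on_def vec_eq_iff)
qed

lemma polys_monomial:
  assumes "0 \<le> a" "k \<in> lattice_points (scaled a V)"
  shows "(\<lambda>x. \<Prod>j\<in>UNIV. complex_of_real (x $ j) ^ (k $ j)) \<in> polys a V"
  unfolding polys_def
proof (intro CollectI exI[of _ "\<lambda>i. if i = k then 1 else 0"] ext)
  fix x :: "real ^ 'n"
  have "(\<Sum>i\<in>lattice_points (scaled a V). (if i = k then 1 else 0) * (\<Prod>j\<in>UNIV. complex_of_real (x $ j) ^ (i $ j)))
    = (\<Sum>i\<in>lattice_points (scaled a V). if i = k then (\<Prod>j\<in>UNIV. complex_of_real (x $ j) ^ (k $ j)) else 0)"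
    by (intro sum.cong) auto
  also have "\<dots> = (\<Prod>j\<in>UNIV. complex_of_real (x $ j) ^ (k $ j))" using finite_lattice_points assms by simp
  finally show "(\<Prod>j\<in>UNIV. complex_of_real (x $ j) ^ (k $ j)) = (\<Sum>i\<in>lattice_points (scaled a V). (if i = k then 1 else 0) * (\<Prod>j\<in>UNIV. complex_of_real (x $ j) ^ (i $ j)))" by simp
qed

text \<open>By the \<Pi>-condition every exponent occurring in the product lies in \<open>a V\<close>.\<close>
lemma prod_poly_in_polys:
  fixes Q :: "'n \<Rightarrow> complex poly"
  assumes a: "0 \<le> a" and l: "l \<in> scaled a V" and Q: "\<And>j. real (degree (Q j)) \<le> \<bar>l $ j\<bar>"
  shows "(\<lambda>x. \<Prod>j\<in>UNIV. poly (Q j) (complex_of_real (x $ j))) \<in> polys a V"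
proof -
  have "(\<Prod>j\<in>UNIV. poly (Q j) (complex_of_real (x $ j))) =
    (\<Sum>k\<in>PiE UNIV (\<lambda>j. {..degree (Q j)}). (\<Prod>j\<in>UNIV. coeff (Q j) (k j)) * (\<Prod>j\<in>UNIV. complex_of_real (x $ j) ^ ((\<chi> j. k j) $ j)))" for x
    unfolding poly_altdef by (subst prod_sum_PiE) (auto simp: prod.distrib)
  moreover have "(\<lambda>x. \<Sum>k\<in>PiE UNIV (\<lambda>j. {..degree (Q j)}). (\<Prod>j\<in>UNIV. coeff (Q j) (k j)) * (\<Prod>j\<in>UNIV. complex_of_real (x $ j) ^ ((\<chi> j. k j) $ j))) \<in> polys a V"
  proof (intro polys_sum polys_cmult polys_monomial a)
    fix k assume k: "k \<in> PiE UNIV (\<lambda>j. {..degree (Q j)})"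
    have "\<bar>(\<chi> j. real (k j)) $ j\<bar> \<le> \<bar>l $ j\<bar>" for j
    proof -
      have "k j \<le> degree (Q j)" using k by (auto simp: PiE_iff)
      then show ?thesis using Q[of j] by simp
    qed
    from scaled_solid[OF a l this] show "(\<chi> j. k j) \<in> lattice_points (scaled a V)" by (simp add: lattice_points_def)
  qed
  ultimately show ?thesis by simp
qed

end

lemma card_ibox_le: "real (card (ibox (\<chi> i. real n) :: (real ^ 'n) set)) \<le> (2 * real n + 1) ^ CARD('n)"
proof -
  have "ibox (\<chi> i. real n) \<subseteq> (\<lambda>k. \<chi> j. real_of_int (k j)) ` (PiE (UNIV :: 'n set) (\<lambda>_. {- int n..int n}))"
  proof
    fix l :: "real ^ 'n" assume l: "l \<in> ibox (\<chi> i. real n)"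
    define k where "k j = \<lfloor>l $ j\<rfloor>" for j
    have k: "l $ j = of_int (k j)" for j using l by (auto simp: ibox_def k_def Ints_def)
    have "k j \<in> {- int n..int n}" for j
    proof -
      have "\<bar>l $ j\<bar> \<le> real n" using l by (simp add: ibox_def)
      then have "\<bar>real_of_int (k j)\<bar> \<le> real n" unfolding k .
      then show ?thesis by (simp add: abs_le_iff)
    qed
    then show "l \<in> (\<lambda>k. \<chi> j. real_of_int (k j)) ` (PiE (UNIV :: 'n set) (\<lambda>_. {- int n..int n}))"
      using k by (intro image_eqI[of _ _ k]) (auto simp: vec_eq_iff)
  qed
  then have "card (ibox (\<chi> i. real n) :: (real ^ 'n) set) \<le> card (PiE (UNIV :: 'n set) (\<lambda>_. {- int n..int n}))"
    by (rule surj_card_le[rotated]) (auto intro: finite_PiE)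
  also have "\<dots> = (2 * n + 1) ^ CARD('n)" by (simp add: card_PiE nat_add_distrib nat_mult_distrib)
  finally have "real (card (ibox (\<chi> i. real n) :: (real ^ 'n) set)) \<le> real ((2 * n + 1) ^ CARD('n))" by (rule of_nat_mono)
  then show ?thesis by (simp add: add.commute)
qed

context solid_body
begin

text \<open>A function \<open>f\<close> of type \<open>V\<close>, bounded on the real space, gives the entire function \<open>f(\<sigma> a sin \<theta>)\<close> of \<open>\<theta>\<close>,
  which is periodic and symmetric under \<open>\<theta>\<^sub>j \<rightarrow> \<pi> - \<theta>\<^sub>j\<close>.  Shifting \<open>\<theta>\<close> by a small imaginary vector shows that its
  frequencies outside \<open>\<tau> a V\<close> have exponentially small coefficients; dropping them and symmetrising leaves a
  polynomial in \<open>sin \<theta>\<close> with exponents in \<open>\<tau> a V\<close>.\<close>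
theorem polynomial_approximation:
  assumes f: "f \<in> exp_type V" and M: "\<And>x. cmod (f (cx x)) \<le> M" and \<sigma>: "0 < \<sigma>" "\<sigma> < \<tau>"
  shows "\<exists>c>0. \<exists>K\<ge>0. \<forall>a\<ge>1. \<exists>P\<in>polys (\<tau> * a) V. \<forall>x\<in>cube.
    cmod (P x - f (cx ((\<sigma> * a) *\<^sub>R x))) \<le> K * a ^ (2 * CARD('n)) * exp (- c * a)"
proof -
  define d where "d = CARD('n)"
  have M0: "0 \<le> M" by (rule order_trans[OF norm_ge_zero M[of 0]])
  have ent: "entire f" using f by (simp add: exp_type_def)
  define \<tau>' where "\<tau>' = (\<sigma> + \<tau>) / 2"
  have \<tau>': "\<sigma> < \<tau>'" "\<tau>' < \<tau>" using \<sigma> by (auto simp: \<tau>'_def)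
  define \<kappa> where "\<kappa> = min 1 ((\<tau>' / \<sigma> - 1) / 3)"
  have \<kappa>: "0 < \<kappa>" "\<kappa> \<le> 1" "3 * \<kappa> \<le> \<tau>' / \<sigma> - 1"
  proof -
    show "0 < \<kappa>" "\<kappa> \<le> 1" using \<sigma> \<tau>' by (auto simp: \<kappa>_def)
    have "\<kappa> \<le> (\<tau>' / \<sigma> - 1) / 3" unfolding \<kappa>_def by (rule min.cobounded2)
    from mult_left_mono[OF this, of 3] show "3 * \<kappa> \<le> \<tau>' / \<sigma> - 1" by simp
  qed
  have \<kappa>2: "(1 + \<kappa>) * ((1 + \<kappa>) * \<sigma>) \<le> \<tau>'"
  proof -
    have "\<kappa> * \<kappa> \<le> \<kappa> * 1" using \<kappa> by (intro mult_left_mono) auto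
    then have "(1 + \<kappa>) * (1 + \<kappa>) \<le> \<tau>' / \<sigma>" using \<kappa>(3) by (simp add: algebra_simps)
    then show ?thesis using \<sigma>(1) by (simp add: pos_le_divide_eq mult_ac)
  qed
  obtain C where C: "0 < C" "\<And>z. cmod (f z) \<le> C * exp ((1 + \<kappa> / 2) * dn z)"
    using f \<kappa>(1) unfolding exp_type_def by (auto dest!: spec[of _ "\<kappa> / 2"])
  have et: "etype (1 + \<kappa> / 2) f" unfolding etype_def using ent C(2) by blast
  define D where "D = 12 * \<sigma> * (R * real d) + 1"
  have D1: "1 \<le> D" unfolding D_def using \<sigma> R_nonneg by simp
  define K1 where "K1 = real d * (2 * C * (D + 2) ^ d)"
  have K10: "0 \<le> K1" unfolding K1_def using C(1) D1 by simp
  \<comment> \<open>The size of the imaginary shift: so small that \<open>cosh s\<close> is within the room between \<open>\<sigma>\<close> and \<open>\<tau>'\<close>.\<close>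
  define s where "s = \<kappa>"
  have s: "0 < s" "s \<le> 1" "cosh s \<le> 1 + \<kappa>"
  proof -
    have "cosh s \<le> 1 + s\<^sup>2" using cosh_le[of s] \<kappa> by (simp add: s_def)
    moreover have "s * s \<le> s * 1" using \<kappa> unfolding s_def by (intro mult_left_mono) auto
    ultimately show "cosh s \<le> 1 + \<kappa>" by (simp add: s_def power2_eq_square)
  qed (use \<kappa> in \<open>auto simp: s_def\<close>)
  \<comment> \<open>The rate of decay of the coefficients at frequencies outside \<open>\<tau> a V\<close>.\<close>
  define c0 where "c0 = (\<tau> - \<tau>') * s * r"
  have c0: "0 < c0" unfolding c0_def using \<tau>' s r_pos by simp
  define c where "c = min 1 c0"
  define K where "K = K1 + (2 * (D + 2)) ^ d * (M + K1)"
  have K0: "0 \<le> K" unfolding K_def using K10 M0 D1 by simp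
  have main: "\<exists>P\<in>polys (\<tau> * a) V. \<forall>x\<in>cube. cmod (P x - f (cx ((\<sigma> * a) *\<^sub>R x))) \<le> K * a ^ (2 * d) * exp (- c * a)" if a: "1 \<le> a" for a
  proof -
    define b where "b = \<sigma> * a"
    have b: "0 < b" using \<sigma> a by (simp add: b_def)
    \<comment> \<open>So many nodes that the interpolation error, of order \<open>e\<^sup>-\<^sup>n\<close> times the size of \<open>f\<close> on the polydisc of
        radius \<open>6 b\<close>, is of order \<open>e\<^sup>-\<^sup>a\<close>, up to powers of \<open>a\<close>.\<close>
    define n where "n = nat \<lceil>D * a\<rceil>"
    have n: "D * a \<le> real n" "real n \<le> D * a + 1" "0 < n"
    proof -
      have "1 * 1 \<le> D * a" using D1 a by (intro mult_mono) auto
      then show "D * a \<le> real n" "real n \<le> D * a + 1" "0 < n" unfolding n_def by linarith+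
    qed
    define g where "g z = f (of_real b *s z)" for z
    define B where "B = C * exp (12 * b * (R * real d))"
    have n1: "1 + real n \<le> (D + 2) * a" using n(2) a by (simp add: algebra_simps)
    have hol: "(\<lambda>\<zeta>. g (vupd z i \<zeta>)) holomorphic_on UNIV" for z i
    proof -
      have "of_real b *s vupd z i \<zeta> = of_real b *s vupd z i 0 + \<zeta> *s (of_real b *s axis i 1)" for \<zeta>
        by (simp add: vec_eq_iff vupd_nth axis_def)
      then have "(\<lambda>\<zeta>. g (vupd z i \<zeta>)) = (\<lambda>\<zeta>. f (of_real b *s vupd z i 0 + \<zeta> *s (of_real b *s axis i 1)))"
        unfolding g_def by (intro ext arg_cong[where f = f])
      then show ?thesis by (simp only: entire_slice_holomorphic[OF ent])
    qed
    have bd: "cmod (g z) \<le> B" if z: "\<And>i. cmod (z $ i) \<le> 3 * 2" for z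
    proof -
      have "(\<Sum>j\<in>UNIV. cmod (z $ j)) \<le> (\<Sum>j\<in>(UNIV :: 'n set). 6)" using z by (intro sum_mono) simp
      then have "R * (\<Sum>j\<in>UNIV. cmod (z $ j)) \<le> R * (6 * real d)" using R_nonneg unfolding d_def by (intro mult_left_mono) auto
      then have "dn z \<le> R * (6 * real d)" using dn_upper[of z] by linarith
      then have "b * dn z \<le> b * (R * (6 * real d))" using b by (intro mult_left_mono) auto
      moreover have "dn (of_real b *s z) \<le> b * dn z" using dn_scale_le[of "of_real b" z] b by simp
      ultimately have "dn (of_real b *s z) \<le> b * (R * (6 * real d))" by linarith
      then have "(1 + \<kappa> / 2) * dn (of_real b *s z) \<le> 2 * (b * (R * (6 * real d)))"
        using \<kappa> dn_nonneg by (intro mult_mono) auto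
      then have "C * exp ((1 + \<kappa> / 2) * dn (of_real b *s z)) \<le> B" unfolding B_def using C(1) by (intro mult_left_mono) (auto simp: mult_ac)
      then show ?thesis unfolding g_def using C(2)[of "of_real b *s z"] by linarith
    qed
    have B0: "0 \<le> B" unfolding B_def using C(1) by simp
    obtain T where T: "\<And>z. (\<And>i. cmod (z $ i) \<le> 2) \<Longrightarrow> cmod (g z - T z) \<le> real (card (UNIV :: 'n set)) * (2 * B * (1 + real n) ^ card (UNIV :: 'n set) * exp (- real n))"
      "\<And>w. expsum (ibox (\<chi> i. if i \<in> (UNIV :: 'n set) then real n else 0)) (\<lambda>\<theta>. T (\<chi> i. if i \<in> (UNIV :: 'n set) then sin (\<theta> $ i) else w $ i))"
      using trigonometric_approximation[of 2 n B g UNIV, OF _ n(3) B0 hol bd] by auto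
    define err where "err = K1 * a ^ d * exp (- a)"
    have err0: "0 \<le> err" unfolding err_def using K10 a by simp
    have Terr: "cmod (g z - T z) \<le> err" if "\<And>i. cmod (z $ i) \<le> 2" for z
    proof -
      have "12 * b * (R * real d) + - real n \<le> - a" using n(1) by (simp add: b_def D_def algebra_simps)
      then have "C * exp (12 * b * (R * real d) + - real n) \<le> C * exp (- a)" using C(1) by simp
      then have e: "B * exp (- real n) \<le> C * exp (- a)" unfolding B_def exp_add by (simp add: mult_ac)
      have "(1 + real n) ^ d \<le> ((D + 2) * a) ^ d" using n1 by (intro power_mono) auto
      from mult_mono[OF this e] have "(1 + real n) ^ d * (B * exp (- real n)) \<le> ((D + 2) * a) ^ d * (C * exp (- a))"
        using B0 D1 a by auto
      then have "real d * (2 * ((1 + real n) ^ d * (B * exp (- real n)))) \<le> real d * (2 * (((D + 2) * a) ^ d * (C * exp (- a))))"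
        by (intro mult_left_mono) auto
      then have "real d * (2 * B * (1 + real n) ^ d * exp (- real n)) \<le> err"
        by (simp add: err_def K1_def power_mult_distrib mult_ac)
      then show ?thesis using T(1)[OF that] unfolding d_def by linarith
    qed
    obtain S cf where S: "finite S" "S \<subseteq> ibox (\<chi> i. real n)" "\<And>\<theta>. T (\<chi> i. sin (\<theta> $ i)) = (\<Sum>l\<in>S. cf l * expo l \<theta>)"
    proof -
      have "expsum (ibox (\<chi> i. real n)) (\<lambda>\<theta>. T (\<chi> i. sin (\<theta> $ i)))" using T(2)[of 0] by simp
      then obtain S cf where h: "finite S" "S \<subseteq> ibox (\<chi> i. real n)" "(\<lambda>\<theta>. T (\<chi> i. sin (\<theta> $ i))) = (\<lambda>\<theta>. \<Sum>l\<in>S. cf l * expo l \<theta>)"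
        unfolding expsum_def by blast
      show thesis by (rule that[OF h(1,2)]) (rule fun_cong[OF h(3)])
    qed
    define good where "good = {l \<in> S. l \<in> scaled (\<tau> * a) V}"
    have ta: "0 < \<tau> * a" using \<sigma> a by simp
    have coeff: "cmod (cf l) \<le> (M + K1 * a ^ d) * exp (- c0 * a)" if l: "l \<in> S" "l \<notin> good" for l
    proof -
      have "l \<notin> scaled (\<tau> * a) V" using l by (simp add: good_def)
      from separating_direction[OF ta this] obtain u where u: "\<And>j. \<bar>u $ j\<bar> \<le> 1" "r \<le> supp u" "\<tau> * a * supp u \<le> l \<bullet> u" by blast
      \<comment> \<open>Shifting against the separating direction makes the factor \<open>exp (l \<bullet> y)\<close> small; by \<open>etype_bound\<close> the
          function itself grows less than that factor decays.\<close>
      define y where "y = (- s) *\<^sub>R u"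
      define H where "H = \<tau>' * a * s * supp u"
      have H0: "0 \<le> H" unfolding H_def using \<sigma> \<tau>' a s dn_nonneg by simp
      have yb: "\<bar>y $ j\<bar> \<le> s" for j using u(1)[of j] s(1) by (simp add: y_def abs_mult mult_left_le)
      have ch: "cosh (y $ j) \<le> 1 + \<kappa>" for j
      proof -
        have "cosh (y $ j) \<le> cosh s" using yb[of j] s(1) cosh_real_nonneg_le_iff[of "\<bar>y $ j\<bar>" s] by simp
        then show ?thesis using s(3) by linarith
      qed
      have "cmod (\<Sum>l\<in>S. cf l * expo l (cx x + \<i> *s cx y)) \<le> M * exp H + err" for x
      proof -
        define z where "z = (\<chi> i. sin ((cx x + \<i> *s cx y) $ i))"
        have "cmod (z $ i) \<le> 2" for i
          using norm_sin_le_cosh[of "(cx x + \<i> *s cx y) $ i"] ch[of i] \<kappa>(2) by (simp add: z_def)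
        then have t: "cmod (g z - T z) \<le> err" by (rule Terr)
        have "supp (im_vec (of_real b *s z)) \<le> supp ((b * (1 + \<kappa>) * s) *\<^sub>R u)"
        proof (rule supp_mono)
          fix j
          have "\<bar>sinh (y $ j)\<bar> \<le> \<bar>y $ j\<bar> * (1 + \<kappa>)" using abs_sinh_le[of "y $ j"] ch[of j] by (meson abs_ge_zero mult_left_mono order_trans)
          then have "\<bar>cos (x $ j)\<bar> * \<bar>sinh (y $ j)\<bar> \<le> 1 * (\<bar>y $ j\<bar> * (1 + \<kappa>))" by (intro mult_mono) auto
          then have "b * (\<bar>cos (x $ j)\<bar> * \<bar>sinh (y $ j)\<bar>) \<le> b * (1 * (\<bar>y $ j\<bar> * (1 + \<kappa>)))" using b by (intro mult_left_mono) auto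
          then show "\<bar>im_vec (of_real b *s z) $ j\<bar> \<le> \<bar>((b * (1 + \<kappa>) * s) *\<^sub>R u) $ j\<bar>"
            using b \<kappa> s by (simp add: z_def Im_sin_sinh abs_mult y_def mult_ac)
        qed
        also have "\<dots> \<le> b * (1 + \<kappa>) * s * supp u" using supp_scale[of "b * (1 + \<kappa>) * s" u] b \<kappa> s by simp
        finally have "(1 + \<kappa>) * supp (im_vec (of_real b *s z)) \<le> (1 + \<kappa>) * (b * (1 + \<kappa>) * s * supp u)" using \<kappa> by (intro mult_left_mono) auto
        also have "\<dots> = ((1 + \<kappa>) * ((1 + \<kappa>) * \<sigma>)) * (a * s * supp u)" by (simp add: b_def mult_ac)
        also have "\<dots> \<le> \<tau>' * (a * s * supp u)" using \<kappa>2 a s dn_nonneg by (intro mult_right_mono) auto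
        also have "\<dots> = H" by (simp add: H_def mult_ac)
        finally have "M * exp ((1 + \<kappa>) * supp (im_vec (of_real b *s z))) \<le> M * exp H" using M0 by (intro mult_left_mono) auto
        moreover have "cmod (g z) \<le> M * exp ((1 + \<kappa>) * supp (im_vec (of_real b *s z)))"
          unfolding g_def by (rule etype_bound[OF et _ _ M]) (use \<kappa> in auto)
        ultimately have "cmod (g z) \<le> M * exp H" by linarith
        then have "cmod (T z) \<le> M * exp H + err" using t norm_triangle_ineq2[of "T z" "g z"] by (simp add: norm_minus_commute)
        then show ?thesis unfolding z_def S(3) .
      qed
      from expsum_coeff_bound[OF S(1,2) l(1) this] have "cmod (cf l) \<le> (M * exp H + err) * exp (l \<bullet> y)" .
      also have "\<dots> \<le> (M * exp H + K1 * a ^ d * exp H) * exp (- (\<tau> * a * s * supp u))"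
      proof (intro mult_mono add_mono)
        show "err \<le> K1 * a ^ d * exp H" unfolding err_def using K10 a H0 by (intro mult_left_mono) auto
        have "s * (\<tau> * a * supp u) \<le> s * (l \<bullet> u)" using u(3) s(1) by (intro mult_left_mono) auto
        then show "exp (l \<bullet> y) \<le> exp (- (\<tau> * a * s * supp u))" by (simp add: y_def mult_ac)
      qed (use M0 K10 a in auto)
      also have "\<dots> = (M + K1 * a ^ d) * exp (H + - (\<tau> * a * s * supp u))" unfolding exp_add by (simp add: algebra_simps)
      also have "\<dots> \<le> (M + K1 * a ^ d) * exp (- c0 * a)"
      proof -
        have "(\<tau> - \<tau>') * a * s * r \<le> (\<tau> - \<tau>') * a * s * supp u" using u(2) \<tau>' a s by (intro mult_left_mono) auto
        then have "H + - (\<tau> * a * s * supp u) \<le> - c0 * a" by (simp add: H_def c0_def algebra_simps)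
        then show ?thesis using M0 K10 a by (intro mult_left_mono) auto
      qed
      finally show ?thesis .
    qed
    have "\<forall>l. \<exists>Q :: complex poly. l \<in> \<int> \<longrightarrow> real (degree Q) \<le> \<bar>l\<bar> \<and>
      (\<forall>\<theta>. exp (\<i> * of_real l * \<theta>) + exp (\<i> * of_real l * (of_real pi - \<theta>)) = poly Q (sin \<theta>))"
      using reflected_exponential_polynomial by blast
    from choice[OF this] obtain Q :: "real \<Rightarrow> complex poly" where Q: "\<And>l. l \<in> \<int> \<Longrightarrow> real (degree (Q l)) \<le> \<bar>l\<bar>"
      "\<And>l \<theta>. l \<in> \<int> \<Longrightarrow> exp (\<i> * of_real l * \<theta>) + exp (\<i> * of_real l * (of_real pi - \<theta>)) = poly (Q l) (sin \<theta>)" by blast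
    have Sint: "l $ j \<in> \<int>" if "l \<in> S" for l j using S(2) that by (auto simp: ibox_def)
    define P where "P x = (1 / 2 ^ d) * (\<Sum>l\<in>good. cf l * (\<Prod>j\<in>UNIV. poly (Q (l $ j)) (complex_of_real (x $ j))))" for x
    have "P \<in> polys (\<tau> * a) V" unfolding P_def
    proof (intro polys_cmult polys_sum prod_poly_in_polys less_imp_le[OF ta])
      fix l assume "l \<in> good"
      then show "l \<in> scaled (\<tau> * a) V" "\<And>j. real (degree (Q (l $ j))) \<le> \<bar>l $ j\<bar>"
        using Q(1)[OF Sint] by (auto simp: good_def)
    qed
    moreover have "cmod (P x - f (cx ((\<sigma> * a) *\<^sub>R x))) \<le> K * a ^ (2 * d) * exp (- c * a)" if x: "x \<in> cube" for x
    proof -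
      have x1: "\<bar>x $ j\<bar> \<le> 1" for j using x by (simp add: cube_def)
      define \<theta> where "\<theta> = (\<chi> j. arcsin (x $ j))"
      have st: "sin (\<theta> $ j) = x $ j" for j
        using x1[of j] unfolding \<theta>_def vec_lambda_beta by (intro sin_arcsin) linarith+
      \<comment> \<open>All these points have the same sines; averaging the exponential sum over them makes each frequency
          contribute a polynomial in the sines.\<close>
      define refl where "refl E = (\<chi> j. if j \<in> E then \<theta> $ j else pi - \<theta> $ j)" for E
      have sr: "(\<chi> i. sin (cx (refl E) $ i)) = cx x" for E
      proof -
        have "sin (refl E $ i) = x $ i" for i by (simp add: refl_def st)
        then show ?thesis by (simp add: vec_eq_iff sin_of_real)
      qed
      have Tx: "T (cx x) = (\<Sum>l\<in>S. cf l * expo l (cx (refl E)))" for E using S(3)[of "cx (refl E)"] unfolding sr .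
      have pr: "(\<Prod>j\<in>UNIV. poly (Q (l $ j)) (complex_of_real (x $ j))) = (\<Sum>E\<in>Pow UNIV. expo l (cx (refl E)))" if l: "l \<in> S" for l
      proof -
        have "(\<Prod>j\<in>UNIV. poly (Q (l $ j)) (complex_of_real (x $ j))) =
          (\<Prod>j\<in>UNIV. exp (\<i> * of_real (l $ j) * of_real (\<theta> $ j)) + exp (\<i> * of_real (l $ j) * (of_real pi - of_real (\<theta> $ j))))"
          by (intro prod.cong refl) (simp only: Q(2)[OF Sint[OF l]] st[symmetric] sin_of_real)
        also have "\<dots> = (\<Sum>E\<in>Pow UNIV. (\<Prod>j\<in>E. exp (\<i> * of_real (l $ j) * of_real (\<theta> $ j))) * (\<Prod>j\<in>UNIV - E. exp (\<i> * of_real (l $ j) * (of_real pi - of_real (\<theta> $ j)))))"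
          by (rule prod_add) simp
        also have "\<dots> = (\<Sum>E\<in>Pow UNIV. expo l (cx (refl E)))"
        proof (rule sum.cong[OF refl])
          fix E :: "'n set"
          have "expo l (cx (refl E)) = (\<Prod>j\<in>UNIV. exp (\<i> * of_real (l $ j) * of_real (refl E $ j)))"
            by (simp add: expo_def exp_sum sum_distrib_left mult.assoc)
          also have "\<dots> = (\<Prod>j\<in>E. exp (\<i> * of_real (l $ j) * of_real (refl E $ j))) * (\<Prod>j\<in>UNIV - E. exp (\<i> * of_real (l $ j) * of_real (refl E $ j)))"
            by (subst prod.subset_diff[of E UNIV]) (auto simp: mult.commute)
          also have "\<dots> = (\<Prod>j\<in>E. exp (\<i> * of_real (l $ j) * of_real (\<theta> $ j))) * (\<Prod>j\<in>UNIV - E. exp (\<i> * of_real (l $ j) * (of_real pi - of_real (\<theta> $ j))))"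
            by (intro arg_cong2[where f = "(*)"] prod.cong) (auto simp: refl_def)
          finally show "(\<Prod>j\<in>E. exp (\<i> * of_real (l $ j) * of_real (\<theta> $ j))) * (\<Prod>j\<in>UNIV - E. exp (\<i> * of_real (l $ j) * (of_real pi - of_real (\<theta> $ j)))) = expo l (cx (refl E))" by simp
        qed
        finally show ?thesis .
      qed
      have cP: "card (Pow (UNIV :: 'n set)) = 2 ^ d" by (simp add: card_Pow d_def)
      have "P x = (1 / 2 ^ d) * (\<Sum>E\<in>Pow (UNIV :: 'n set). \<Sum>l\<in>good. cf l * expo l (cx (refl E)))"
      proof -
        have "(\<Sum>l\<in>good. cf l * (\<Prod>j\<in>UNIV. poly (Q (l $ j)) (complex_of_real (x $ j)))) = (\<Sum>l\<in>good. \<Sum>E\<in>Pow (UNIV :: 'n set). cf l * expo l (cx (refl E)))"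
          using pr by (intro sum.cong refl) (auto simp: good_def sum_distrib_left)
        then show ?thesis unfolding P_def by (subst sum.swap) simp
      qed
      moreover have "T (cx x) = (1 / 2 ^ d) * (\<Sum>E\<in>Pow (UNIV :: 'n set). \<Sum>l\<in>S. cf l * expo l (cx (refl E)))"
        unfolding Tx[symmetric] by (simp add: d_def)
      ultimately have PT: "P x = (1 / 2 ^ d) * (\<Sum>E\<in>Pow (UNIV :: 'n set). \<Sum>l\<in>good. cf l * expo l (cx (refl E)))"
        "T (cx x) = (1 / 2 ^ d) * (\<Sum>E\<in>Pow (UNIV :: 'n set). \<Sum>l\<in>S. cf l * expo l (cx (refl E)))" .
      then have "T (cx x) - P x = (1 / 2 ^ d) * (\<Sum>E\<in>Pow (UNIV :: 'n set). \<Sum>l\<in>S - good. cf l * expo l (cx (refl E)))"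
      proof -
        have "good \<subseteq> S" by (auto simp: good_def)
        then have sd: "(\<Sum>l\<in>S - good. cf l * expo l (cx (refl E))) = (\<Sum>l\<in>S. cf l * expo l (cx (refl E))) - (\<Sum>l\<in>good. cf l * expo l (cx (refl E)))" for E
          by (rule sum_diff[OF S(1)])
        show ?thesis by (simp only: sd sum_subtractf right_diff_distrib PT)
      qed
      also have "cmod \<dots> \<le> (1 / 2 ^ d) * (\<Sum>E\<in>Pow (UNIV :: 'n set). \<Sum>l\<in>S - good. (M + K1 * a ^ d) * exp (- c0 * a))"
        unfolding norm_mult
      proof (intro mult_mono sum_norm_le)
        fix E l assume "l \<in> S - good"
        then show "cmod (cf l * expo l (cx (refl E))) \<le> (M + K1 * a ^ d) * exp (- c0 * a)" using coeff[of l] by (simp add: norm_mult norm_expo)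
      qed (auto simp: norm_divide norm_power)
      also have "\<dots> = real (card (S - good)) * ((M + K1 * a ^ d) * exp (- c0 * a))" by (simp add: d_def)
      also have "\<dots> \<le> (2 * (D + 2)) ^ d * a ^ d * (((M + K1) * a ^ d) * exp (- c * a))"
      proof (intro mult_mono)
        have "card (S - good) \<le> card (ibox (\<chi> i. real n) :: (real ^ 'n) set)" using S(2) by (intro card_mono finite_ibox) auto
        then have "real (card (S - good)) \<le> (2 * real n + 1) ^ d" using card_ibox_le[where 'n = 'n, of n] unfolding d_def by linarith
        also have "\<dots> \<le> (2 * ((D + 2) * a)) ^ d" using n1 by (intro power_mono) auto
        finally show "real (card (S - good)) \<le> (2 * (D + 2)) ^ d * a ^ d"
          by (simp only: mult.assoc[symmetric] power_mult_distrib)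
        have "M * 1 \<le> M * a ^ d" using M0 a by (intro mult_left_mono one_le_power) auto
        then show "M + K1 * a ^ d \<le> (M + K1) * a ^ d" by (simp add: algebra_simps)
        show "exp (- c0 * a) \<le> exp (- c * a)" using a by (simp add: c_def)
      qed (use M0 K10 a D1 in auto)
      finally have 0: "cmod (T (cx x) - P x) \<le> (2 * (D + 2)) ^ d * a ^ d * (((M + K1) * a ^ d) * exp (- c * a))" .
      have 1: "cmod (T (cx x) - P x) \<le> (2 * (D + 2)) ^ d * (M + K1) * a ^ (2 * d) * exp (- c * a)"
      proof -
        have "a ^ (2 * d) = a ^ d * a ^ d" by (simp add: mult_2 power_add)
        then show ?thesis using 0 by (simp only: mult_ac)
      qed
      have x2: "cmod (cx x $ i) \<le> 2" for i using x1[of i] unfolding cx_nth norm_of_real by linarith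
      have "cmod (g (cx x) - T (cx x)) \<le> err" by (rule Terr[OF x2])
      also have "\<dots> \<le> K1 * a ^ (2 * d) * exp (- c * a)"
        unfolding err_def using K10 a by (intro mult_mono power_increasing) (auto simp: c_def)
      finally have 2: "cmod (g (cx x) - T (cx x)) \<le> K1 * a ^ (2 * d) * exp (- c * a)" .
      have gx: "g (cx x) = f (cx ((\<sigma> * a) *\<^sub>R x))" by (simp add: g_def b_def cx_scaleR)
      have "cmod (P x - f (cx ((\<sigma> * a) *\<^sub>R x))) \<le> cmod (g (cx x) - T (cx x)) + cmod (T (cx x) - P x)"
        unfolding gx[symmetric] using norm_triangle_ineq[of "g (cx x) - T (cx x)" "T (cx x) - P x"] by (simp add: norm_minus_commute)
      also have "\<dots> \<le> K * a ^ (2 * d) * exp (- c * a)" using 1 2 by (simp add: K_def algebra_simps)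
      finally show ?thesis .
    qed
    ultimately show ?thesis by blast
  qed
  have "0 < c" using c0 by (simp add: c_def)
  then show ?thesis using main K0 unfolding d_def by blast
qed

end

section \<open>The lower estimate\<close>

text \<open>A substitute for the triangle inequality that holds for every \<open>p > 0\<close> and has a constant close to \<open>1\<close> at the main
  term.\<close>
lemma powr_add_le:
  fixes u v :: real
  assumes "0 \<le> u" "0 \<le> v" "0 < \<eta>" "0 < p"
  shows "(u + v) powr p \<le> (1 + \<eta>) powr p * u powr p + (1 + 1 / \<eta>) powr p * v powr p"
proof (cases "v \<le> \<eta> * u")
  case True
  then have "(u + v) powr p \<le> ((1 + \<eta>) * u) powr p" using assms by (intro powr_mono2) (auto simp: algebra_simps)
  also have "\<dots> = (1 + \<eta>) powr p * u powr p" using assms by (simp add: powr_mult)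
  finally show ?thesis by (simp add: add_increasing2)
next
  case False
  then have "u \<le> v / \<eta>" using assms by (simp add: field_simps)
  then have "(u + v) powr p \<le> ((1 + 1 / \<eta>) * v) powr p" using assms by (intro powr_mono2) (auto simp: algebra_simps)
  also have "\<dots> = (1 + 1 / \<eta>) powr p * v powr p" using assms by (simp add: powr_mult)
  finally show ?thesis by (simp add: add_increasing)
qed

lemma prod_mono_ennreal:
  fixes u v :: "'a \<Rightarrow> ennreal"
  shows "(\<And>i. i \<in> A \<Longrightarrow> u i \<le> v i) \<Longrightarrow> prod u A \<le> prod v A"
  by (induction A rule: infinite_finite_induct) (auto intro!: mult_mono)

text \<open>The factor \<open>\<Prod>\<^sub>j (1 - t\<^sub>j\<^sup>2)\<^sup>N\<close> cancels the singularity of the Jacobi weight at the faces of the cube; what remains is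
  dominated by the power weight.\<close>
lemma jacobi_weight_damped_le:
  assumes "\<And>j. \<bar>t $ j\<bar> \<le> 1" "0 < N" "0 < p" "\<And>j. 0 \<le> real N * p + \<beta> j"
  shows "ennreal ((\<Prod>j\<in>UNIV. (1 - (t $ j)\<^sup>2) ^ N) powr p) * jacobi_weight \<alpha> \<beta> t \<le> power_weight \<alpha> t"
proof -
  have t1: "0 \<le> 1 - (t $ j)\<^sup>2" "1 - (t $ j)\<^sup>2 \<le> 1" for j using assms(1)[of j] by (auto simp: abs_square_le_1)
  have le1: "ennreal (((1 - (t $ j)\<^sup>2) ^ N) powr p) * epow (1 - (t $ j)\<^sup>2) (\<beta> j) \<le> 1" for j
  proof (cases "1 - (t $ j)\<^sup>2 = 0")
    case True
    then show ?thesis using assms(2) by (simp add: zero_power)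
  next
    case False
    then have pos: "0 < 1 - (t $ j)\<^sup>2" using t1[of j] by simp
    have "((1 - (t $ j)\<^sup>2) ^ N) powr p * (1 - (t $ j)\<^sup>2) powr \<beta> j = (1 - (t $ j)\<^sup>2) powr (real N * p + \<beta> j)"
      using pos by (simp add: powr_add powr_realpow[symmetric] powr_powr)
    also have "\<dots> \<le> 1" using powr_le1[OF assms(4)[of j]] t1[of j] by simp
    finally have "((1 - (t $ j)\<^sup>2) ^ N) powr p * (1 - (t $ j)\<^sup>2) powr \<beta> j \<le> 1" .
    then show ?thesis using False by (simp add: epow_def ennreal_mult[symmetric])
  qed
  have "ennreal ((\<Prod>j\<in>UNIV. (1 - (t $ j)\<^sup>2) ^ N) powr p) * jacobi_weight \<alpha> \<beta> t
    = (\<Prod>j\<in>UNIV. epow \<bar>t $ j\<bar> (\<alpha> j) * (ennreal (((1 - (t $ j)\<^sup>2) ^ N) powr p) * epow (1 - (t $ j)\<^sup>2) (\<beta> j)))"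
    unfolding jacobi_weight_def prod_powr_distrib using t1 by (simp add: prod_ennreal[symmetric] prod.distrib mult_ac)
  also have "\<dots> \<le> (\<Prod>j\<in>UNIV. epow \<bar>t $ j\<bar> (\<alpha> j) * 1)"
    using le1 by (intro prod_mono_ennreal mult_left_mono) auto
  finally show ?thesis by (simp add: power_weight_def)
qed

lemma power_weight_le_1:
  assumes "\<And>j. 0 \<le> \<alpha> j" "\<And>j. \<bar>t $ j\<bar> \<le> 1"
  shows "power_weight \<alpha> t \<le> 1"
proof -
  have "epow \<bar>t $ j\<bar> (\<alpha> j) \<le> 1" for j using assms powr_le1[of "\<alpha> j" "\<bar>t $ j\<bar>"] by (auto simp: epow_def not_less[symmetric])
  then have "power_weight \<alpha> t \<le> (\<Prod>j\<in>(UNIV :: 'a set). 1)" unfolding power_weight_def by (intro prod_mono_ennreal) auto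
  then show ?thesis by simp
qed

lemma power_weight_scale:
  assumes "\<And>j. 0 \<le> \<alpha> j" "0 < b"
  shows "power_weight \<alpha> (b *\<^sub>R t) = ennreal (b powr (\<Sum>j\<in>UNIV. \<alpha> j)) * power_weight \<alpha> t"
proof -
  have "epow \<bar>b * t $ j\<bar> (\<alpha> j) = ennreal (b powr \<alpha> j) * epow \<bar>t $ j\<bar> (\<alpha> j)" for j
    using epow_scale[OF assms(1)[of j] assms(2), of "b * t $ j"] assms(2) by simp
  then show ?thesis unfolding power_weight_def using assms(2) by (simp add: prod.distrib powr_sum prod_ennreal)
qed

lemma emeasure_cube: "emeasure lborel (cube :: (real ^ 'n) set) = ennreal (2 ^ CARD('n))"
proof -
  have "\<forall>b\<in>Basis. (\<chi> j. - 1 :: real ^ 'n) \<bullet> b \<le> (\<chi> j. 1) \<bullet> b" by (auto dest!: inner_Basis_cart simp: inner_axis)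
  then have "emeasure lborel (cube :: (real ^ 'n) set) = ennreal (\<Prod>b\<in>Basis. ((\<chi> j. 1) - (\<chi> j. - 1) :: real ^ 'n) \<bullet> b)"
    unfolding cube_eq_cbox by (simp add: emeasure_lborel_cbox_eq)
  also have "(\<Prod>b\<in>Basis. ((\<chi> j. 1) - (\<chi> j. - 1) :: real ^ 'n) \<bullet> b) = 2 ^ CARD('n)"
    using prod_Basis_cart[of "\<lambda>x. x" "(\<chi> j. 1) - (\<chi> j. - 1) :: real ^ 'n"] by simp
  finally show ?thesis .
qed

context solid_body
begin

lemma polys_mult_cube_factor:
  assumes P: "P \<in> polys a V" and a: "0 \<le> a" and e: "0 < e" "2 * real N \<le> e * r"
  shows "(\<lambda>x. P x * of_real (\<Prod>j\<in>UNIV. (1 - (x $ j)\<^sup>2) ^ N)) \<in> polys (a + e) V"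
proof -
  obtain c where c: "P = (\<lambda>x. \<Sum>k \<in> lattice_points (scaled a V). c k * (\<Prod>j\<in>UNIV. complex_of_real (x $ j) ^ (k $ j)))"
    using P unfolding polys_def by blast
  define Q :: "nat \<Rightarrow> complex poly" where "Q k = monom 1 k * [:1, 0, - 1:] ^ N" for k
  have Q: "poly (Q k) z = z ^ k * (1 - z\<^sup>2) ^ N" for k z
    by (simp add: Q_def poly_monom poly_power power2_eq_square)
  have dQ: "degree (Q k) \<le> k + 2 * N" for k
  proof -
    have "degree ([:1, 0, - 1:] ^ N :: complex poly) \<le> 2 * N" using degree_power_le[of "[:1, 0, - 1:] :: complex poly" N] by simp
    then show ?thesis unfolding Q_def using degree_mult_le[of "monom 1 k :: complex poly" "[:1, 0, - 1:] ^ N"] degree_monom_le[of "1 :: complex" k] by linarith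
  qed
  have eq: "(\<lambda>x. P x * of_real (\<Prod>j\<in>UNIV. (1 - (x $ j)\<^sup>2) ^ N)) =
    (\<lambda>x. \<Sum>k \<in> lattice_points (scaled a V). c k * (\<Prod>j\<in>UNIV. poly (Q (k $ j)) (complex_of_real (x $ j))))"
    unfolding c Q by (simp add: sum_distrib_right prod.distrib mult.assoc)
  show ?thesis unfolding eq
  proof (intro polys_sum polys_cmult)
    fix k assume "k \<in> lattice_points (scaled a V)"
    then have k: "(\<chi> j. real (k $ j)) \<in> scaled a V" by (simp add: lattice_points_def)
    have "(\<chi> j. 2 * real N) \<in> scaled e V" using e by (intro scaled_cube) auto
    from scaled_sum[OF a less_imp_le[OF e(1)] k this]
    have m: "(\<chi> j. real (k $ j)) + (\<chi> j. 2 * real N) \<in> scaled (a + e) V" .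
    show "(\<lambda>x. \<Prod>j\<in>UNIV. poly (Q (k $ j)) (complex_of_real (x $ j))) \<in> polys (a + e) V"
    proof (rule prod_poly_in_polys[OF _ m])
      fix j
      have "real (degree (Q (k $ j))) \<le> real (k $ j + 2 * N)" using dQ[of "k $ j"] by (rule of_nat_mono)
      then show "real (degree (Q (k $ j))) \<le> \<bar>((\<chi> j. real (k $ j)) + (\<chi> j. 2 * real N)) $ j\<bar>" by simp
    qed (use a e in auto)
  qed
qed

lemma ennreal_le_scaled_quotient:
  assumes "0 < A" "0 \<le> y" "K * y \<le> x" "0 < x" "L \<le> ennreal (A * y)" "0 \<le> K"
  shows "ennreal K \<le> ennreal A * (ennreal x / L)"
proof (cases "L = 0")
  case True
  then have "ennreal x / L = top" using assms by (simp add: ennreal_divide_eq_top_iff)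
  then show ?thesis using assms by (simp add: ennreal_mult_top)
next
  case False
  have "L < top" using assms(5) by (rule order_le_less_trans) simp
  then obtain l where l: "L = ennreal l" "0 \<le> l" by (cases L) auto
  then have l0: "0 < l" using False by (auto simp: less_le)
  have "l \<le> A * y" using assms l by (simp add: ennreal_le_iff)
  then have "K * l \<le> K * (A * y)" using assms by (intro mult_left_mono)
  also have "\<dots> = A * (K * y)" by simp
  also have "\<dots> \<le> A * x" using assms by (intro mult_left_mono) auto
  finally have "K \<le> A * (x / l)" using l0 by (simp add: field_simps)
  then show ?thesis unfolding l using l0 assms by (simp add: divide_ennreal ennreal_mult[symmetric] ennreal_leI)
qed

text \<open>A function \<open>f\<close> in the space is bounded, so it has polynomial approximants \<open>P\<close> to \<open>f(\<sigma> a t)\<close> on the cube with an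
  exponentially small error.  The competitor is \<open>P(t) \<Prod>\<^sub>j (1 - t\<^sub>j\<^sup>2)\<^sup>N\<close>: its exponents lie in \<open>a V\<close> for large \<open>a\<close> because
  \<open>\<tau> < 1\<close>, its value at the origin is close to \<open>f(0)\<close>, and its norm is close to that of \<open>f(\<sigma> a t)\<close> with the power
  weight, that is, to \<open>(\<sigma> a)\<^bsup>-q/p\<^esup>\<close> times the norm of \<open>f\<close>.\<close>
theorem lower_estimate:
  fixes \<alpha> \<beta> :: "'n \<Rightarrow> real"
  defines "q \<equiv> homogeneity \<alpha>"
  assumes p: "0 < p" and \<alpha>: "\<And>j. 0 \<le> \<alpha> j" and \<beta>: "\<And>j. - 1 / 2 \<le> \<beta> j"
    and \<phi>: "\<phi> \<in> exp_type V" and f: "\<And>x. f x = \<phi> (cx x)"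
    and I: "power_integral p \<alpha> f = ennreal I" "0 \<le> I"
    and K: "0 \<le> K" "K * I powr (1 / p) < cmod (f 0)"
  shows "\<forall>\<^sub>F a in at_top. ennreal K \<le> ennreal (a powr (- q / p)) * N0 (polys a V) p (jacobi_weight \<alpha> \<beta>) cube"
proof -
  define d where "d = CARD('n)"
  obtain M where M: "\<And>x. cmod (\<phi> (cx x)) \<le> M"
    using bounded_of_finite_norm[where \<alpha> = \<alpha>, OF \<phi> p \<alpha>] I(1) unfolding f by auto
  have ent: "entire \<phi>" using \<phi> by (simp add: exp_type_def)
  have q0: "0 < q" unfolding q_def using \<alpha> by (intro add_pos_nonneg sum_nonneg) auto
  \<comment> \<open>A small \<open>\<eta>\<close> absorbs both the loss in \<open>powr_add_le\<close> and the dilation by \<open>\<sigma> = 1 - \<eta>\<close>.\<close>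
  have "((\<lambda>\<eta>. K * ((1 + \<eta>) * (1 - \<eta>) powr (- q / p) * I powr (1 / p))) \<longlongrightarrow> K * ((1 + 0) * (1 - 0) powr (- q / p) * I powr (1 / p))) (at_right 0)"
    by (intro tendsto_intros) auto
  then have "((\<lambda>\<eta>. K * ((1 + \<eta>) * (1 - \<eta>) powr (- q / p) * I powr (1 / p))) \<longlongrightarrow> K * I powr (1 / p)) (at_right 0)" by simp
  from order_tendstoD(2)[OF this K(2)]
  have "\<forall>\<^sub>F \<eta> in at_right 0. K * ((1 + \<eta>) * (1 - \<eta>) powr (- q / p) * I powr (1 / p)) < cmod (f 0) \<and> 0 < \<eta> \<and> \<eta> < 1"
    using eventually_at_right_real[OF zero_less_one] by eventually_elim auto
  from eventually_happens'[OF _ this] obtain \<eta> where \<eta>: "0 < \<eta>" "\<eta> < 1" "K * ((1 + \<eta>) * (1 - \<eta>) powr (- q / p) * I powr (1 / p)) < cmod (f 0)"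
    by auto
  define \<sigma> where "\<sigma> = 1 - \<eta>"
  define \<tau> where "\<tau> = 1 - \<eta> / 2"
  have \<sigma>: "0 < \<sigma>" "\<sigma> < \<tau>" "\<tau> < 1" using \<eta> by (auto simp: \<sigma>_def \<tau>_def)
  obtain c C where c: "0 < c" "0 \<le> C" and apx: "\<And>a. 1 \<le> a \<Longrightarrow> \<exists>P\<in>polys (\<tau> * a) V. \<forall>x\<in>cube.
    cmod (P x - \<phi> (cx ((\<sigma> * a) *\<^sub>R x))) \<le> C * a ^ (2 * CARD('n)) * exp (- c * a)"
    using polynomial_approximation[OF \<phi> M \<sigma>(1,2)] by blast
  define err where "err a = C * a ^ (2 * d) * exp (- c * a)" for a
  obtain N :: nat where N: "1 / p < real N" using reals_Archimedean2 by blast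
  have N0: "0 < N" using N p by (cases N) auto
  have Nb: "0 \<le> real N * p + \<beta> j" for j using N \<beta>[of j] p by (simp add: field_simps)
  \<comment> \<open>Up to the factor \<open>a\<^bsup>-q\<^esup>\<close>, the bound for the \<open>p\<close>-th power of the norm of the competitor.\<close>
  define Y where "Y a = (1 + \<eta>) powr p * (\<sigma> powr - q * I) + (1 + 1 / \<eta>) powr p * 2 ^ d * (a powr q * err a powr p)" for a
  have err_lim: "(err \<longlongrightarrow> 0) at_top" unfolding err_def using c(1) by real_asymp
  have "((\<lambda>a. a powr q * err a powr p) \<longlongrightarrow> 0) at_top"
  proof -
    have "((\<lambda>a. C powr p * (a powr q * (a ^ (2 * d) * exp (- c * a)) powr p)) \<longlongrightarrow> C powr p * 0) at_top"
    proof (intro tendsto_intros)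
      define b e where "b = c * p" and "e = q + real (2 * d) * p"
      have "0 < b" using c p by (simp add: b_def)
      then have "((\<lambda>a::real. a powr e * exp (- b * a)) \<longlongrightarrow> 0) at_top" by real_asymp
      then have "((\<lambda>a::real. a powr (q + real (2 * d) * p) * exp (- (c * p) * a)) \<longlongrightarrow> 0) at_top" unfolding b_def e_def .
      moreover have "\<forall>\<^sub>F a in at_top. a powr (q + real (2 * d) * p) * exp (- (c * p) * a) = a powr q * (a ^ (2 * d) * exp (- c * a)) powr p"
        using eventually_gt_at_top[of 0]
      proof eventually_elim
        fix a :: real assume a: "0 < a"
        then have "(a ^ (2 * d) * exp (- c * a)) powr p = a powr (real (2 * d) * p) * exp (- (c * p) * a)"
          by (simp add: powr_mult powr_realpow[symmetric] powr_powr exp_powr_real mult_ac)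
        then show "a powr (q + real (2 * d) * p) * exp (- (c * p) * a) = a powr q * (a ^ (2 * d) * exp (- c * a)) powr p"
          by (simp add: powr_add)
      qed
      ultimately show "((\<lambda>a. a powr q * (a ^ (2 * d) * exp (- c * a)) powr p) \<longlongrightarrow> 0) at_top" by (rule Lim_transform_eventually)
    qed
    then show ?thesis unfolding err_def using c(2) by (simp add: powr_mult mult_ac)
  qed
  then have "(Y \<longlongrightarrow> (1 + \<eta>) powr p * (\<sigma> powr - q * I) + (1 + 1 / \<eta>) powr p * 2 ^ d * 0) at_top"
    unfolding Y_def by (intro tendsto_intros)
  then have Ylim: "(Y \<longlongrightarrow> (1 + \<eta>) powr p * (\<sigma> powr - q * I)) at_top" by simp
  have Y0: "0 \<le> Y a" for a unfolding Y_def using I(2) by simp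
  have "((\<lambda>a. K * Y a powr (1 / p) + err a) \<longlongrightarrow> K * ((1 + \<eta>) powr p * (\<sigma> powr - q * I)) powr (1 / p) + 0) at_top"
    using p Y0 by (intro tendsto_add tendsto_mult tendsto_const err_lim tendsto_powr'[OF Ylim]) auto
  moreover have "((1 + \<eta>) powr p * (\<sigma> powr - q * I)) powr (1 / p) = (1 + \<eta>) * (1 - \<eta>) powr (- q / p) * I powr (1 / p)"
    using \<eta> \<sigma> p I(2) by (simp add: powr_mult powr_powr \<sigma>_def)
  ultimately have "((\<lambda>a. K * Y a powr (1 / p) + err a) \<longlongrightarrow> K * ((1 + \<eta>) * (1 - \<eta>) powr (- q / p) * I powr (1 / p))) at_top" by simp
  from order_tendstoD(2)[OF this \<eta>(3)] have ev1: "\<forall>\<^sub>F a in at_top. K * Y a powr (1 / p) + err a < cmod (f 0)" .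
  have "0 \<le> K * I powr (1 / p)" using K by simp
  then have "0 < cmod (f 0)" using K(2) by linarith
  from order_tendstoD(2)[OF err_lim this] have ev2: "\<forall>\<^sub>F a in at_top. err a < cmod (f 0)" .
  show ?thesis
    using ev1 ev2 eventually_ge_at_top[of 1] eventually_ge_at_top[of "2 * real N / ((1 - \<tau>) * r)"]
  proof eventually_elim
    fix a :: real assume a1: "K * Y a powr (1 / p) + err a < cmod (f 0)" "err a < cmod (f 0)" "1 \<le> a" "2 * real N / ((1 - \<tau>) * r) \<le> a"
    obtain P where P: "P \<in> polys (\<tau> * a) V" "\<And>x. x \<in> cube \<Longrightarrow> cmod (P x - \<phi> (cx ((\<sigma> * a) *\<^sub>R x))) \<le> err a"
      using apx[OF a1(3)] unfolding err_def d_def by blast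
    define h where "h x = P x * of_real (\<Prod>j\<in>UNIV. (1 - (x $ j)\<^sup>2) ^ N)" for x
    have "2 * real N \<le> (1 - \<tau>) * a * r" using a1(4) \<sigma> r_pos by (simp add: pos_divide_le_eq mult_ac)
    then have "(\<lambda>x. P x * of_real (\<Prod>j\<in>UNIV. (1 - (x $ j)\<^sup>2) ^ N)) \<in> polys (\<tau> * a + (1 - \<tau>) * a) V"
      using \<sigma> a1(3) by (intro polys_mult_cube_factor P) auto
    moreover have "\<tau> * a + (1 - \<tau>) * a = a" by (simp add: algebra_simps)
    ultimately have hp: "h \<in> polys a V" unfolding h_def by simp
    have z: "0 \<in> cube" by (simp add: cube_def)
    have h0: "cmod (f 0) - err a \<le> cmod (h 0)"
    proof -
      have "cmod (P 0 - f 0) \<le> err a" using P(2)[OF z] by (simp add: f)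
      then show ?thesis using norm_triangle_ineq2[of "f 0" "P 0"] by (simp add: h_def norm_minus_commute)
    qed
    define b where "b = \<sigma> * a"
    have b: "0 < b" using \<sigma> a1 by (simp add: b_def)
    have err0: "0 \<le> err a" unfolding err_def using c a1(3) by simp
    have fm [measurable]: "f \<in> borel_measurable borel"
    proof -
      have "continuous_on UNIV f" unfolding f[abs_def]
        by (rule entire_continuous_real[OF ent])
      then show ?thesis by (rule borel_measurable_continuous_onI)
    qed
    have cm [measurable]: "cube \<in> sets (borel :: (real ^ 'n) measure)" using closed_cube by (rule borel_closed)
    have pt: "ennreal (cmod (h t) powr p) * jacobi_weight \<alpha> \<beta> t * indicator cube t \<le>
      ennreal ((1 + \<eta>) powr p * b powr - (\<Sum>j\<in>UNIV. \<alpha> j)) * (ennreal (cmod (f (b *\<^sub>R t)) powr p) * power_weight \<alpha> (b *\<^sub>R t)) +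
      ennreal ((1 + 1 / \<eta>) powr p * err a powr p) * indicator cube t" for t
    proof (cases "t \<in> cube")
      case True
      then have t1: "\<bar>t $ j\<bar> \<le> 1" for j by (simp add: cube_def)
      have D0: "0 \<le> (\<Prod>j\<in>UNIV. (1 - (t $ j)\<^sup>2) ^ N)" using t1 by (intro prod_nonneg) (auto simp: abs_square_le_1)
      have "ennreal (cmod (h t) powr p) * jacobi_weight \<alpha> \<beta> t = ennreal (cmod (P t) powr p) * (ennreal ((\<Prod>j\<in>UNIV. (1 - (t $ j)\<^sup>2) ^ N) powr p) * jacobi_weight \<alpha> \<beta> t)"
        unfolding h_def norm_mult norm_of_real abs_of_nonneg[OF D0] using D0 by (simp add: powr_mult ennreal_mult mult.assoc)
      also have "\<dots> \<le> ennreal (cmod (P t) powr p) * power_weight \<alpha> t"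
        by (intro mult_left_mono jacobi_weight_damped_le[OF t1 N0 p Nb]) auto
      also have "\<dots> \<le> ennreal ((1 + \<eta>) powr p * cmod (f (b *\<^sub>R t)) powr p + (1 + 1 / \<eta>) powr p * err a powr p) * power_weight \<alpha> t"
      proof (intro mult_right_mono ennreal_leI)
        have "cmod (P t) \<le> cmod (f (b *\<^sub>R t)) + err a"
          using P(2)[OF True] norm_triangle_ineq2[of "P t" "f (b *\<^sub>R t)"] unfolding f b_def by linarith
        then have "cmod (P t) powr p \<le> (cmod (f (b *\<^sub>R t)) + err a) powr p" using p by (intro powr_mono2) auto
        also have "\<dots> \<le> (1 + \<eta>) powr p * cmod (f (b *\<^sub>R t)) powr p + (1 + 1 / \<eta>) powr p * err a powr p"
          using \<eta> p err0 by (intro powr_add_le) auto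
        finally show "cmod (P t) powr p \<le> (1 + \<eta>) powr p * cmod (f (b *\<^sub>R t)) powr p + (1 + 1 / \<eta>) powr p * err a powr p" .
      qed auto
      also have "\<dots> = ennreal ((1 + \<eta>) powr p) * (ennreal (cmod (f (b *\<^sub>R t)) powr p) * power_weight \<alpha> t) + ennreal ((1 + 1 / \<eta>) powr p * err a powr p) * power_weight \<alpha> t"
        by (simp add: ennreal_plus ennreal_mult distrib_right mult.assoc)
      also have "\<dots> \<le> ennreal ((1 + \<eta>) powr p * b powr - (\<Sum>j\<in>UNIV. \<alpha> j)) * (ennreal (cmod (f (b *\<^sub>R t)) powr p) * power_weight \<alpha> (b *\<^sub>R t)) + ennreal ((1 + 1 / \<eta>) powr p * err a powr p) * 1"
      proof (rule add_mono)
        show "ennreal ((1 + 1 / \<eta>) powr p * err a powr p) * power_weight \<alpha> t \<le> ennreal ((1 + 1 / \<eta>) powr p * err a powr p) * 1"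
          using power_weight_le_1[OF \<alpha> t1] by (intro mult_left_mono) auto
        have e1: "ennreal (b powr - (\<Sum>j\<in>UNIV. \<alpha> j)) * ennreal (b powr (\<Sum>j\<in>UNIV. \<alpha> j)) = 1"
          using b by (simp add: ennreal_mult[symmetric] powr_add[symmetric])
        have "ennreal ((1 + \<eta>) powr p * b powr - (\<Sum>j\<in>UNIV. \<alpha> j)) * (ennreal (cmod (f (b *\<^sub>R t)) powr p) * power_weight \<alpha> (b *\<^sub>R t))
          = ennreal ((1 + \<eta>) powr p) * (ennreal (cmod (f (b *\<^sub>R t)) powr p) * ((ennreal (b powr - (\<Sum>j\<in>UNIV. \<alpha> j)) * ennreal (b powr (\<Sum>j\<in>UNIV. \<alpha> j))) * power_weight \<alpha> t))"
          unfolding power_weight_scale[OF \<alpha> b] by (simp add: ennreal_mult mult_ac)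
        then show "ennreal ((1 + \<eta>) powr p) * (ennreal (cmod (f (b *\<^sub>R t)) powr p) * power_weight \<alpha> t) \<le> ennreal ((1 + \<eta>) powr p * b powr - (\<Sum>j\<in>UNIV. \<alpha> j)) * (ennreal (cmod (f (b *\<^sub>R t)) powr p) * power_weight \<alpha> (b *\<^sub>R t))"
          unfolding e1 by simp
      qed
      finally show ?thesis using True by simp
    qed simp
    have "jacobi_integral p \<alpha> \<beta> h \<le>
      (\<integral>\<^sup>+ t. ennreal ((1 + \<eta>) powr p * b powr - (\<Sum>j\<in>UNIV. \<alpha> j)) * (ennreal (cmod (f (b *\<^sub>R t)) powr p) * power_weight \<alpha> (b *\<^sub>R t)) +
      ennreal ((1 + 1 / \<eta>) powr p * err a powr p) * indicator cube t \<partial>lborel)" by (intro nn_integral_mono pt)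
    also have "\<dots> = ennreal ((1 + \<eta>) powr p * b powr - (\<Sum>j\<in>UNIV. \<alpha> j)) * (\<integral>\<^sup>+ t. ennreal (cmod (f (b *\<^sub>R t)) powr p) * power_weight \<alpha> (b *\<^sub>R t) \<partial>lborel) +
      ennreal ((1 + 1 / \<eta>) powr p * err a powr p) * emeasure lborel (cube :: (real ^ 'n) set)"
      by (subst nn_integral_add) (auto simp: nn_integral_cmult nn_integral_cmult_indicator)
    also have "(\<integral>\<^sup>+ t. ennreal (cmod (f (b *\<^sub>R t)) powr p) * power_weight \<alpha> (b *\<^sub>R t) \<partial>lborel) = ennreal ((1 / b) ^ d) * ennreal I"
    proof -
      define F where "F x = ennreal (cmod (f x) powr p) * power_weight \<alpha> x" for x
      have [measurable]: "F \<in> borel_measurable borel" unfolding F_def by measurable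
      show ?thesis using nn_integral_scale[of F "1 / b"] b I(1) unfolding F_def d_def by simp
    qed
    also have "ennreal ((1 + \<eta>) powr p * b powr - (\<Sum>j\<in>UNIV. \<alpha> j)) * (ennreal ((1 / b) ^ d) * ennreal I) +
      ennreal ((1 + 1 / \<eta>) powr p * err a powr p) * emeasure lborel (cube :: (real ^ 'n) set) = ennreal (a powr - q * Y a)"
    proof -
      have e1: "b powr - (\<Sum>j\<in>UNIV. \<alpha> j) * (1 / b) ^ d = a powr - q * \<sigma> powr - q"
      proof -
        have "(1 / b) ^ d = b powr - real d" using b by (simp add: powr_minus powr_realpow power_one_over inverse_eq_divide)
        then have "b powr - (\<Sum>j\<in>UNIV. \<alpha> j) * (1 / b) ^ d = b powr (- (\<Sum>j\<in>UNIV. \<alpha> j) + - real d)" by (simp only: powr_add)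
        also have "- (\<Sum>j\<in>UNIV. \<alpha> j) + - real d = - q" by (simp add: q_def d_def)
        also have "b powr - q = a powr - q * \<sigma> powr - q" using \<sigma> a1(3) by (simp add: b_def powr_mult mult.commute)
        finally show ?thesis .
      qed
      have e2: "a powr - q * a powr q = 1" using a1(3) by (simp add: powr_add[symmetric])
      have "(1 + \<eta>) powr p * b powr - (\<Sum>j\<in>UNIV. \<alpha> j) * ((1 / b) ^ d * I) + (1 + 1 / \<eta>) powr p * err a powr p * 2 ^ d
        = (1 + \<eta>) powr p * ((b powr - (\<Sum>j\<in>UNIV. \<alpha> j) * (1 / b) ^ d) * I) + (a powr - q * a powr q) * ((1 + 1 / \<eta>) powr p * err a powr p * 2 ^ d)"
        unfolding e2 by simp
      also have "\<dots> = a powr - q * Y a" unfolding e1 Y_def by (simp add: algebra_simps)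
      finally have "(1 + \<eta>) powr p * b powr - (\<Sum>j\<in>UNIV. \<alpha> j) * ((1 / b) ^ d * I) + (1 + 1 / \<eta>) powr p * err a powr p * 2 ^ d = a powr - q * Y a" .
      then show ?thesis unfolding emeasure_cube d_def[symmetric] using b I(2)
        by (simp add: ennreal_mult[symmetric] ennreal_plus[symmetric] del: ennreal_plus)
    qed
    finally have hI: "jacobi_integral p \<alpha> \<beta> h \<le> ennreal (a powr - q * Y a)" .
    have "Lnorm p (jacobi_weight \<alpha> \<beta>) cube h \<le> ennreal ((a powr - q * Y a) powr (1 / p))"
    proof (rule Lnorm_le[OF p _ _ hI])
      show "(cube :: (real ^ 'n) set) \<in> sets lebesgue" by (rule sets_completionI_sets) (use cm in simp)
      show "0 \<le> a powr - q * Y a" using Y0 by simp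
    qed
    also have "(a powr - q * Y a) powr (1 / p) = a powr (- q / p) * Y a powr (1 / p)" using Y0 by (simp add: powr_mult powr_powr)
    finally have hL: "Lnorm p (jacobi_weight \<alpha> \<beta>) cube h \<le> ennreal (a powr (- q / p) * Y a powr (1 / p))" .
    have hpos: "0 < cmod (h 0)" using h0 a1(2) by linarith
    have "ennreal K \<le> ennreal (a powr (- q / p)) * (ennreal (cmod (h 0)) / Lnorm p (jacobi_weight \<alpha> \<beta>) cube h)"
      using hL hpos h0 a1 K(1) by (intro ennreal_le_scaled_quotient[where y = "Y a powr (1 / p)"]) auto
    also have "\<dots> \<le> ennreal (a powr (- q / p)) * N0 (polys a V) p (jacobi_weight \<alpha> \<beta>) cube"
      unfolding N0_def using hp z hpos by (intro mult_left_mono SUP_upper) auto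
    finally show "ennreal K \<le> ennreal (a powr (- q / p)) * N0 (polys a V) p (jacobi_weight \<alpha> \<beta>) cube" .
  qed
qed

end

section \<open>A nonzero function in the space\<close>

text \<open>The entire function \<open>sin z / z\<close>.\<close>
definition csinc :: "complex \<Rightarrow> complex" where
  "csinc z = (if z = 0 then 1 else sin z / z)"

lemma csinc_holomorphic: "csinc holomorphic_on UNIV"
proof (rule pole_theorem_0[where g = sin and a = 0])
  show "csinc 0 = deriv sin 0" by (simp add: csinc_def DERIV_imp_deriv[OF DERIV_sin])
qed (auto simp: csinc_def intro: holomorphic_intros)

lemma cmod_csinc_le: "cmod (csinc z) \<le> exp 2 * exp (cmod z)"
proof (cases "cmod z \<le> 1")
  case True
  have "cmod (csinc z) \<le> exp 2"
  proof (rule maximum_modulus_frontier[of csinc "cball 0 1"])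
    show "csinc holomorphic_on interior (cball 0 1)" "continuous_on (closure (cball 0 1)) csinc"
      using csinc_holomorphic by (auto intro: holomorphic_on_subset holomorphic_on_imp_continuous_on)
    fix w :: complex assume "w \<in> frontier (cball 0 1)"
    then have w: "cmod w = 1" by (simp add: frontier_cball)
    then have "cmod (csinc w) = cmod (sin w)" by (auto simp: csinc_def norm_divide)
    also have "\<dots> \<le> cosh (Im w)" by (rule norm_sin_le_cosh)
    also have "\<dots> \<le> 1 + (1::real)\<^sup>2"
    proof -
      have "cosh \<bar>Im w\<bar> \<le> cosh 1" using abs_Im_le_cmod[of w] w by (subst cosh_real_nonneg_le_iff) auto
      then show ?thesis using cosh_le[of 1] by simp
    qed
    also have "\<dots> \<le> exp 2" using exp_ge_add_one_self[of "2::real"] by simp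
    finally show "cmod (csinc w) \<le> exp 2" .
  qed (use True in auto)
  also have "\<dots> \<le> exp 2 * exp (cmod z)" by simp
  finally show ?thesis .
next
  case False
  then have "cmod (csinc z) = cmod (sin z) / cmod z" by (auto simp: csinc_def norm_divide)
  also have "\<dots> \<le> cmod (sin z) / 1" using False by (intro divide_left_mono) auto
  also have "\<dots> \<le> cosh (Im z)" using norm_sin_le_cosh[of z] by simp
  also have "\<dots> \<le> 1 * exp \<bar>Im z\<bar>"
  proof -
    have "cosh \<bar>Im z\<bar> \<le> exp \<bar>Im z\<bar>" by (simp add: cosh_field_def)
    then show ?thesis by simp
  qed
  also have "\<dots> \<le> exp 2 * exp (cmod z)" using abs_Im_le_cmod[of z] by (intro mult_mono) auto
  finally show ?thesis .
qed

lemma cmod_csinc_real_le: "cmod (csinc (of_real t)) \<le> 1" "t \<noteq> 0 \<Longrightarrow> cmod (csinc (of_real t)) \<le> 1 / \<bar>t\<bar>"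
proof -
  have e: "t \<noteq> 0 \<Longrightarrow> cmod (csinc (of_real t)) = \<bar>sin t\<bar> / \<bar>t\<bar>"
    by (simp add: csinc_def sin_of_real norm_divide)
  show "t \<noteq> 0 \<Longrightarrow> cmod (csinc (of_real t)) \<le> 1 / \<bar>t\<bar>" unfolding e by (intro divide_right_mono) auto
  show "cmod (csinc (of_real t)) \<le> 1"
    using e abs_sin_x_le_abs_x[of t] by (cases "t = 0") (auto simp: csinc_def divide_le_eq_1_pos)
qed

lemma entire_prod_coordinates:
  fixes g :: "complex \<Rightarrow> complex"
  assumes g: "g holomorphic_on UNIV"
  shows "entire (\<lambda>z :: complex ^ 'n. \<Prod>j\<in>UNIV. g (z $ j))"
  unfolding entire_def
proof
  fix z :: "complex ^ 'n"
  have d: "((\<lambda>z. g (z $ j)) has_derivative (\<lambda>v. deriv g (z $ j) * v $ j)) (at z)" for j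
  proof -
    have "(g has_field_derivative deriv g (z $ j)) (at (z $ j))" using g by (rule holomorphic_derivI) auto
    from has_derivative_compose[OF bounded_linear_imp_has_derivative[OF bounded_linear_vec_nth] has_field_derivative_imp_has_derivative[OF this]]
    show ?thesis by (simp add: o_def)
  qed
  define D where "D v = (\<Sum>i\<in>UNIV. (deriv g (z $ i) * v $ i) * (\<Prod>j\<in>UNIV - {i}. g (z $ j)))" for v :: "complex ^ 'n"
  have "((\<lambda>z. \<Prod>j\<in>UNIV. g (z $ j)) has_derivative D) (at z)"
    unfolding D_def by (rule has_derivative_prod[OF d])
  moreover have "D (c *s v) = c * D v" for c v unfolding D_def by (simp add: sum_distrib_left mult_ac)
  ultimately show "\<exists>D. ((\<lambda>z. \<Prod>j\<in>UNIV. g (z $ j)) has_derivative D) (at z) \<and> (\<forall>c v. D (c *s v) = c * D v)" by blast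
qed

lemma nn_integral_prod_cart:
  fixes u :: "real \<Rightarrow> ennreal"
  assumes [measurable]: "u \<in> borel_measurable borel"
  shows "(\<integral>\<^sup>+ x. (\<Prod>j\<in>(UNIV :: 'n::finite set). u (x $ j)) \<partial>(lborel :: (real ^ 'n) measure)) = (\<integral>\<^sup>+ t. u t \<partial>lborel) ^ CARD('n)"
proof -
  have "(\<integral>\<^sup>+ x. (\<Prod>b\<in>Basis. u (x \<bullet> b)) \<partial>(lborel :: (real ^ 'n) measure)) = (\<Prod>b\<in>(Basis :: (real ^ 'n) set). \<integral>\<^sup>+ t. u t \<partial>lborel)"
    by (rule nn_integral_lborel_prod) auto
  then show ?thesis unfolding prod_Basis_cart by simp
qed

lemma nn_integral_inverse_one_plus_square_finite: "(\<integral>\<^sup>+ t. ennreal (c / (1 + t\<^sup>2)) \<partial>lborel) < \<infinity>"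
proof -
  define f where "f t = 1 / (1 + t\<^sup>2)" for t :: real
  have pos: "0 < 1 + t\<^sup>2" for t :: real by (simp add: add_pos_nonneg)
  have [measurable]: "f \<in> borel_measurable borel" unfolding f_def by measurable
  have half: "(\<integral>\<^sup>+ t. ennreal (f t) * indicator {0..} t \<partial>lborel) = ennreal (pi / 2 - arctan 0)"
  proof (rule nn_integral_FTC_atLeast)
    show "(arctan has_real_derivative f t) (at t)" for t unfolding f_def
      using DERIV_arctan[of t] by (simp add: inverse_eq_divide)
    show "0 \<le> f t" for t unfolding f_def using pos[of t] by simp
    show "(arctan \<longlongrightarrow> pi / 2) at_top" by (rule tendsto_arctan_at_top)
  qed simp
  have "(\<integral>\<^sup>+ t. ennreal (f t) \<partial>lborel) \<le> (\<integral>\<^sup>+ t. ennreal (f t) * indicator {0..} t + ennreal (f (- t)) * indicator {0..} (- t) \<partial>lborel)"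
  proof (rule nn_integral_mono)
    fix t
    show "ennreal (f t) \<le> ennreal (f t) * indicator {0..} t + ennreal (f (- t)) * indicator {0..} (- t)"
      by (cases "0 \<le> t") (auto simp: f_def)
  qed
  also have "\<dots> = (\<integral>\<^sup>+ t. ennreal (f t) * indicator {0..} t \<partial>lborel) + (\<integral>\<^sup>+ t. ennreal (f (- t)) * indicator {0..} (- t) \<partial>lborel)"
    by (rule nn_integral_add) measurable
  also have "(\<integral>\<^sup>+ t. ennreal (f (- t)) * indicator {0..} (- t) \<partial>lborel) = (\<integral>\<^sup>+ t. ennreal (f t) * indicator {0..} t \<partial>lborel)"
    using nn_integral_real_affine[of "\<lambda>t. ennreal (f t) * indicator {0..} t" "- 1" 0] by simp
  finally have fin: "(\<integral>\<^sup>+ t. ennreal (f t) \<partial>lborel) < \<infinity>" unfolding half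
    by (rule order_le_less_trans) (simp add: ennreal_add_less_top)
  have "(\<integral>\<^sup>+ t. ennreal (c / (1 + t\<^sup>2)) \<partial>lborel) \<le> (\<integral>\<^sup>+ t. ennreal \<bar>c\<bar> * ennreal (f t) \<partial>lborel)"
  proof (rule nn_integral_mono)
    fix t :: real
    have "c / (1 + t\<^sup>2) \<le> \<bar>c\<bar> / (1 + t\<^sup>2)" using pos[of t] by (intro divide_right_mono) auto
    then show "ennreal (c / (1 + t\<^sup>2)) \<le> ennreal \<bar>c\<bar> * ennreal (f t)"
      using pos[of t] by (simp add: f_def ennreal_mult[symmetric] ennreal_leI)
  qed
  also have "\<dots> = ennreal \<bar>c\<bar> * (\<integral>\<^sup>+ t. ennreal (f t) \<partial>lborel)" by (rule nn_integral_cmult) measurable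
  also have "\<dots> < \<infinity>" using fin by (simp add: ennreal_mult_less_top)
  finally show ?thesis .
qed

lemma csinc_power_weighted_le:
  assumes e: "0 < e" "e \<le> 1" and p: "0 < p" and \<alpha>: "0 \<le> \<alpha>" "\<alpha> + 2 \<le> real m * p"
  shows "ennreal (cmod (csinc (of_real (e * t)) ^ m) powr p) * epow \<bar>t\<bar> \<alpha> \<le> ennreal (2 * e powr - (real m * p) / (1 + t\<^sup>2))"
proof -
  have E: "1 \<le> e powr - (real m * p)"
  proof -
    have "e powr (real m * p) \<le> 1" using e \<alpha> by (intro powr_le1) auto
    then show ?thesis using e by (simp add: powr_minus one_le_inverse)
  qed
  have pos: "0 < 1 + t\<^sup>2" by (simp add: add_pos_nonneg)
  show ?thesis
  proof (cases "\<bar>t\<bar> \<le> 1")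
    case True
    have "cmod (csinc (of_real (e * t)) ^ m) powr p \<le> 1"
      using p cmod_csinc_real_le(1)[of "e * t"] by (intro powr_le1) (auto simp: norm_power power_le_one simp del: of_real_mult)
    then have 1: "ennreal (cmod (csinc (of_real (e * t)) ^ m) powr p) \<le> 1" by simp
    have 2: "epow \<bar>t\<bar> \<alpha> \<le> 1" using True \<alpha> powr_le1[of \<alpha> "\<bar>t\<bar>"] by (auto simp: epow_def)
    have "t\<^sup>2 \<le> 1" using True by (simp add: abs_square_le_1)
    then have "1 + t\<^sup>2 \<le> 2 * 1" by simp
    also have "\<dots> \<le> 2 * e powr - (real m * p)" using E by (intro mult_left_mono) auto
    finally have "1 \<le> 2 * e powr - (real m * p) / (1 + t\<^sup>2)" using pos by (simp add: le_divide_eq)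
    then have "1 \<le> ennreal (2 * e powr - (real m * p) / (1 + t\<^sup>2))" by simp
    then show ?thesis using mult_mono[OF 1 2] by (simp add: order_trans)
  next
    case False
    define x where "x = \<bar>t\<bar>"
    have x: "1 < x" using False by (simp add: x_def)
    have "cmod (csinc (of_real (e * t))) \<le> 1 / \<bar>e * t\<bar>" using cmod_csinc_real_le(2)[of "e * t"] e x by (auto simp: x_def)
    also have "\<bar>e * t\<bar> = e * x" using e by (simp add: x_def abs_mult)
    finally have "cmod (csinc (of_real (e * t)) ^ m) \<le> (1 / (e * x)) ^ m" unfolding norm_power by (intro power_mono) auto
    then have "cmod (csinc (of_real (e * t)) ^ m) powr p \<le> ((1 / (e * x)) ^ m) powr p" using p by (intro powr_mono2) auto
    also have "\<dots> = e powr - (real m * p) * x powr - (real m * p)"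
    proof -
      have "(1 / (e * x)) ^ m = (e * x) powr - real m" using e x by (simp add: powr_minus powr_realpow power_one_over inverse_eq_divide)
      then have "((1 / (e * x)) ^ m) powr p = (e * x) powr - (real m * p)" by (simp add: powr_powr)
      then show ?thesis using e x by (simp add: powr_mult)
    qed
    finally have "cmod (csinc (of_real (e * t)) ^ m) powr p * x powr \<alpha> \<le> e powr - (real m * p) * x powr - (real m * p) * x powr \<alpha>"
      by (intro mult_right_mono) auto
    also have "\<dots> = e powr - (real m * p) * x powr (\<alpha> - real m * p)" by (simp add: powr_diff powr_minus divide_inverse mult_ac)
    also have "\<dots> \<le> e powr - (real m * p) * x powr (- 2)" using x \<alpha> by (intro mult_left_mono powr_mono) auto
    also have "x powr (- 2) = 1 / t\<^sup>2" using x by (simp add: x_def powr_minus inverse_eq_divide)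
    also have "e powr - (real m * p) * (1 / t\<^sup>2) \<le> e powr - (real m * p) * (2 / (1 + t\<^sup>2))"
    proof (intro mult_left_mono)
      have "1 \<le> \<bar>t\<bar> ^ 2" using x unfolding x_def by (intro one_le_power) auto
      then have "1 \<le> t\<^sup>2" by simp
      moreover from this have "0 < t\<^sup>2" by linarith
      ultimately show "1 / t\<^sup>2 \<le> 2 / (1 + t\<^sup>2)" using pos by (simp only: pos_divide_le_eq pos_le_divide_eq times_divide_eq_left) simp
    qed simp
    finally have "cmod (csinc (of_real (e * t)) ^ m) powr p * x powr \<alpha> \<le> 2 * e powr - (real m * p) / (1 + t\<^sup>2)" by (simp add: mult_ac)
    moreover have "epow \<bar>t\<bar> \<alpha> = ennreal (x powr \<alpha>)" using x by (simp add: epow_def x_def)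
    ultimately show ?thesis by (simp add: ennreal_mult[symmetric] ennreal_leI)
  qed
qed

context solid_body
begin

text \<open>The space contains \<open>\<Prod>\<^sub>j (sin (\<epsilon> z\<^sub>j) / (\<epsilon> z\<^sub>j))\<^sup>m\<close>: a large power \<open>m\<close> gives enough decay for the weight, and a small
  \<open>\<epsilon>\<close> keeps the type within \<open>V\<close>.\<close>
lemma nontrivial_function:
  fixes \<alpha> :: "'n \<Rightarrow> real"
  assumes p: "0 < p" and \<alpha>: "\<And>j. 0 \<le> \<alpha> j"
  shows "\<exists>\<phi>\<in>exp_type V. \<phi> (cx 0) = 1 \<and> power_integral p \<alpha> (\<lambda>x. \<phi> (cx x)) < \<infinity>"
proof -
  obtain m :: nat where m: "(2 + (\<Sum>j\<in>UNIV. \<alpha> j)) / p < real m" using reals_Archimedean2 by blast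
  have m\<alpha>: "\<alpha> j + 2 \<le> real m * p" for j
  proof -
    have "2 + (\<Sum>j\<in>UNIV. \<alpha> j) \<le> real m * p" using m p by (simp add: pos_divide_less_eq less_imp_le)
    moreover have "\<alpha> j \<le> (\<Sum>j\<in>UNIV. \<alpha> j)" using \<alpha> by (intro member_le_sum) auto
    ultimately show ?thesis by linarith
  qed
  have m0: "0 < real m" using m\<alpha>[of undefined] \<alpha>[of undefined] p by (cases "m = 0") auto
  define e where "e = min 1 (r / (real m * real CARD('n)))"
  have e: "0 < e" "e \<le> 1" unfolding e_def using r_pos m0 by auto
  have em: "real m * e * real CARD('n) \<le> r"
  proof -
    have "e \<le> r / (real m * real CARD('n))" unfolding e_def by (rule min.cobounded2)
    then have "e * (real m * real CARD('n)) \<le> r" using m0 by (subst (asm) pos_le_divide_eq) auto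
    then show ?thesis by (simp only: mult_ac)
  qed
  define G where "G w = csinc (complex_of_real e * w) ^ m" for w
  define \<phi> where "\<phi> z = (\<Prod>j\<in>UNIV. G (z $ j))" for z :: "complex ^ 'n"
  have "(\<lambda>w. csinc (of_real e * w)) holomorphic_on UNIV"
    using holomorphic_on_compose[of "\<lambda>w. of_real e * w" UNIV csinc] holomorphic_on_subset[OF csinc_holomorphic]
    by (auto simp: o_def intro!: holomorphic_intros)
  then have holG: "G holomorphic_on UNIV" unfolding G_def by (intro holomorphic_on_power)
  have "\<phi> \<in> exp_type V" unfolding exp_type_def
  proof (intro CollectI conjI allI impI)
    show "entire \<phi>" unfolding \<phi>_def by (rule entire_prod_coordinates[OF holG])
    fix \<epsilon> :: real assume \<epsilon>: "0 < \<epsilon>"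
    define C :: real where "C = (exp 2 ^ m) ^ CARD('n)"
    have "cmod (\<phi> z) \<le> C * exp ((1 + \<epsilon>) * dn z)" for z
    proof -
      have "cmod (G w) \<le> exp 2 ^ m * exp (real m * e * cmod w)" for w
      proof -
        have "cmod (G w) \<le> (exp 2 * exp (cmod (of_real e * w))) ^ m" unfolding G_def norm_power by (intro power_mono cmod_csinc_le) auto
        also have "\<dots> = exp 2 ^ m * exp (real m * e * cmod w)" using e by (simp add: power_mult_distrib exp_of_nat_mult[symmetric] norm_mult mult_ac)
        finally show ?thesis .
      qed
      then have "cmod (\<phi> z) \<le> (\<Prod>j\<in>UNIV. exp 2 ^ m * exp (real m * e * cmod (z $ j)))"
        unfolding \<phi>_def prod_norm[symmetric] by (intro prod_mono) auto
      also have "\<dots> = C * exp (real m * e * (\<Sum>j\<in>UNIV. cmod (z $ j)))"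
        by (simp add: prod.distrib C_def exp_sum sum_distrib_left)
      also have "\<dots> \<le> C * exp ((1 + \<epsilon>) * dn z)"
      proof -
        have "(\<Sum>j\<in>UNIV. cmod (z $ j)) \<le> (\<Sum>j\<in>(UNIV :: 'n set). dn z / r)"
          using dn_lower[of z] r_pos by (intro sum_mono) (simp add: field_simps)
        then have "real m * e * (\<Sum>j\<in>UNIV. cmod (z $ j)) \<le> real m * e * (real CARD('n) * (dn z / r))"
          using e by (intro mult_left_mono) auto
        also have "\<dots> = (real m * e * real CARD('n)) * (dn z / r)" by simp
        also have "\<dots> \<le> r * (dn z / r)" using em dn_nonneg r_pos by (intro mult_right_mono) auto
        also have "\<dots> = 1 * dn z" using r_pos by simp
        also have "\<dots> \<le> (1 + \<epsilon>) * dn z" using \<epsilon> dn_nonneg by (intro mult_right_mono) auto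
        finally show ?thesis by (intro mult_left_mono) (auto simp: C_def)
      qed
      finally show ?thesis .
    qed
    then show "\<exists>C>0. \<forall>z. cmod (\<phi> z) \<le> C * exp ((1 + \<epsilon>) * dn z)" by (intro exI[of _ C]) (auto simp: C_def)
  qed
  moreover have "\<phi> (cx 0) = 1" by (simp add: \<phi>_def G_def csinc_def)
  moreover have "power_integral p \<alpha> (\<lambda>x. \<phi> (cx x)) < \<infinity>"
  proof -
    define u where "u t = ennreal (2 * e powr - (real m * p) / (1 + t\<^sup>2))" for t
    have um: "u \<in> borel_measurable borel" unfolding u_def by measurable
    have "power_integral p \<alpha> (\<lambda>x. \<phi> (cx x)) \<le> (\<integral>\<^sup>+ x. (\<Prod>j\<in>UNIV. u (x $ j)) \<partial>(lborel :: (real ^ 'n) measure))"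
    proof (rule nn_integral_mono)
      fix x :: "real ^ 'n"
      have "ennreal (cmod (\<phi> (cx x)) powr p) * power_weight \<alpha> x = (\<Prod>j\<in>UNIV. ennreal (cmod (csinc (of_real (e * x $ j)) ^ m) powr p) * epow \<bar>x $ j\<bar> (\<alpha> j))"
        unfolding \<phi>_def G_def prod_norm[symmetric] prod_powr_distrib power_weight_def by (simp add: prod_ennreal[symmetric] prod.distrib)
      also have "\<dots> \<le> (\<Prod>j\<in>UNIV. u (x $ j))" unfolding u_def
        by (intro prod_mono_ennreal csinc_power_weighted_le e p \<alpha> m\<alpha>)
      finally show "ennreal (cmod (\<phi> (cx x)) powr p) * power_weight \<alpha> x \<le> (\<Prod>j\<in>UNIV. u (x $ j))" .
    qed
    also have "\<dots> = (\<integral>\<^sup>+ t. u t \<partial>lborel) ^ CARD('n)" by (rule nn_integral_prod_cart[OF um])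
    also have "\<dots> < \<infinity>" using nn_integral_inverse_one_plus_square_finite[of "2 * e powr - (real m * p)"]
      unfolding u_def by (simp add: power_less_top_ennreal)
    finally show ?thesis .
  qed
  ultimately show ?thesis by blast
qed

end

section \<open>Existence of the limit and of an extremal function\<close>

lemma quotient_less_imp:
  assumes "0 \<le> x" "0 \<le> l" "0 \<le> A" "0 \<le> K" "ennreal K < ennreal A * (ennreal x / ennreal l)"
  shows "K * l < A * x"
proof (cases "l = 0")
  case True
  have "0 < A * x"
  proof (rule ccontr)
    assume "\<not> 0 < A * x"
    then have "A = 0 \<or> x = 0" using assms by (auto simp: less_le)
    then show False using assms(5) by auto
  qed
  then show ?thesis using True by simp
next
  case False
  then have "ennreal K < ennreal (A * (x / l))" using assms by (simp add: divide_ennreal ennreal_mult[symmetric])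
  then have "K < A * (x / l)" using assms by (simp add: ennreal_less_iff)
  then show ?thesis using False assms by (simp add: field_simps)
qed

context solid_body
begin

lemma BL_elim:
  assumes "f \<in> BL V p W"
  obtains \<phi> where "\<phi> \<in> exp_type V" "\<And>x. f x = \<phi> (cx x)" "Lnorm p W UNIV f < \<infinity>"
  using assms unfolding BL_def Lspace_def by (auto simp: real_restriction_eq)

lemma quotient_le_N0_BL:
  assumes "f \<in> BL V p W" "f 0 \<noteq> 0"
  shows "ennreal (cmod (f 0)) / Lnorm p W UNIV f \<le> N0 (BL V p W) p W UNIV"
  unfolding N0_def using assms by (intro SUP_upper) auto

text \<open>If the scaled suprema stay above \<open>c\<^sub>n\<close>, polynomials exceeding \<open>c\<^sub>n\<close> and normalised at the origin have rescaled
  integrals at most \<open>c\<^sub>n\<^bsup>-p\<^esup>\<close>, so \<open>limit_of_rescaled_polynomials\<close> applies to them.\<close>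
lemma limit_of_nearly_extremal_polynomials:
  fixes \<alpha> \<beta> :: "'n \<Rightarrow> real"
  defines "q \<equiv> homogeneity \<alpha>"
  assumes p: "0 < p" and \<alpha>: "\<And>j. 0 \<le> \<alpha> j"
    and a: "filterlim a at_top sequentially"
    and c: "\<And>n. 0 < c n" "(\<lambda>n. c n powr - p) \<longlonglongrightarrow> L"
    and less: "\<And>n. ennreal (c n) < ennreal (a n powr (- q / p)) * N0 (polys (a n) V) p (jacobi_weight \<alpha> \<beta>) cube"
  shows "\<exists>f \<in> BL V p (power_weight \<alpha>). f 0 = 1 \<and>
    power_integral p \<alpha> f \<le> ennreal L"
proof -
  obtain N :: nat where N: "(1 / 2 + (\<Sum>j\<in>UNIV. \<bar>\<beta> j\<bar>)) / p < real N" using reals_Archimedean2 by blast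
  have Np: "\<beta> j - real N * p \<le> - 1 / 2" for j
  proof -
    have "1 / 2 + (\<Sum>j\<in>UNIV. \<bar>\<beta> j\<bar>) \<le> real N * p" using N p by (simp add: pos_divide_less_eq less_imp_le)
    moreover have "\<bar>\<beta> j\<bar> \<le> (\<Sum>j\<in>UNIV. \<bar>\<beta> j\<bar>)" by (intro member_le_sum) auto
    ultimately show ?thesis by linarith
  qed
  have "0 \<le> (1 / 2 + (\<Sum>j\<in>UNIV. \<bar>\<beta> j\<bar>)) / p" using p by (intro divide_nonneg_pos add_nonneg_nonneg sum_nonneg) auto
  then have N0: "0 < N" using N by (cases N) auto
  have "\<forall>\<^sub>F n in sequentially. max 1 (2 * real N / r) \<le> a n" using a unfolding filterlim_at_top by blast
  then obtain n0 where n0: "\<And>n. n0 \<le> n \<Longrightarrow> max 1 (2 * real N / r) \<le> a n" unfolding eventually_sequentially by blast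
  define b where "b n = a (n + n0)" for n
  have b: "1 \<le> b n" "2 * real N / r \<le> b n" for n using n0[of "n + n0"] by (auto simp: b_def)
  have bl: "filterlim b at_top sequentially" unfolding b_def by (rule filterlim_compose[OF a filterlim_add_const_nat_at_top])
  have cub: "(cube :: (real ^ 'n) set) \<in> sets lebesgue"
    by (rule sets_completionI_sets) (use closed_cube in \<open>auto intro: borel_closed\<close>)
  have "\<forall>n. \<exists>P. P \<in> polys (b n) V \<and> P 0 = 1 \<and>
    jacobi_integral p \<alpha> \<beta> P \<le> ennreal (b n powr - q * c (n + n0) powr - p)"
  proof
    fix n
    have b0: "0 < b n" using b(1)[of n] by simp
    have c0: "0 < c (n + n0)" by (rule c)
    have "ennreal (c (n + n0)) < (SUP h \<in> {h \<in> polys (b n) V. \<exists>t\<in>cube. h t \<noteq> 0}.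
      ennreal (b n powr (- q / p)) * (ennreal (cmod (h 0)) / Lnorm p (jacobi_weight \<alpha> \<beta>) cube h))"
      using less[of "n + n0"] unfolding N0_def b_def by (simp add: SUP_mult_left_ennreal)
    then obtain h where h: "h \<in> polys (b n) V"
      "ennreal (c (n + n0)) < ennreal (b n powr (- q / p)) * (ennreal (cmod (h 0)) / Lnorm p (jacobi_weight \<alpha> \<beta>) cube h)"
      unfolding less_SUP_iff by auto
    have "Lnorm p (jacobi_weight \<alpha> \<beta>) cube h < \<infinity>"
    proof (rule ccontr)
      assume "\<not> Lnorm p (jacobi_weight \<alpha> \<beta>) cube h < \<infinity>"
      then have "Lnorm p (jacobi_weight \<alpha> \<beta>) cube h = top" by (simp add: less_top[symmetric])
      then show False using h(2) by simp
    qed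
    from Lnorm_finite_imp[OF cub this] obtain I where I: "0 \<le> I"
      "jacobi_integral p \<alpha> \<beta> h = ennreal I"
      "Lnorm p (jacobi_weight \<alpha> \<beta>) cube h = ennreal (I powr (1 / p))" by blast
    have lt: "c (n + n0) * I powr (1 / p) < b n powr (- q / p) * cmod (h 0)"
      using h(2) c0 unfolding I(3) by (intro quotient_less_imp) auto
    moreover have "0 \<le> c (n + n0) * I powr (1 / p)" using c0 by simp
    ultimately have "0 < b n powr (- q / p) * cmod (h 0)" by linarith
    then have h0: "0 < cmod (h 0)" by (simp add: zero_less_mult_iff)
    have "(c (n + n0) * I powr (1 / p)) powr p \<le> (b n powr (- q / p) * cmod (h 0)) powr p"
      using lt c0 p by (intro powr_mono2) auto
    then have "c (n + n0) powr p * I \<le> b n powr - q * cmod (h 0) powr p"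
      using c0 p I(1) b0 by (simp add: powr_mult powr_powr)
    then have Ile: "I / cmod (h 0) powr p \<le> b n powr - q * c (n + n0) powr - p"
    proof -
      have "I \<le> b n powr - q * cmod (h 0) powr p / c (n + n0) powr p"
        using \<open>c (n + n0) powr p * I \<le> b n powr - q * cmod (h 0) powr p\<close> c0 by (simp add: pos_le_divide_eq mult.commute)
      also have "\<dots> = b n powr - q * c (n + n0) powr - p * cmod (h 0) powr p"
        by (simp only: powr_minus divide_inverse mult_ac)
      finally show ?thesis using h0 by (simp add: pos_divide_le_eq)
    qed
    define P where "P x = (1 / h 0) * h x" for x
    have "ennreal (cmod (P t) powr p) = ennreal (1 / cmod (h 0) powr p) * ennreal (cmod (h t) powr p)" for t
      using h0 by (simp add: P_def norm_mult norm_divide powr_mult powr_divide ennreal_mult[symmetric])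
    then have "jacobi_integral p \<alpha> \<beta> P
      = (\<integral>\<^sup>+ t. ennreal (1 / cmod (h 0) powr p) * (ennreal (cmod (h t) powr p) * jacobi_weight \<alpha> \<beta> t * indicator cube t) \<partial>lborel)"
      by (simp add: mult.assoc)
    also have "\<dots> = ennreal (1 / cmod (h 0) powr p) * ennreal I"
    proof -
      have [measurable]: "h \<in> borel_measurable borel" by (rule polys_measurable[OF h(1)])
      have [measurable]: "cube \<in> sets (borel :: (real ^ 'n) measure)" using closed_cube by (rule borel_closed)
      show ?thesis unfolding I(2)[symmetric] by (rule nn_integral_cmult) measurable
    qed
    also have "\<dots> = ennreal (I / cmod (h 0) powr p)" using I(1) by (simp add: ennreal_mult[symmetric])
    also have "\<dots> \<le> ennreal (b n powr - q * c (n + n0) powr - p)" by (rule ennreal_leI[OF Ile])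
    finally have "jacobi_integral p \<alpha> \<beta> P \<le> ennreal (b n powr - q * c (n + n0) powr - p)" .
    moreover have "P \<in> polys (b n) V" unfolding P_def by (rule polys_cmult[OF h(1)])
    moreover have "P 0 = 1" using h0 by (auto simp: P_def)
    ultimately show "\<exists>P. P \<in> polys (b n) V \<and> P 0 = 1 \<and>
      jacobi_integral p \<alpha> \<beta> P \<le> ennreal (b n powr - q * c (n + n0) powr - p)" by blast
  qed
  from choice[OF this] obtain P where P: "\<And>n. P n \<in> polys (b n) V" "\<And>n. P n 0 = 1"
    "\<And>n. jacobi_integral p \<alpha> \<beta> (P n) \<le> ennreal (b n powr - q * c (n + n0) powr - p)" by blast
  have "(\<lambda>n. c (n + n0) powr - p) \<longlonglongrightarrow> L" using c(2) by (rule LIMSEQ_ignore_initial_segment)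
  then show ?thesis
    using limit_of_rescaled_polynomials[where \<alpha> = \<alpha> and \<beta> = \<beta> and p = p and N = N and a = b and P = P and J = "\<lambda>n. c (n + n0) powr - p" and L = L,
      OF p \<alpha> b bl N0 Np P(1,2) P(3)[unfolded q_def]] by simp
qed

text \<open>By continuity the function stays above one half near the origin.\<close>
lemma integral_pos_of_value_at_zero:
  fixes \<alpha> :: "'n \<Rightarrow> real"
  assumes p: "0 < p" and \<alpha>: "\<And>j. 0 \<le> \<alpha> j" and f: "f \<in> BL V p W" "f 0 = 1"
  shows "0 < power_integral p \<alpha> f"
proof -
  obtain \<phi> where \<phi>: "\<phi> \<in> exp_type V" "\<And>x. f x = \<phi> (cx x)" using BL_elim[OF f(1)] by blast
  have ent: "entire \<phi>" using \<phi>(1) by (simp add: exp_type_def)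
  have "continuous_on UNIV f" unfolding \<phi>(2)[abs_def]
    by (rule entire_continuous_real[OF ent])
  then have "isCont f 0" by (simp add: continuous_on_eq_continuous_at)
  then obtain e where e: "0 < e" "\<And>x. norm x < e \<Longrightarrow> cmod (f x - f 0) < 1 / 2"
    unfolding continuous_at_eps_delta dist_norm by (metis diff_zero half_gt_zero zero_less_one)
  define \<delta> where "\<delta> = e / (2 * real CARD('n))"
  have \<delta>: "0 < \<delta>" using e by (simp add: \<delta>_def)
  have "ennreal ((1 / 2) powr p * (\<delta> / 4) powr homogeneity \<alpha>) \<le>
    power_integral p \<alpha> f"
  proof (rule weighted_integral_ge_near_point[OF p \<alpha> \<delta> order_refl, where x = 0])
    fix y :: "real ^ 'n" assume y: "\<And>j. \<bar>y $ j\<bar> \<le> \<delta>"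
    have "norm y \<le> (\<Sum>j\<in>UNIV. \<bar>y $ j\<bar>)" by (rule norm_le_l1_cart)
    also have "\<dots> \<le> (\<Sum>j\<in>(UNIV :: 'n set). \<delta>)" using y by (intro sum_mono)
    also have "\<dots> < e" using e by (simp add: \<delta>_def)
    finally have "cmod (f y - 1) < 1 / 2" using e(2)[of y] f(2) by simp
    then show "1 / 2 \<le> cmod (f y)" using norm_triangle_ineq2[of 1 "f y"] by (simp add: norm_minus_commute)
  qed (use \<delta> in auto)
  moreover have "0 < ennreal ((1 / 2) powr p * (\<delta> / 4) powr homogeneity \<alpha>)" using \<delta> by simp
  ultimately show ?thesis by (rule less_le_trans[rotated])
qed

text \<open>By the lower estimate the lower limit of the scaled suprema \<open>M a\<close> is at least \<open>E\<close>, and limits of nearly extremal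
  polynomials show that the upper limit is at most \<open>E\<close>.  The same limit process, run with constants \<open>c\<^sub>n\<close> increasing to \<open>E\<close>, produces
  a function attaining \<open>E\<close>; run with constants tending to infinity, it shows that \<open>E\<close> is finite.\<close>
theorem limit_and_extremal_function:
  fixes \<alpha> \<beta> :: "'n \<Rightarrow> real" and p :: real
  defines "q \<equiv> homogeneity \<alpha>"
  defines "M \<equiv> \<lambda>a. ennreal (a powr (- q / p)) * N0 (polys a V) p (jacobi_weight \<alpha> \<beta>) cube"
  defines "E \<equiv> N0 (BL V p (power_weight \<alpha>)) p (power_weight \<alpha>) UNIV"
  assumes p: "0 < p" and \<alpha>: "\<And>j. 0 \<le> \<alpha> j" and \<beta>: "\<And>j. - 1 / 2 \<le> \<beta> j"
  shows "(M \<longlongrightarrow> E) at_top \<and> (\<exists>f\<^sub>0 \<in> BL V p (power_weight \<alpha>) - {\<lambda>_. 0}. (M \<longlongrightarrow> ennreal (cmod (f\<^sub>0 0)) / Lnorm p (power_weight \<alpha>) UNIV f\<^sub>0) at_top)"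
proof -
  have low: "\<forall>\<^sub>F a in at_top. ennreal K \<le> M a" if K: "0 \<le> K" "ennreal K < E" for K
  proof -
    obtain f where f: "f \<in> BL V p (power_weight \<alpha>)" "ennreal K < ennreal (cmod (f 0)) / Lnorm p (power_weight \<alpha>) UNIV f"
      using K(2) unfolding E_def N0_def less_SUP_iff by auto
    obtain \<phi> where \<phi>: "\<phi> \<in> exp_type V" "\<And>x. f x = \<phi> (cx x)" "Lnorm p (power_weight \<alpha>) UNIV f < \<infinity>" using BL_elim[OF f(1)] by blast
    obtain I where I: "0 \<le> I" "(\<integral>\<^sup>+ t. ennreal (cmod (f t) powr p) * power_weight \<alpha> t * indicator UNIV t \<partial>lborel) = ennreal I"
      "Lnorm p (power_weight \<alpha>) UNIV f = ennreal (I powr (1 / p))" using Lnorm_finite_imp[OF _ \<phi>(3)] by auto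
    have "K * I powr (1 / p) < 1 * cmod (f 0)"
      using f(2) K(1) unfolding I(3) by (intro quotient_less_imp) auto
    then show ?thesis unfolding M_def q_def using I(1,2) K(1)
      by (intro lower_estimate[OF p \<alpha> \<beta> \<phi>(1,2)]) auto
  qed
  have up: "\<exists>f \<in> BL V p (power_weight \<alpha>). f 0 = 1 \<and> power_integral p \<alpha> f \<le> ennreal L"
    if "filterlim a at_top sequentially" "\<And>n. 0 < c n" "(\<lambda>n. c n powr - p) \<longlonglongrightarrow> L" "\<And>n. ennreal (c n) < M (a n)" for a c L
    using limit_of_nearly_extremal_polynomials[where \<alpha> = \<alpha> and \<beta> = \<beta>, OF p \<alpha> that(1,2,3)] that(4) unfolding M_def q_def by blast
  have quot: "ennreal c \<le> ennreal (cmod (f 0)) / Lnorm p (power_weight \<alpha>) UNIV f"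
    if c: "0 < c" and f: "f \<in> BL V p (power_weight \<alpha>)" "f 0 = 1" "power_integral p \<alpha> f \<le> ennreal (c powr - p)" for c f
  proof -
    have "Lnorm p (power_weight \<alpha>) UNIV f \<le> ennreal ((c powr - p) powr (1 / p))" using f(3) by (intro Lnorm_le[OF p]) auto
    also have "(c powr - p) powr (1 / p) = c powr (- p * (1 / p))" by (rule powr_powr)
    also have "\<dots> = 1 * (1 / c)" using p c by (simp add: powr_minus inverse_eq_divide)
    finally have "ennreal c \<le> ennreal 1 * (ennreal 1 / Lnorm p (power_weight \<alpha>) UNIV f)"
      using c by (intro ennreal_le_scaled_quotient[where y = "1 / c"]) auto
    then show ?thesis using f(2) by simp
  qed
  \<comment> \<open>Otherwise constants tending to infinity would produce a function with value \<open>1\<close> at the origin and vanishing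
      integral.\<close>
  have "E \<noteq> \<infinity>"
  proof
    assume E: "E = \<infinity>"
    have "\<forall>n. \<exists>a. real n \<le> a \<and> ennreal (real n + 1) < M a"
    proof
      fix n
      have "\<forall>\<^sub>F a in at_top. ennreal (real n + 2) \<le> M a \<and> real n \<le> a"
        by (intro eventually_conj low eventually_ge_at_top) (auto simp: E)
      from eventually_happens'[OF _ this] obtain a where "ennreal (real n + 2) \<le> M a" "real n \<le> a" by auto
      moreover have "ennreal (real n + 1) < ennreal (real n + 2)" by (simp add: ennreal_less_iff)
      ultimately show "\<exists>a. real n \<le> a \<and> ennreal (real n + 1) < M a" by (meson less_le_trans)
    qed
    from choice[OF this] obtain a where a: "\<And>n. real n \<le> a n" "\<And>n. ennreal (real n + 1) < M (a n)" by blast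
    have al: "filterlim a at_top sequentially"
      by (rule filterlim_at_top_mono[OF filterlim_real_sequentially]) (simp add: a(1))
    have "(\<lambda>n. (real n + 1) powr - p) \<longlonglongrightarrow> 0" using p by real_asymp
    from up[OF al _ this a(2)] obtain f where f: "f \<in> BL V p (power_weight \<alpha>)" "f 0 = 1"
      "power_integral p \<alpha> f \<le> ennreal 0" by (auto simp: add_nonneg_pos)
    then show False using integral_pos_of_value_at_zero[where \<alpha> = \<alpha>, OF p \<alpha> f(1,2)] by simp
  qed
  then obtain e where e: "E = ennreal e" "0 \<le> e" by (cases E) auto
  have "0 < E"
  proof -
    obtain \<phi> where \<phi>: "\<phi> \<in> exp_type V" "\<phi> (cx 0) = 1" "power_integral p \<alpha> (\<lambda>x. \<phi> (cx x)) < \<infinity>"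
      using nontrivial_function[where \<alpha> = \<alpha>, OF p \<alpha>] by blast
    have h: "real_restriction \<phi> \<in> BL V p (power_weight \<alpha>)" by (rule mem_BL_intro[OF \<phi>(1) p \<phi>(3)])
    have h0: "real_restriction \<phi> 0 = 1" using \<phi>(2) by (simp add: real_restriction_eq)
    obtain \<psi> where "Lnorm p (power_weight \<alpha>) UNIV (real_restriction \<phi>) < \<infinity>" using BL_elim[OF h] by blast
    then have "0 < ennreal (cmod (real_restriction \<phi> 0)) / Lnorm p (power_weight \<alpha>) UNIV (real_restriction \<phi>)"
      unfolding h0 by (simp add: ennreal_zero_less_divide)
    also have "\<dots> \<le> E" unfolding E_def using h h0 by (intro quotient_le_N0_BL) auto
    finally show ?thesis .
  qed
  then have e0: "0 < e" using e by simp
  have lim: "(M \<longlongrightarrow> E) at_top"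
  proof (rule order_tendstoI)
    fix l assume "l < E"
    then obtain K where K: "l < ennreal K" "ennreal K < E" "0 \<le> K"
    proof -
      obtain k where k: "l < k" "k < E" using dense[OF \<open>l < E\<close>] by blast
      then have "k < top" using less_top order_less_trans by fastforce
      then obtain K where "k = ennreal K" "0 \<le> K" by (cases k) auto
      then show thesis using that k by blast
    qed
    from low[OF K(3,2)] show "\<forall>\<^sub>F a in at_top. l < M a" by eventually_elim (use K(1) in \<open>rule less_le_trans\<close>)
  next
    fix u assume "E < u"
    then obtain k where k: "E < k" "k < u" using dense by blast
    then have "k < top" using less_le_trans top_greatest by blast
    then obtain c where c: "k = ennreal c" "0 \<le> c" by (cases k) auto
    have c0: "0 < c" using k(1) e e0 unfolding c by (simp add: ennreal_less_iff)
    show "\<forall>\<^sub>F a in at_top. M a < u"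
    proof (rule ccontr)
      assume "\<not> (\<forall>\<^sub>F a in at_top. M a < u)"
      then have "\<forall>n. \<exists>a. real n \<le> a \<and> ennreal c < M a"
        unfolding eventually_at_top_linorder using k(2) unfolding c by (meson le_less_trans not_less less_le_trans)
      from choice[OF this] obtain a where a: "\<And>n. real n \<le> a n" "\<And>n. ennreal c < M (a n)" by blast
      have al: "filterlim a at_top sequentially"
        by (rule filterlim_at_top_mono[OF filterlim_real_sequentially]) (simp add: a(1))
      obtain f where f: "f \<in> BL V p (power_weight \<alpha>)" "f 0 = 1"
        "power_integral p \<alpha> f \<le> ennreal (c powr - p)"
        using up[OF al c0 tendsto_const a(2)] by blast
      have "ennreal c \<le> E" using order_trans[OF quot[OF c0 f] quotient_le_N0_BL[OF f(1)]] f(2) unfolding E_def by simp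
      then show False using k(1) unfolding c by simp
    qed
  qed
  \<comment> \<open>Constants below \<open>E\<close> that increase to it; the limit function obtained from them is extremal.\<close>
  define c where "c n = e * (1 - 1 / (real n + 2))" for n
  have c0: "0 < c n" "c n < e" for n
  proof -
    have "0 < 1 - 1 / (real n + 2)" "1 - 1 / (real n + 2) < 1" by (auto simp: field_simps)
    then show "0 < c n" "c n < e" using e0 by (auto simp: c_def)
  qed
  have "\<forall>n. \<exists>a. real n \<le> a \<and> ennreal (c n) < M a"
  proof
    fix n
    have "ennreal (c n) < E" unfolding e(1) using c0[of n] by (simp add: ennreal_less_iff)
    from order_tendstoD(1)[OF lim this] have "\<forall>\<^sub>F a in at_top. ennreal (c n) < M a \<and> real n \<le> a"
      using eventually_ge_at_top[of "real n"] by eventually_elim auto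
    from eventually_happens'[OF _ this] show "\<exists>a. real n \<le> a \<and> ennreal (c n) < M a" by auto
  qed
  from choice[OF this] obtain a where a: "\<And>n. real n \<le> a n" "\<And>n. ennreal (c n) < M (a n)" by blast
  have al: "filterlim a at_top sequentially"
    by (rule filterlim_at_top_mono[OF filterlim_real_sequentially]) (simp add: a(1))
  have "(\<lambda>n. 1 - 1 / (real n + 2)) \<longlonglongrightarrow> 1" by real_asymp
  then have "c \<longlonglongrightarrow> e * 1" unfolding c_def by (intro tendsto_intros)
  then have "(\<lambda>n. c n powr - p) \<longlonglongrightarrow> e powr - p" using e0 by (intro tendsto_powr) auto
  from up[OF al c0(1) this a(2)] obtain f where f: "f \<in> BL V p (power_weight \<alpha>)" "f 0 = 1"
    "power_integral p \<alpha> f \<le> ennreal (e powr - p)" by blast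
  have "ennreal (cmod (f 0)) / Lnorm p (power_weight \<alpha>) UNIV f = E"
  proof (rule antisym)
    show "ennreal (cmod (f 0)) / Lnorm p (power_weight \<alpha>) UNIV f \<le> E" unfolding E_def using f by (intro quotient_le_N0_BL) auto
    show "E \<le> ennreal (cmod (f 0)) / Lnorm p (power_weight \<alpha>) UNIV f" unfolding e(1) by (rule quot[OF e0 f])
  qed
  then have "(M \<longlongrightarrow> ennreal (cmod (f 0)) / Lnorm p (power_weight \<alpha>) UNIV f) at_top" using lim by simp
  moreover have "f \<in> BL V p (power_weight \<alpha>) - {\<lambda>_. 0}" using f(1,2) by auto
  ultimately show ?thesis using lim by blast
qed

end

theorem theorem1p4:
  fixes V :: "(real ^ 'n) set" and p :: real and \<alpha> \<beta> :: "'n \<Rightarrow> real"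
  assumes "convex_body V" and "centrally_symmetric V" and "Pi_condition V"
    and "0 < p"
    and "\<And>j. 0 \<le> \<alpha> j" and "\<And>j. - 1 / 2 \<le> \<beta> j"
  shows "((\<lambda>a. ennreal (a powr (- (real CARD('n) + (\<Sum>j\<in>UNIV. \<alpha> j)) / p)) *
              N0 (polys a V) p (jacobi_weight \<alpha> \<beta>) cube)
            \<longlongrightarrow> N0 (BL V p (power_weight \<alpha>)) p (power_weight \<alpha>) UNIV) at_top \<and>
         (\<exists>f\<^sub>0 \<in> BL V p (power_weight \<alpha>) - {\<lambda>_. 0}.
           ((\<lambda>a. ennreal (a powr (- (real CARD('n) + (\<Sum>j\<in>UNIV. \<alpha> j)) / p)) *
              N0 (polys a V) p (jacobi_weight \<alpha> \<beta>) cube)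
            \<longlongrightarrow> ennreal (cmod (f\<^sub>0 0)) / Lnorm p (power_weight \<alpha>) UNIV f\<^sub>0) at_top)"
proof -
  obtain r R where "solid_body V r R" using solid_body_exists[OF assms(1,3)] by blast
  then interpret solid_body V r R .
  show ?thesis by (rule limit_and_extremal_function[OF assms(4-6)])
qed

end
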